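(* Let $\Omega$ be an associative $\mathbb{C}$-algebra of finite or countable dimension (possibly not unital) and let $d\ge1$ be an integer. Let $X$ be any basis of $\Omega$, let $W(X):=\bigsqcup_{m=1}^\infty X^m$, let $\prec$ be any total order on the set of triples $(i,j,\mathbf{x})$ with $i,j\in\{1,\dots,d\}$ and $\mathbf{x}\in W(X)$, and let $s\in\mathbb{C}$ be any fixed number. Call a product $$t_{i_1j_1}(\mathbf{x}^1;s)\cdots t_{i_rj_r}(\mathbf{x}^r;s),\qquad r\ge1,\quad i_k,j_k\in\{1,\dots,d\},\quad \mathbf{x}^1,\dots,\mathbf{x}^r\in W(X),$$ an ordered monomial if the triples $(i_1,j_1,\mathbf{x}^1),\dots,(i_r,j_r,\mathbf{x}^r)$ weakly increase with respect to $\prec$. Then the ordered monomials together with $1$ form a basis of the algebra $Y_d(\Omega)$.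
   Context: The Lie algebra $\mathfrak{gl}(N,\Omega)=\mathrm{Mat}(N,\mathbb{C})\otimes\Omega$ carries the commutator bracket; with $E_{ij}$ the matrix units ($1\le i,j\le N$) and $E_{ij}(x):=E_{ij}\otimes x$, one has $[E_{ij}(x),E_{kl}(y)]=\delta_{kj}E_{il}(xy)-\delta_{il}E_{kj}(yx)$. The Lie algebra $\mathfrak{gl}(N,\mathbb{C})$ acts on $\mathfrak{gl}(N,\Omega)=\mathfrak{gl}(N,\mathbb{C})\otimes\Omega$ by $\mathrm{ad}\otimes\mathrm{Id}$, i.e. $[E_{ij},E_{kl}(y)]=\delta_{kj}E_{il}(y)-\delta_{il}E_{kj}(y)$ (even if $\Omega$ is not unital); this action is by derivations and extends to the universal enveloping algebra $\mathcal{U}(\mathfrak{gl}(N,\Omega))$ by derivations. By convention $\mathcal{U}(\mathfrak{gl}(0,\Omega))=\mathbb{C}$. For $0\le d\le N$ let $\mathfrak{gl}_d(N,\mathbb{C})\subset\mathfrak{gl}(N,\mathbb{C})$ be the span of the $E_{ij}$ with $d+1\le i,j\le N$, and let $A_d(\Omega;N):=\mathcal{U}(\mathfrak{gl}(N,\Omega))^{\mathfrak{gl}_d(N,\mathbb{C})}$ be the subalgebra of invariants. Let $I^+(N)$ be the left ideal of $\mathcal{U}(\mathfrak{gl}(N,\Omega))$ generated by all $E_{iN}(x)$, $1\le i\le N$, $x\in\Omega$, and $I^-(N)$ the right ideal generated by all $E_{Nj}(x)$, $1\le j\le N$, $x\in\Omega$. Let $\mathcal{U}(\mathfrak{gl}(N,\Omega))^{E_{NN}}$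 be the subalgebra of elements annihilated by $[E_{NN},-]$. Its intersections with $I^+(N)$ and $I^-(N)$ coincide; the common intersection $L(N)$ is a two-sided ideal in it, and $\mathcal{U}(\mathfrak{gl}(N,\Omega))^{E_{NN}}=\mathcal{U}(\mathfrak{gl}(N-1,\Omega))\oplus L(N)$. Let $\pi_{N,N-1}\colon\mathcal{U}(\mathfrak{gl}(N,\Omega))^{E_{NN}}\to\mathcal{U}(\mathfrak{gl}(N-1,\Omega))$ be the projection along $L(N)$; it is a homomorphism of filtered algebras, and for $N>d$ it maps $A_d(\Omega;N)$ into $A_d(\Omega;N-1)$. $A_d(\Omega):=\varprojlim(A_d(\Omega;N),\pi_{N,N-1})$, the limit taken in the category of filtered algebras with respect to the canonical filtrations of universal enveloping algebras: its elements are sequences $\mathbf{a}=\{\mathbf{a}(N)\colon N\ge d\}$ with $\mathbf{a}(N)\in A_d(\Omega;N)$, $\pi_{N,N-1}(\mathbf{a}(N))=\mathbf{a}(N-1)$ for $N>d$, and $\deg\mathbf{a}(N)$ bounded uniformly in $N$. Let $\pi_{\infty,N}\colon A_d(\Omega)\to A_d(\Omega;N)$, $\mathbf{a}\mapsto\mathbf{a}(N)$. Let $W(\Omega):=\bigsqcup_{m\ge1}\Omega^m$ (ordered tuples of elements of $\Omega$), and $\ell(\mathbf{x}):=m$ for $\mathbf{x}\in\Omega^m$. For $\mathbf{x}=(x_1,\dots,x_m)$ and $N\ge\max(i,j)$ put $e_{ij}(\mathbf{x};N):=\sum_{a_1,\dots,a_{m-1}=1}^N E_{ia_1}(x_1)E_{a_1a_2}(x_2)\cdots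 E_{a_{m-1}j}(x_m)$ (equal to $E_{ij}(x_1)$ if $m=1$). $\mathrm{Comp}(m)$ is the set of compositions $\nu=(\nu_1,\dots,\nu_n)$ of $m$ (positive integers with sum $m$). For $\mathbf{x}\in\Omega^m$ and $\nu\in\mathrm{Comp}(m)$ of length $n$, $\mathbf{x}\rhd\nu:=(y_1,\dots,y_n)\in\Omega^n$, where $y_1=x_1\cdots x_{\nu_1}$, $y_2=x_{\nu_1+1}\cdots x_{\nu_1+\nu_2}$, ..., $y_n=x_{\nu_1+\dots+\nu_{n-1}+1}\cdots x_m$ (products in $\Omega$). For $s\in\mathbb{C}$ and $\mathbf{x}\in\Omega^m$, $$t_{ij}(\mathbf{x};N;s):=\sum_{\nu\in\mathrm{Comp}(m)}(-N-s)^{\ell(\mathbf{x})-\ell(\mathbf{x}\rhd\nu)}e_{ij}(\mathbf{x}\rhd\nu;N),\qquad 0^0:=1.$$ For $i,j\in\{1,\dots,d\}$ there is a unique element $t_{ij}(\mathbf{x};s)\in A_d(\Omega)$ with $\pi_{\infty,N}(t_{ij}(\mathbf{x};s))=t_{ij}(\mathbf{x};N;s)$ for all $N\ge d$. For $d\ge1$, $Y_d(\Omega)$ is the unital subalgebra of $A_d(\Omega)$ generated by all $t_{ij}(\mathbf{x};s)$ with $i,j\in\{1,\dots,d\}$, $\mathbf{x}\in W(\Omega)$, where $s\in\mathbb{C}$ is an arbitrary fixed number (the subalgebra does not depend on the choice of $s$). *)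

theory Defs
  imports Complex_Main "HOL-Library.Countable_Set" "HOL-Library.Poly_Mapping" "HOL-Algebra.Subrings" "HOL-Algebra.Module"
begin

section \<open>Associative complex algebras, possibly without unit\<close>

class nonunital_complex_algebra = ring +
  fixes scaleC :: "complex \<Rightarrow> 'a \<Rightarrow> 'a"
  assumes scaleC_add_right: "scaleC c (x + y) = scaleC c x + scaleC c y"
    and scaleC_add_left: "scaleC (b + c) x = scaleC b x + scaleC c x"
    and scaleC_scaleC: "scaleC b (scaleC c x) = scaleC (b * c) x"
    and scaleC_one: "scaleC 1 x = x"
    and scaleC_mult_left: "scaleC c x * y = scaleC c (x * y)"
    and scaleC_mult_right: "x * scaleC c y = scaleC c (x * y)"

global_interpretation nuca: vector_space "scaleC :: complex \<Rightarrow> 'a \<Rightarrow> 'a::nonunital_complex_algebra"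
  by unfold_locales
    (simp_all add: scaleC_add_right scaleC_add_left scaleC_scaleC scaleC_one)

definition is_linear_basis :: "'w::nonunital_complex_algebra set \<Rightarrow> bool" where
  "is_linear_basis X \<longleftrightarrow> module.independent scaleC X \<and> module.span scaleC X = UNIV"


section \<open>Free unital algebras and universal enveloping algebras\<close>

text \<open>The wrapper around lists carries the free monoid structure (written additively), so that
  the product of finitely supported functions on words is the product of the free algebra.\<close>

datatype 'g fmon = Word (letters: "'g list")

instantiation fmon :: (type) monoid_add
begin

definition zero_fmon :: "'g fmon" where "zero_fmon = Word []"

definition plus_fmon :: "'g fmon \<Rightarrow> 'g fmon \<Rightarrow> 'g fmon" where
  "plus_fmon u v = Word (letters u @ letters v)"

instance
  by intro_classes (simp_all add: zero_fmon_def plus_fmon_def)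

end

type_synonym 'g falg = "'g fmon \<Rightarrow>\<^sub>0 complex"

definition gen :: "'g \<Rightarrow> 'g falg" where
  "gen x = Poly_Mapping.single (Word [x]) 1"

definition cst :: "complex \<Rightarrow> 'g falg" where
  "cst c = Poly_Mapping.single 0 c"

definition free_alg :: "'g set \<Rightarrow> 'g falg ring" where
  "free_alg L =
    \<lparr>carrier = {p. \<forall>w\<in>Poly_Mapping.keys p. set (letters w) \<subseteq> L}, mult = (*), one = 1, zero = 0, add = (+)\<rparr>"

lemma ring_free_alg: "ring (free_alg L)"
proof (rule ringI)
  have mult_closed: "p * q \<in> carrier (free_alg L)"
    if "p \<in> carrier (free_alg L)" "q \<in> carrier (free_alg L)" for p q
    using that keys_mult[of p q] by (fastforce simp: free_alg_def plus_fmon_def)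
  have add_closed: "p + q \<in> carrier (free_alg L)"
    if "p \<in> carrier (free_alg L)" "q \<in> carrier (free_alg L)" for p q
    using that Poly_Mapping.keys_add[of p q] by (fastforce simp: free_alg_def)
  show "abelian_group (free_alg L)"
  proof (rule abelian_groupI)
    fix p assume "p \<in> carrier (free_alg L)"
    then have "- p \<in> carrier (free_alg L)" "- p \<oplus>\<^bsub>free_alg L\<^esub> p = \<zero>\<^bsub>free_alg L\<^esub>"
      by (simp_all add: free_alg_def)
    then show "\<exists>q\<in>carrier (free_alg L). q \<oplus>\<^bsub>free_alg L\<^esub> p = \<zero>\<^bsub>free_alg L\<^esub>"
      by blast
  next
    fix p q assume "p \<in> carrier (free_alg L)" "q \<in> carrier (free_alg L)"
    then show "p \<oplus>\<^bsub>free_alg L\<^esub> q \<in> carrier (free_alg L)"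
      using add_closed[of p q] by (simp add: free_alg_def)
  qed (auto simp: free_alg_def add.assoc add.commute)
  show "monoid (free_alg L)"
  proof (rule monoidI)
    fix p q assume "p \<in> carrier (free_alg L)" "q \<in> carrier (free_alg L)"
    then show "p \<otimes>\<^bsub>free_alg L\<^esub> q \<in> carrier (free_alg L)"
      using mult_closed[of p q] by (simp add: free_alg_def)
  qed (auto simp: free_alg_def mult.assoc zero_fmon_def)
qed (auto simp: free_alg_def distrib_left distrib_right)

text \<open>\<open>L\<close> is the underlying set of a complex Lie algebra with scalar multiplication \<open>sc\<close> and
  bracket \<open>br\<close>.  Its enveloping algebra is presented with one generator for each element of \<open>L\<close>;
  the first two families of relations make \<open>L\<close> embed linearly, the third one identifies
  brackets with commutators.\<close>

definition uea_relations ::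
    "'g::ab_group_add set \<Rightarrow> (complex \<Rightarrow> 'g \<Rightarrow> 'g) \<Rightarrow> ('g \<Rightarrow> 'g \<Rightarrow> 'g) \<Rightarrow> 'g falg set" where
  "uea_relations L sc br =
     {gen (x + y) - gen x - gen y | x y. x \<in> L \<and> y \<in> L} \<union>
     {gen (sc c x) - cst c * gen x | c x. x \<in> L} \<union>
     {gen x * gen y - gen y * gen x - gen (br x y) | x y. x \<in> L \<and> y \<in> L}"

definition uea_ideal ::
    "'g::ab_group_add set \<Rightarrow> (complex \<Rightarrow> 'g \<Rightarrow> 'g) \<Rightarrow> ('g \<Rightarrow> 'g \<Rightarrow> 'g) \<Rightarrow> 'g falg set" where
  "uea_ideal L sc br = Idl\<^bsub>free_alg L\<^esub> (uea_relations L sc br)"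

definition uea ::
    "'g::ab_group_add set \<Rightarrow> (complex \<Rightarrow> 'g \<Rightarrow> 'g) \<Rightarrow> ('g \<Rightarrow> 'g \<Rightarrow> 'g) \<Rightarrow> (complex, 'g falg set) module" where
  "uea L sc br = (let J = uea_ideal L sc br; Q = free_alg L Quot J in
     \<lparr>carrier = carrier Q, mult = mult Q, one = one Q, zero = zero Q, add = add Q,
      smult = (\<lambda>c a. (J +>\<^bsub>free_alg L\<^esub> cst c) \<otimes>\<^bsub>Q\<^esub> a)\<rparr>)"

text \<open>The derivation of the free algebra that maps \<open>gen x\<close> to \<open>gen (D x)\<close>.\<close>

definition word_derivation :: "('g \<Rightarrow> 'g) \<Rightarrow> 'g falg \<Rightarrow> 'g falg" where
  "word_derivation D p =
     (\<Sum>w\<in>Poly_Mapping.keys p. \<Sum>k<length (letters w).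
        Poly_Mapping.single (Word ((letters w)[k := D (letters w ! k)])) (Poly_Mapping.lookup p w))"


section \<open>Matrices and the Lie algebra gl(N,\<open>\<Omega>\<close>)\<close>

text \<open>Matrices are finitely supported families of entries, with rows and columns numbered
  from 1.  Thus \<open>gl (N - 1) \<subseteq> gl N\<close> is the usual upper left corner embedding.\<close>

type_synonym 'a matr = "nat \<times> nat \<Rightarrow>\<^sub>0 'a"

definition Emat :: "nat \<Rightarrow> nat \<Rightarrow> 'a::zero \<Rightarrow> 'a matr" where
  "Emat i j x = Poly_Mapping.single (i, j) x"

definition gl :: "nat \<Rightarrow> 'a::zero matr set" where
  "gl N = {A. Poly_Mapping.keys A \<subseteq> {1..N} \<times> {1..N}}"

text \<open>The matrix product with respect to a product \<open>f\<close> of entries; besides the product of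
  \<open>\<Omega>\<close> it is used with scalar multiplication, where one factor is a complex matrix.\<close>

definition mat_prod ::
    "('a::zero \<Rightarrow> 'b::zero \<Rightarrow> 'c::comm_monoid_add) \<Rightarrow> 'a matr \<Rightarrow> 'b matr \<Rightarrow> 'c matr" where
  "mat_prod f A B = (\<Sum>(i, a)\<in>Poly_Mapping.keys A. \<Sum>(b, j)\<in>Poly_Mapping.keys B.
     if a = b then Emat i j (f (Poly_Mapping.lookup A (i, a)) (Poly_Mapping.lookup B (b, j))) else 0)"

definition mat_scale :: "complex \<Rightarrow> 'w::nonunital_complex_algebra matr \<Rightarrow> 'w matr" where
  "mat_scale c = Poly_Mapping.map (scaleC c)"

definition gl_bracket :: "'w::nonunital_complex_algebra matr \<Rightarrow> 'w matr \<Rightarrow> 'w matr" where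
  "gl_bracket A B = mat_prod (*) A B - mat_prod (*) B A"

text \<open>The action \<open>ad \<otimes> Id\<close> of complex matrices.\<close>

definition gl_ad :: "complex matr \<Rightarrow> 'w::nonunital_complex_algebra matr \<Rightarrow> 'w matr" where
  "gl_ad A Z = mat_prod scaleC A Z - mat_prod (\<lambda>z c. scaleC c z) Z A"

lemma mat_prod_Emat:
  assumes "\<And>x. f 0 x = 0" and "\<And>x. f x 0 = 0"
  shows "mat_prod f (Emat i j x) (Emat k l y) = (if j = k then Emat i l (f x y) else 0)"
  using assms by (auto simp: mat_prod_def Emat_def)

lemma gl_bracket_Emat:
  "gl_bracket (Emat i j x) (Emat k l y) =
     (if k = j then Emat i l (x * y) else 0) - (if i = l then Emat k j (y * x) else 0)"
  by (auto simp: gl_bracket_def mat_prod_Emat)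

lemma gl_ad_Emat:
  "gl_ad (Emat i j 1) (Emat k l y) =
     (if k = j then Emat i l y else 0) - (if i = l then Emat k j y else 0)"
  by (auto simp: gl_ad_def mat_prod_Emat scaleC_one)


section \<open>The algebras U(gl(N,\<open>\<Omega>\<close>)) and their subspaces\<close>

abbreviation Ufree :: "nat \<Rightarrow> 'w::nonunital_complex_algebra matr falg ring" where
  "Ufree N \<equiv> free_alg (gl N)"

abbreviation Uideal :: "nat \<Rightarrow> 'w::nonunital_complex_algebra matr falg set" where
  "Uideal N \<equiv> uea_ideal (gl N) mat_scale gl_bracket"

abbreviation Ugl :: "nat \<Rightarrow> (complex, 'w::nonunital_complex_algebra matr falg set) module" where
  "Ugl N \<equiv> uea (gl N) mat_scale gl_bracket"

definition cls :: "nat \<Rightarrow> 'w::nonunital_complex_algebra matr falg \<Rightarrow> 'w matr falg set" where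
  "cls N p = Uideal N +>\<^bsub>Ufree N\<^esub> p"

text \<open>The map on classes induced by a map \<open>h\<close> on representatives: if \<open>h\<close> respects the
  congruences, all members of the union are equal.\<close>

definition induced ::
    "nat \<Rightarrow> ('w::nonunital_complex_algebra matr falg \<Rightarrow> 'w matr falg) \<Rightarrow> 'w matr falg set \<Rightarrow> 'w matr falg set" where
  "induced N h a = (\<Union>p\<in>a. cls N (h p))"

text \<open>The canonical map U(gl(N-1,\<open>\<Omega>\<close>)) to U(gl(N,\<open>\<Omega>\<close>)).\<close>

definition emb :: "nat \<Rightarrow> 'w::nonunital_complex_algebra matr falg set \<Rightarrow> 'w matr falg set" where
  "emb N = induced N (\<lambda>p. p)"

definition act ::
    "nat \<Rightarrow> complex matr \<Rightarrow> 'w::nonunital_complex_algebra matr falg set \<Rightarrow> 'w matr falg set" where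
  "act N A = induced N (word_derivation (gl_ad A))"

text \<open>The canonical filtration: \<open>U_filt N k\<close> consists of the elements of degree at most \<open>k\<close>.\<close>

definition U_filt :: "nat \<Rightarrow> nat \<Rightarrow> 'w::nonunital_complex_algebra matr falg set set" where
  "U_filt N k = {cls N p | p. p \<in> carrier (Ufree N) \<and> (\<forall>w\<in>Poly_Mapping.keys p. length (letters w) \<le> k)}"

definition gl_sub :: "nat \<Rightarrow> nat \<Rightarrow> complex matr set" where
  "gl_sub d N = {A. Poly_Mapping.keys A \<subseteq> {d+1..N} \<times> {d+1..N}}"

definition A_fin :: "nat \<Rightarrow> nat \<Rightarrow> 'w::nonunital_complex_algebra matr falg set set" where
  "A_fin d N = {a \<in> carrier (Ugl N). \<forall>A\<in>gl_sub d N. act N A a = \<zero>\<^bsub>Ugl N\<^esub>}"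

definition left_ideal :: "'a set \<Rightarrow> ('a, 'm) ring_scheme \<Rightarrow> bool" where
  "left_ideal I R \<longleftrightarrow> additive_subgroup I R \<and> (\<forall>a\<in>carrier R. \<forall>x\<in>I. a \<otimes>\<^bsub>R\<^esub> x \<in> I)"

definition right_ideal :: "'a set \<Rightarrow> ('a, 'm) ring_scheme \<Rightarrow> bool" where
  "right_ideal I R \<longleftrightarrow> additive_subgroup I R \<and> (\<forall>a\<in>carrier R. \<forall>x\<in>I. x \<otimes>\<^bsub>R\<^esub> a \<in> I)"

definition I_plus :: "nat \<Rightarrow> 'w::nonunital_complex_algebra matr falg set set" where
  "I_plus N = \<Inter>{I. left_ideal I (Ugl N) \<and> {cls N (gen (Emat i N x)) | i x. i \<in> {1..N}} \<subseteq> I}"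

definition I_minus :: "nat \<Rightarrow> 'w::nonunital_complex_algebra matr falg set set" where
  "I_minus N = \<Inter>{I. right_ideal I (Ugl N) \<and> {cls N (gen (Emat N j x)) | j x. j \<in> {1..N}} \<subseteq> I}"

definition U_ENN :: "nat \<Rightarrow> 'w::nonunital_complex_algebra matr falg set set" where
  "U_ENN N = {a \<in> carrier (Ugl N). act N (Emat N N 1) a = \<zero>\<^bsub>Ugl N\<^esub>}"

text \<open>The intersections of \<open>U_ENN N\<close> with \<open>I_plus N\<close> and with \<open>I_minus N\<close> coincide.\<close>

definition L_ideal :: "nat \<Rightarrow> 'w::nonunital_complex_algebra matr falg set set" where
  "L_ideal N = U_ENN N \<inter> I_plus N \<inter> I_minus N"

text \<open>\<open>proj N\<close> is \<open>\<pi>\<^bsub>N,N-1\<^esub>\<close>, the projection of \<open>U_ENN N = emb N (Ugl (N - 1)) \<oplus> L_ideal N\<close>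
  to the first summand, defined for \<open>N \<ge> 1\<close>.\<close>

definition proj :: "nat \<Rightarrow> 'w::nonunital_complex_algebra matr falg set \<Rightarrow> 'w matr falg set" where
  "proj N a = (THE b. b \<in> carrier (Ugl (N - 1)) \<and> (\<exists>l\<in>L_ideal N. a = emb N b \<oplus>\<^bsub>Ugl N\<^esub> l))"


section \<open>The limit algebra\<close>

definition A_alg :: "nat \<Rightarrow> (complex, nat \<Rightarrow> 'w::nonunital_complex_algebra matr falg set) module" where
  "A_alg d =
     \<lparr>carrier = {a \<in> (\<Pi>\<^sub>E N\<in>{d..}. A_fin d N).
        (\<forall>N>d. proj N (a N) = a (N - 1)) \<and> (\<exists>k. \<forall>N\<ge>d. a N \<in> U_filt N k)},
      mult = (\<lambda>a b. \<lambda>N\<in>{d..}. a N \<otimes>\<^bsub>Ugl N\<^esub> b N),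
      one = (\<lambda>N\<in>{d..}. \<one>\<^bsub>Ugl N\<^esub>),
      zero = (\<lambda>N\<in>{d..}. \<zero>\<^bsub>Ugl N\<^esub>),
      add = (\<lambda>a b. \<lambda>N\<in>{d..}. a N \<oplus>\<^bsub>Ugl N\<^esub> b N),
      smult = (\<lambda>c a. \<lambda>N\<in>{d..}. c \<odot>\<^bsub>Ugl N\<^esub> a N)\<rparr>"


section \<open>The elements \<open>t\<^sub>i\<^sub>j(x;s)\<close> and the algebra \<open>Y\<^sub>d\<close>\<close>

text \<open>\<open>words X\<close> is the set W(X) of nonempty tuples of elements of \<open>X\<close>.\<close>

definition words :: "'w set \<Rightarrow> 'w list set" where
  "words X = {xs. xs \<noteq> [] \<and> set xs \<subseteq> X}"

definition compositions :: "nat \<Rightarrow> nat list set" where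
  "compositions m = {\<nu>. (\<forall>k\<in>set \<nu>. 0 < k) \<and> sum_list \<nu> = m}"

text \<open>The product of a nonempty tuple; the value at the empty one is irrelevant.\<close>

fun prod_tuple :: "'w::ring list \<Rightarrow> 'w" where
  "prod_tuple [] = 0"
| "prod_tuple [x] = x"
| "prod_tuple (x # y # ys) = x * prod_tuple (y # ys)"

fun contract :: "'w::ring list \<Rightarrow> nat list \<Rightarrow> 'w list" (infixl \<open>\<rhd>\<close> 70) where
  "xs \<rhd> [] = []"
| "xs \<rhd> (n # \<nu>) = prod_tuple (take n xs) # (drop n xs \<rhd> \<nu>)"

text \<open>In \<open>e_free\<close> the tuple \<open>as\<close> is \<open>(a\<^sub>1, \<dots>, a\<^bsub>m-1\<^esub>)\<close>, padded by \<open>i\<close> and \<open>j\<close>.\<close>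

definition e_free ::
    "nat \<Rightarrow> nat \<Rightarrow> nat \<Rightarrow> 'w::nonunital_complex_algebra list \<Rightarrow> 'w matr falg" where
  "e_free N i j xs = (\<Sum>as\<in>{as. length as = length xs - 1 \<and> set as \<subseteq> {1..N}}.
     \<Prod>k\<leftarrow>[0..<length xs].
        gen (Emat ((i # as @ [j]) ! k) ((i # as @ [j]) ! (k + 1)) (xs ! k)))"

definition t_fin ::
    "complex \<Rightarrow> nat \<Rightarrow> nat \<Rightarrow> nat \<Rightarrow> 'w::nonunital_complex_algebra list \<Rightarrow> 'w matr falg set" where
  "t_fin s N i j xs = cls N (\<Sum>\<nu>\<in>compositions (length xs).
     cst ((- of_nat N - s) ^ (length xs - length (xs \<rhd> \<nu>))) * e_free N i j (xs \<rhd> \<nu>))"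

definition t_elem ::
    "nat \<Rightarrow> complex \<Rightarrow> nat \<times> nat \<times> 'w::nonunital_complex_algebra list \<Rightarrow> nat \<Rightarrow> 'w matr falg set" where
  "t_elem d s = (\<lambda>(i, j, xs). \<lambda>N\<in>{d..}. t_fin s N i j xs)"

definition triples :: "nat \<Rightarrow> 'w set \<Rightarrow> (nat \<times> nat \<times> 'w list) set" where
  "triples d X = {1..d} \<times> {1..d} \<times> words X"

definition generated_subalgebra :: "(complex, 'b) module \<Rightarrow> 'b set \<Rightarrow> 'b set" where
  "generated_subalgebra A S =
     \<Inter>{B. subring B A \<and> (\<forall>c. \<forall>b\<in>B. c \<odot>\<^bsub>A\<^esub> b \<in> B) \<and> S \<subseteq> B}"

definition Y_alg :: "nat \<Rightarrow> complex \<Rightarrow> (nat \<Rightarrow> 'w::nonunital_complex_algebra matr falg set) set" where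
  "Y_alg d s = generated_subalgebra (A_alg d) (t_elem d s ` triples d UNIV)"

text \<open>The empty list gives the monomial 1.\<close>

definition t_monomial ::
    "nat \<Rightarrow> complex \<Rightarrow> (nat \<times> nat \<times> 'w::nonunital_complex_algebra list) list
      \<Rightarrow> nat \<Rightarrow> 'w matr falg set" where
  "t_monomial d s ts = foldr (\<lambda>t a. t_elem d s t \<otimes>\<^bsub>A_alg d\<^esub> a) ts \<one>\<^bsub>A_alg d\<^esub>"

definition weakly_increasing_lists :: "('t \<times> 't) set \<Rightarrow> 't set \<Rightarrow> 't list set" where
  "weakly_increasing_lists r T = {ts. set ts \<subseteq> T \<and> sorted_wrt (\<lambda>t t'. (t, t') \<in> r) ts}"


section \<open>Bases\<close>

definition lin_comb :: "(complex, 'b) module \<Rightarrow> ('i \<Rightarrow> 'b) \<Rightarrow> ('i \<Rightarrow>\<^sub>0 complex) \<Rightarrow> 'b" where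
  "lin_comb M f c = (\<Oplus>\<^bsub>M\<^esub>i\<in>Poly_Mapping.keys c. Poly_Mapping.lookup c i \<odot>\<^bsub>M\<^esub> f i)"

text \<open>The family \<open>f\<close> indexed by \<open>I\<close> is a basis of the subspace \<open>B\<close> of \<open>M\<close>; in particular
  \<open>f\<close> is injective on \<open>I\<close>.\<close>

definition is_basis_family ::
    "(complex, 'b) module \<Rightarrow> 'b set \<Rightarrow> 'i set \<Rightarrow> ('i \<Rightarrow> 'b) \<Rightarrow> bool" where
  "is_basis_family M B I f \<longleftrightarrow>
     f ` I \<subseteq> B \<and>
     (\<forall>c. Poly_Mapping.keys c \<subseteq> I \<and> lin_comb M f c = \<zero>\<^bsub>M\<^esub> \<longrightarrow> c = 0) \<and>
     (\<forall>b\<in>B. \<exists>c. Poly_Mapping.keys c \<subseteq> I \<and> b = lin_comb M f c)"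

end

theory Submission
  imports Defs "HOL-Library.Multiset"
begin

text \<open>For the Lie algebra of an associative algebra the Poincare-Birkhoff-Witt theorem is elementary:
  a linear form \<open>f\<close> on the associative algebra extends to the functional \<open>x\<^sub>1 \<dots> x\<^sub>m \<mapsto> f (x\<^sub>1 \<cdot> \<dots> \<cdot> x\<^sub>m)\<close>
  (0 on the empty word) of the enveloping algebra, and the convolution of \<open>k\<close> such functionals kills all
  words shorter than \<open>k\<close> and is a permanent on words of length \<open>k\<close>.

  These functionals also settle the independence of the ordered monomials at a single level
  \<open>N \<ge> d + K\<close>, where \<open>K\<close> bounds the total length of the words.  The top degree component of
  \<open>t\<^sub>i\<^sub>j(x;N;s)\<close> is a sum over labelled paths from \<open>i\<close> to \<open>j\<close>, and a monomial is recovered from the multiset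
  of edges of paths with pairwise distinct inner vertices outside \<open>{1..d}\<close>.

  For the spanning property, at a fixed level the parameter \<open>-N-s\<close> may be replaced by 0, and the
  commutator of \<open>e\<^sub>i\<^sub>j(x)\<close> and \<open>e\<^sub>k\<^sub>l(y)\<close> is a combination of products of such elements of smaller total
  length, so products can be sorted.  The resulting coefficients depend a priori on \<open>N\<close>.  But they are
  unique for large \<open>N\<close>, and the projections from level \<open>N\<close> to level \<open>N - 1\<close> respect the expansions;
  hence they are constant.\<close>

\<comment> \<open>Positivity carries the independence argument: on words of matrix units with basis
  entries the functionals take natural numbers as values. Contributions of different paths to a
  monomial therefore cannot cancel, and it suffices to know which of them are nonzero. The threshold
  \<open>d + K\<close> leaves room for enough vertices beyond \<open>d\<close> to keep the inner
  vertices of all paths of a monomial apart; since the bound \<open>K\<close> on the weight is the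
  same at every level, one threshold serves all \<open>N\<close>.

  Descending one level works because the left ideal generated by the last column meets the smaller
  algebra only in 0, which the functionals built from edges of the smaller level show.

  The parameter \<open>-N-s\<close> compensates for the additional summation index at level
  \<open>N + 1\<close>. Modulo the two ideals that index contributes exactly one more contracted
  word, so that \<open>c\<close> at level \<open>N + 1\<close> corresponds to \<open>c + 1\<close>
  at level \<open>N\<close>.\<close>
alias keys = Poly_Mapping.keys
alias lookup = Poly_Mapping.lookup
alias single = Poly_Mapping.single

section \<open>Finitely supported functions\<close>

lemma poly_mapping_sum_single:
  "(\<Sum>k\<in>keys p. single k (lookup p k)) = p"
  by (rule poly_mapping_eqI)
    (auto simp: lookup_sum lookup_single when_def in_keys_iff sum.delta[OF finite_keys] cong: if_cong)

lemma poly_mapping_single_add_induct [case_names single add]: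
  assumes "\<And>k c. P (single k c)" and "\<And>p q. P p \<Longrightarrow> P q \<Longrightarrow> P (p + q)"
  shows "P (p :: 'k \<Rightarrow>\<^sub>0 'c::comm_monoid_add)"
proof -
  have "P 0" using assms(1)[of undefined 0] by simp
  have "P (\<Sum>k\<in>A. single k (lookup p k))" if "finite A" for A :: "'k set"
    using that by (induction A rule: finite_induct) (auto intro: assms \<open>P 0\<close>)
  then show ?thesis by (metis poly_mapping_sum_single finite_keys)
qed

section \<open>Matrices\<close>

lemma finite_index_set:
  fixes A :: "'a::zero matr"
  obtains S where "finite S" "keys A \<subseteq> S \<times> S"
proof
  let ?S = "fst ` keys A \<union> snd ` keys A"
  show "finite ?S" by simp
  show "keys A \<subseteq> ?S \<times> ?S" by force
qed

lemma common_index_set: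
  fixes A :: "'a::zero matr" and B :: "'b::zero matr" and C :: "'c::zero matr"
  obtains S where "finite S" "keys A \<subseteq> S \<times> S" "keys B \<subseteq> S \<times> S" "keys C \<subseteq> S \<times> S"
proof -
  obtain S1 S2 S3 where S: "finite S1" "finite S2" "finite S3" "keys A \<subseteq> S1 \<times> S1"
    "keys B \<subseteq> S2 \<times> S2" "keys C \<subseteq> S3 \<times> S3"
    by (metis finite_index_set)
  show ?thesis by (rule that[of "S1 \<union> S2 \<union> S3"]) (use S in \<open>fast+\<close>)
qed

text \<open>\<open>mat_prod\<close> sums over the supports of its factors, which change under
  addition. Over a fixed index set \<open>S\<close> that contains them it becomes the usual row by
  column formula, and identities can be checked entrywise.\<close>

lemma lookup_mat_prod:
  fixes f :: "'a::zero \<Rightarrow> 'b::zero \<Rightarrow> 'c::comm_monoid_add"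
  assumes "\<And>x. f 0 x = 0" "\<And>x. f x 0 = 0" "finite S"
    and "keys A \<subseteq> S \<times> S" "keys B \<subseteq> S \<times> S"
  shows "lookup (mat_prod f A B) (i, j) =
     (\<Sum>k\<in>S. f (lookup A (i, k)) (lookup B (k, j)))"
proof -
  let ?A = "lookup A" and ?B = "lookup B"
  have dbl: "(\<Sum>p\<in>S\<times>S. g p) = (\<Sum>a\<in>S. \<Sum>k\<in>S. g (a, k))" for g :: "nat \<times> nat \<Rightarrow> 'c matr"
    by (simp add: sum.cartesian_product)
  have "mat_prod f A B = (\<Sum>p\<in>S\<times>S. \<Sum>q\<in>S\<times>S.
     if snd p = fst q then Emat (fst p) (snd q) (f (?A p) (?B q)) else 0)"
    unfolding mat_prod_def case_prod_beta using assms
    by (intro sum.mono_neutral_cong_left) (auto simp: in_keys_iff Emat_def intro!: sum.mono_neutral_cong_left sum.neutral)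
  also have "\<dots> = (\<Sum>a\<in>S. \<Sum>k\<in>S. \<Sum>l\<in>S. \<Sum>b\<in>S. if k = l then Emat a b (f (?A (a, k)) (?B (l, b))) else 0)"
    by (simp only: dbl fst_conv snd_conv)
  also have "\<dots> = (\<Sum>a\<in>S. \<Sum>k\<in>S. \<Sum>b\<in>S. \<Sum>l\<in>S. if k = l then Emat a b (f (?A (a, k)) (?B (l, b))) else 0)"
    by (intro sum.cong refl sum.swap)
  also have "\<dots> = (\<Sum>a\<in>S. \<Sum>k\<in>S. \<Sum>b\<in>S. Emat a b (f (?A (a, k)) (?B (k, b))))"
    using assms(3) by (simp add: sum.delta)
  finally have *: "mat_prod f A B = \<dots>" .
  have "lookup (mat_prod f A B) (i, j) =
      (\<Sum>a\<in>S. \<Sum>k\<in>S. \<Sum>b\<in>S. if a = i then if b = j then f (?A (a, k)) (?B (k, b)) else 0 else 0)"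
    unfolding * lookup_sum Emat_def by (intro sum.cong refl) (auto simp: lookup_single when_def)
  also have "\<dots> = (\<Sum>k\<in>S. \<Sum>a\<in>S. \<Sum>b\<in>S. if a = i then if b = j then f (?A (a, k)) (?B (k, b)) else 0 else 0)"
    by (rule sum.swap)
  also have "\<dots> = (\<Sum>k\<in>S. f (?A (i, k)) (?B (k, j)))"
  proof (rule sum.cong[OF refl])
    fix k
    have out: "f (?A (i, k)) (?B (k, j)) = 0" if "i \<notin> S \<or> j \<notin> S"
      using that assms(1,2,4,5)
      by (metis (no_types, lifting) in_keys_iff mem_Sigma_iff subset_iff)
    have "(\<Sum>a\<in>S. \<Sum>b\<in>S. if a = i then if b = j then f (?A (a, k)) (?B (k, b)) else 0 else 0)
       = (\<Sum>a\<in>S. if a = i then (\<Sum>b\<in>S. if b = j then f (?A (a, k)) (?B (k, b)) else 0) else 0)"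
      by (intro sum.cong refl) auto
    also have "\<dots> = f (?A (i, k)) (?B (k, j))" using assms(3) out by (auto simp: sum.delta)
    finally show "(\<Sum>a\<in>S. \<Sum>b\<in>S. if a = i then if b = j then f (?A (a, k)) (?B (k, b)) else 0 else 0) =
         f (?A (i, k)) (?B (k, j))" .
  qed
  finally show ?thesis .
qed

lemma keys_mat_prod:
  assumes "\<And>x. f 0 x = 0" "\<And>x. f x 0 = 0" "finite S"
    and "keys A \<subseteq> S \<times> S" "keys B \<subseteq> S \<times> S"
  shows "keys (mat_prod f A B) \<subseteq> S \<times> S"
proof
  fix p assume p: "p \<in> keys (mat_prod f A B)"
  obtain i j where ij: "p = (i, j)" by (cases p)
  from p have "lookup (mat_prod f A B) (i, j) \<noteq> 0" by (simp add: in_keys_iff ij)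
  then have "(\<Sum>k\<in>S. f (lookup A (i, k)) (lookup B (k, j))) \<noteq> 0"
    using lookup_mat_prod[where f=f, OF assms] by simp
  then obtain k where "f (lookup A (i, k)) (lookup B (k, j)) \<noteq> 0"
    by (meson sum.not_neutral_contains_not_neutral)
  with assms(1,2) have "(i, k) \<in> keys A" "(k, j) \<in> keys B"
    by (metis in_keys_iff)+
  then show "p \<in> S \<times> S" using assms(4,5) ij by auto
qed

lemma mat_prod_add_left:
  assumes "\<And>x y z. f (x + y) z = f x z + f y z" "\<And>x. f x 0 = 0"
  shows "mat_prod f (A + B) (C :: 'b::zero matr) = (mat_prod f A C + mat_prod f B C :: 'c::ab_group_add matr)"
proof (rule poly_mapping_eqI)
  fix p :: "nat \<times> nat"
  obtain i j where p: "p = (i, j)" by (cases p)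
  have f0: "\<And>x. f 0 x = 0" using assms(1)[of 0 0] by simp
  obtain S where k: "finite S" "keys A \<subseteq> S \<times> S" "keys B \<subseteq> S \<times> S" "keys C \<subseteq> S \<times> S"
    by (rule common_index_set)
  then have "keys (A + B) \<subseteq> S \<times> S" using Poly_Mapping.keys_add[of A B] by fast
  note k = k this
  show "lookup (mat_prod f (A + B) C) p = lookup (mat_prod f A C + mat_prod f B C) p"
    unfolding p lookup_add
    by (simp add: lookup_mat_prod[where f=f, OF f0 assms(2) k(1)] k lookup_add assms(1) sum.distrib)
qed

lemma mat_prod_add_right:
  assumes "\<And>x y z. f z (x + y) = f z x + f z y" "\<And>x. f 0 x = 0"
  shows "mat_prod f (C :: 'b::zero matr) (A + B) = (mat_prod f C A + mat_prod f C B :: 'c::ab_group_add matr)"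
proof (rule poly_mapping_eqI)
  fix p :: "nat \<times> nat"
  obtain i j where p: "p = (i, j)" by (cases p)
  have f0: "\<And>x. f x 0 = 0" using assms(1)[of _ 0 0] by simp
  obtain S where k: "finite S" "keys A \<subseteq> S \<times> S" "keys B \<subseteq> S \<times> S" "keys C \<subseteq> S \<times> S"
    by (rule common_index_set)
  then have "keys (A + B) \<subseteq> S \<times> S" using Poly_Mapping.keys_add[of A B] by fast
  note k = k this
  show "lookup (mat_prod f C (A + B)) p = lookup (mat_prod f C A + mat_prod f C B) p"
    unfolding p lookup_add
    by (simp add: lookup_mat_prod[where f=f, OF assms(2) f0 k(1)] k lookup_add assms(1) sum.distrib)
qed

lemma lookup_mat_scale:
  "lookup (mat_scale c A) p = scaleC c (lookup A p)"
  unfolding mat_scale_def by (simp add: Poly_Mapping.map.rep_eq when_def)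

lemma keys_mat_scale: "keys (mat_scale c A) \<subseteq> keys A"
  by (auto simp: in_keys_iff lookup_mat_scale)

lemma mat_scale_add: "mat_scale c (A + B) = mat_scale c A + mat_scale c B"
  by (rule poly_mapping_eqI) (simp add: lookup_mat_scale lookup_add scaleC_add_right)

lemma mat_scale_Emat: "mat_scale c (Emat i j x) = Emat i j (scaleC c x)"
  by (simp add: mat_scale_def Emat_def)

lemma Emat_add: "Emat i j (x + y) = Emat i j x + Emat i j y"
  by (simp add: Emat_def single_add)

lemma Emat_zero [simp]: "Emat i j 0 = 0"
  by (simp add: Emat_def)

text \<open>Four entry products are kept apart because the same argument serves associativity over
  \<Omega> and the compatibilities with complex matrices acting on either side.\<close>

lemma mat_prod_assoc:
  fixes f :: "'a::zero \<Rightarrow> 'b::zero \<Rightarrow> 'p::ab_group_add" and h :: "'p \<Rightarrow> 'c::zero \<Rightarrow> 'r::ab_group_add"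
    and f' :: "'a \<Rightarrow> 'q::ab_group_add \<Rightarrow> 'r" and h' :: "'b \<Rightarrow> 'c \<Rightarrow> 'q"
  assumes "\<And>x y z. h (f x y) z = f' x (h' y z)"
    and "\<And>x y z. h (x + y) z = h x z + h y z" "\<And>x y z. f' z (x + y) = f' z x + f' z y"
    and "\<And>x. f 0 x = 0" "\<And>x. f x 0 = 0" "\<And>x. h' 0 x = 0" "\<And>x. h' x 0 = 0" "\<And>x. h x 0 = 0" "\<And>x. f' 0 x = 0"
  shows "mat_prod h (mat_prod f A B) C = mat_prod f' A (mat_prod h' B C)"
proof (rule poly_mapping_eqI)
  fix p :: "nat \<times> nat"
  obtain i j where p: "p = (i, j)" by (cases p)
  have f0: "\<And>x. f' x 0 = 0" using assms(3)[of _ 0 0] by simp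
  have h0: "\<And>x. h 0 x = 0" using assms(2)[of 0 0] by simp
  have hs: "h (\<Sum>k\<in>T. g k) z = (\<Sum>k\<in>T. h (g k) z)" for g z and T :: "nat set"
    by (induction T rule: infinite_finite_induct) (auto simp: h0 assms)
  have fs: "f' z (\<Sum>k\<in>T. g k) = (\<Sum>k\<in>T. f' z (g k))" for g z and T :: "nat set"
    by (induction T rule: infinite_finite_induct) (auto simp: f0 assms)
  obtain S where k: "finite S" "keys A \<subseteq> S \<times> S" "keys B \<subseteq> S \<times> S" "keys C \<subseteq> S \<times> S"
    by (rule common_index_set)
  have k2: "keys (mat_prod f A B) \<subseteq> S \<times> S" "keys (mat_prod h' B C) \<subseteq> S \<times> S"
    by (intro keys_mat_prod assms k)+
  have "lookup (mat_prod h (mat_prod f A B) C) p =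
     (\<Sum>k\<in>S. \<Sum>l\<in>S. h (f (lookup A (i, l)) (lookup B (l, k))) (lookup C (k, j)))"
    unfolding p by (simp add: lookup_mat_prod[where f=h, OF h0 assms(8) k(1) k2(1) k(4)] lookup_mat_prod[where f=f, OF assms(4,5) k(1-3)] hs)
  also have "\<dots> = (\<Sum>l\<in>S. \<Sum>k\<in>S. f' (lookup A (i, l)) (h' (lookup B (l, k)) (lookup C (k, j))))"
    unfolding assms(1) by (rule sum.swap)
  also have "\<dots> = lookup (mat_prod f' A (mat_prod h' B C)) p"
    unfolding p by (simp add: lookup_mat_prod[where f=f', OF assms(9) f0 k(1,2) k2(2)] lookup_mat_prod[where f=h', OF assms(6,7) k(1,3,4)] fs)
  finally show "lookup (mat_prod h (mat_prod f A B) C) p = \<dots>" .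
qed

lemma scaleC_zero_right [simp]: "scaleC c 0 = 0"
  by (rule nuca.scale_zero_right)

section \<open>Products over \<Omega> and the action of complex matrices\<close>

abbreviation mmul :: "'w::nonunital_complex_algebra matr \<Rightarrow> 'w matr \<Rightarrow> 'w matr" where
  "mmul \<equiv> mat_prod (*)"

lemma mmul_add_left: "mmul (A + B) C = mmul A C + mmul B C"
  and mmul_add_right: "mmul C (A + B) = mmul C A + mmul C B"
  by (rule mat_prod_add_left mat_prod_add_right; simp add: distrib_left distrib_right)+

lemma mmul_diff_left: "mmul (A - B) C = mmul A C - mmul B C"
  and mmul_diff_right: "mmul C (A - B) = mmul C A - mmul C B"
  using mmul_add_left[of "A - B" B C] mmul_add_right[of C "A - B" B] by simp_all

lemma mmul_assoc: "mmul (mmul A B) C = mmul A (mmul B C)"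
  by (rule mat_prod_assoc) (auto simp: algebra_simps)

lemma mat_prod_scale:
  fixes A A' :: "'a::zero matr" and B B' :: "'b::zero matr"
  assumes "\<And>x. f 0 x = 0" "\<And>x. f x 0 = 0"
    and f: "\<And>p q. f (lookup A' p) (lookup B' q) = scaleC c (f (lookup A p) (lookup B q))"
    and sub: "keys A' \<subseteq> keys A" "keys B' \<subseteq> keys B"
  shows "mat_prod f A' B' = mat_scale c (mat_prod f A B)"
proof (rule poly_mapping_eqI)
  fix p :: "nat \<times> nat"
  obtain i j where p: "p = (i, j)" by (cases p)
  obtain S where k: "finite S" "keys A \<subseteq> S \<times> S" "keys B \<subseteq> S \<times> S"
    by (rule common_index_set[of A B B])
  then have k': "keys A' \<subseteq> S \<times> S" "keys B' \<subseteq> S \<times> S" using sub by blast+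
  show "lookup (mat_prod f A' B') p = lookup (mat_scale c (mat_prod f A B)) p"
    unfolding p lookup_mat_scale lookup_mat_prod[where f=f, OF assms(1,2) k(1) k'] lookup_mat_prod[where f=f, OF assms(1,2) k]
    by (simp add: f nuca.scale_sum_right)
qed

lemma mmul_scale_left: "mmul (mat_scale c A) B = mat_scale c (mmul A B)"
  and mmul_scale_right: "mmul A (mat_scale c B) = mat_scale c (mmul A B)"
  by (rule mat_prod_scale; simp add: scaleC_mult_left scaleC_mult_right lookup_mat_scale keys_mat_scale)+

abbreviation lact :: "complex matr \<Rightarrow> 'w::nonunital_complex_algebra matr \<Rightarrow> 'w matr" where
  "lact \<equiv> mat_prod scaleC"
abbreviation ract :: "'w::nonunital_complex_algebra matr \<Rightarrow> complex matr \<Rightarrow> 'w matr" where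
  "ract \<equiv> mat_prod (\<lambda>z c. scaleC c z)"

lemma lact_mmul: "mmul (lact A Z) W = lact A (mmul Z W)"
  by (rule mat_prod_assoc) (auto simp: scaleC_mult_left distrib_right scaleC_add_right)
lemma ract_mmul: "mmul (ract Z A) W = mmul Z (lact A W)"
  by (rule mat_prod_assoc) (auto simp: scaleC_mult_left scaleC_mult_right distrib_right distrib_left)
lemma mmul_ract: "ract (mmul Z W) A = mmul Z (ract W A)"
  by (rule mat_prod_assoc) (auto simp: scaleC_mult_right distrib_left scaleC_add_right)

lemma gl_ad_add: "gl_ad A (Z + W) = gl_ad A Z + gl_ad A W"
proof -
  have "lact A (Z + W) = lact A Z + lact A W" by (rule mat_prod_add_right) (auto simp: scaleC_add_right)
  moreover have "ract (Z + W) A = ract Z A + ract W A" by (rule mat_prod_add_left) (auto simp: scaleC_add_right)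
  ultimately show ?thesis by (simp add: gl_ad_def)
qed

lemma mat_scale_diff: "mat_scale c (A - B) = mat_scale c A - mat_scale c B"
  using mat_scale_add[of c "A - B" B] by simp

lemma gl_ad_scale: "gl_ad A (mat_scale c Z) = mat_scale c (gl_ad A Z)"
proof -
  have "lact A (mat_scale c Z) = mat_scale c (lact A Z)"
    by (rule mat_prod_scale) (simp_all add: lookup_mat_scale scaleC_scaleC mult.commute keys_mat_scale)
  moreover have "ract (mat_scale c Z) A = mat_scale c (ract Z A)"
    by (rule mat_prod_scale) (simp_all add: lookup_mat_scale scaleC_scaleC mult.commute keys_mat_scale)
  ultimately show ?thesis by (simp add: gl_ad_def mat_scale_diff)
qed

lemma gl_ad_add_left: "gl_ad (A + B) Z = gl_ad A Z + gl_ad B Z"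
proof -
  have "lact (A + B) Z = lact A Z + lact B Z" by (rule mat_prod_add_left) (auto simp: scaleC_add_left)
  moreover have "ract Z (A + B) = ract Z A + ract Z B" by (rule mat_prod_add_right) (auto simp: scaleC_add_left)
  ultimately show ?thesis by (simp add: gl_ad_def)
qed

text \<open>Complex matrices act on both sides with (ZA)W = Z(AW), so the commutator with
  \<open>A\<close> is a derivation of the associative product and hence of its bracket. This stands
  in for viewing \<open>A\<close> as an element of \<open>gl N\<close>, which a non-unital \<Omega>
  does not allow.\<close>

lemma gl_ad_bracket:
  "gl_ad A (gl_bracket Z W) = gl_bracket (gl_ad A Z) W + gl_bracket Z (gl_ad A W)"
proof -
  have l: "lact A (Z - W) = lact A Z - lact A W" for Z W :: "'a matr"
    using mat_prod_add_right[of scaleC A "Z - W" W] by (simp add: scaleC_add_right)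
  have r: "ract (Z - W) A = ract Z A - ract W A" for Z W :: "'a matr"
    using mat_prod_add_left[of "\<lambda>z c. scaleC c z" "Z - W" W A] by (simp add: scaleC_add_right)
  show ?thesis
    by (simp add: gl_ad_def gl_bracket_def l r mmul_diff_left mmul_diff_right lact_mmul ract_mmul mmul_ract)
qed

section \<open>The Lie algebras \<open>gl N\<close>\<close>

lemma gl_eq_span_Emat_induct [consumes 1, case_names zero Emat add]:
  assumes "A \<in> gl N" and "P 0" and "\<And>i j x. i \<in> {1..N} \<Longrightarrow> j \<in> {1..N} \<Longrightarrow> P (Emat i j x)"
    and "\<And>A B. A \<in> gl N \<Longrightarrow> B \<in> gl N \<Longrightarrow> P A \<Longrightarrow> P B \<Longrightarrow> P (A + B)"
  shows "P (A :: 'a::comm_monoid_add matr)"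
proof -
  have "P (\<Sum>k\<in>K. single k (lookup A k)) \<and>
     (\<Sum>k\<in>K. single k (lookup A k)) \<in> gl N" if "finite K" "K \<subseteq> {1..N} \<times> {1..N}" for K
    using that
  proof (induction K rule: finite_induct)
    case empty
    then show ?case using assms(2) by (auto simp: gl_def)
  next
    case (insert k K)
    obtain i j where k: "k = (i, j)" by (cases k)
    have "P (single k (lookup A k))"
      using assms(3)[of i j] insert.prems unfolding k Emat_def by auto
    moreover have "single k (lookup A k) \<in> gl N"
      using insert.prems by (auto simp: gl_def k)
    moreover have "A + B \<in> gl N" if "A \<in> gl N" "B \<in> gl N" for A B :: "'a matr"
      using that Poly_Mapping.keys_add[of A B] unfolding gl_def by fast
    ultimately show ?case using insert by (simp add: assms(4))
  qed
  moreover have "keys A \<subseteq> {1..N} \<times> {1..N}" using assms(1) by (simp add: gl_def)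
  ultimately show ?thesis by (metis poly_mapping_sum_single finite_keys)
qed

lemma gl_add: "A \<in> gl N \<Longrightarrow> B \<in> gl N \<Longrightarrow> A + B \<in> gl N" for A B :: "'a::comm_monoid_add matr"
  using Poly_Mapping.keys_add[of A B] unfolding gl_def by fast

lemma gl_uminus: "A \<in> gl N \<Longrightarrow> - A \<in> gl N" for A :: "'a::ab_group_add matr"
  by (auto simp: gl_def)

lemma gl_diff: "A \<in> gl N \<Longrightarrow> B \<in> gl N \<Longrightarrow> A - B \<in> gl N" for A B :: "'a::ab_group_add matr"
  using gl_add[of A N "- B"] gl_uminus[of B N] by simp

lemma gl_scale: "A \<in> gl N \<Longrightarrow> mat_scale c A \<in> gl N"
  using keys_mat_scale[of c A] by (auto simp: gl_def)

lemma gl_Emat: "i \<in> {1..N} \<Longrightarrow> j \<in> {1..N} \<Longrightarrow> Emat i j x \<in> gl N"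
  by (auto simp: gl_def Emat_def)

lemma gl_mat_prod:
  "A \<in> gl N \<Longrightarrow> B \<in> gl N \<Longrightarrow> (\<And>x. f 0 x = 0) \<Longrightarrow> (\<And>x. f x 0 = 0) \<Longrightarrow> mat_prod f A B \<in> gl N"
  unfolding gl_def mem_Collect_eq by (rule keys_mat_prod) auto

lemma gl_bracket_closed: "A \<in> gl N \<Longrightarrow> B \<in> gl N \<Longrightarrow> gl_bracket A B \<in> gl N"
  unfolding gl_bracket_def by (intro gl_diff gl_mat_prod) auto

lemma gl_ad_closed: "A \<in> gl N \<Longrightarrow> B \<in> gl N \<Longrightarrow> gl_ad A B \<in> gl N"
  unfolding gl_ad_def by (intro gl_diff gl_mat_prod) auto

section \<open>Functionals on words\<close>

text \<open>The good functionals are the linear functionals on the enveloping algebra of the Lie algebra of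
  all finitely supported matrices, described by their values on words.\<close>

definition good :: "('w::nonunital_complex_algebra matr list \<Rightarrow> complex) \<Rightarrow> bool" where
  "good F \<longleftrightarrow>
     (\<forall>u v x y. F (u @ (x + y) # v) = F (u @ x # v) + F (u @ y # v)) \<and>
     (\<forall>u v c x. F (u @ mat_scale c x # v) = c * F (u @ x # v)) \<and>
     (\<forall>u v x y. F (u @ x # y # v) - F (u @ y # x # v) = F (u @ gl_bracket x y # v))"

lemma goodI:
  assumes "\<And>u v x y. F (u @ (x + y) # v) = F (u @ x # v) + F (u @ y # v)"
    and "\<And>u v c x. F (u @ mat_scale c x # v) = c * F (u @ x # v)"
    and "\<And>u v x y. F (u @ x # y # v) - F (u @ y # x # v) = F (u @ gl_bracket x y # v)"
  shows "good F"
  using assms by (simp add: good_def)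

lemma good_add: "good F \<Longrightarrow> F (u @ (x + y) # v) = F (u @ x # v) + F (u @ y # v)"
  and good_scale: "good F \<Longrightarrow> F (u @ mat_scale c x # v) = c * F (u @ x # v)"
  and good_bracket: "good F \<Longrightarrow> F (u @ x # y # v) - F (u @ y # x # v) = F (u @ gl_bracket x y # v)"
  by (simp_all add: good_def)

lemmas good_add_Nil = good_add[where u="[]", simplified]
lemmas good_scale_Nil = good_scale[where u="[]", simplified]
lemmas good_bracket_Nil = good_bracket[where u="[]", simplified]

text \<open>Prefixing a word is dual to left multiplication in the free algebra. This closure and
  the one under suffixes make the joint kernel of the good functionals a two-sided ideal.\<close>

lemma good_shift: "good F \<Longrightarrow> good (\<lambda>v. F (u @ v))"
  by (intro goodI) (use good_add[of F "u @ _"] good_scale[of F "u @ _"] good_bracket[of F "u @ _"] in auto)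

lemma good_Cons: "good F \<Longrightarrow> good (\<lambda>v. F (x # v))"
  using good_shift[of F "[x]"] by simp

lemma good_shift_right: "good F \<Longrightarrow> good (\<lambda>v. F (v @ u))"
  by (intro goodI) (use good_add[of F _ _ _ "_ @ u"] good_scale[of F _ _ _ "_ @ u"] good_bracket[of F _ _ _ "_ @ u"] in auto)

subsection \<open>Shuffle products\<close>

text \<open>Dual to the coproduct of the enveloping algebra, which is why it preserves good functionals.\<close>

fun shuffle :: "('g list \<Rightarrow> complex) \<Rightarrow> ('g list \<Rightarrow> complex) \<Rightarrow> 'g list \<Rightarrow> complex" where
  "shuffle F G [] = F [] * G []"
| "shuffle F G (x # w) = shuffle (\<lambda>v. F (x # v)) G w + shuffle F (\<lambda>v. G (x # v)) w"

lemma shuffle_add_left: "shuffle (\<lambda>v. F v + F' v) G w = shuffle F G w + shuffle F' G w"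
  and shuffle_diff_left: "shuffle (\<lambda>v. F v - F' v) G w = shuffle F G w - shuffle F' G w"
  and shuffle_scale_left: "shuffle (\<lambda>v. c * F v) G w = c * shuffle F G w"
  and shuffle_add_right: "shuffle F (\<lambda>v. G v + G' v) w = shuffle F G w + shuffle F G' w"
  and shuffle_diff_right: "shuffle F (\<lambda>v. G v - G' v) w = shuffle F G w - shuffle F G' w"
  and shuffle_scale_right: "shuffle F (\<lambda>v. c * G v) w = c * shuffle F G w"
  by (induction w arbitrary: F F' G G') (simp_all add: algebra_simps)

text \<open>The defining recursion reads from the left, but membership in the left ideal generated
  by the last column shows in the last letter.\<close>

lemma shuffle_snoc: "shuffle F G (w @ [x]) = shuffle (\<lambda>v. F (v @ [x])) G w + shuffle F (\<lambda>v. G (v @ [x])) w"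
  by (induction w arbitrary: F G) (simp_all add: algebra_simps)

lemma good_shuffle:
  assumes "good F" "good G"
  shows "good (shuffle F G)"
proof (intro goodI)
  fix u v :: "'a matr list" and x y :: "'a matr" and c
  show "shuffle F G (u @ (x + y) # v) = shuffle F G (u @ x # v) + shuffle F G (u @ y # v)"
    using assms
  proof (induction u arbitrary: F G)
    case Nil
    then show ?case by (simp add: good_add_Nil shuffle_add_left shuffle_add_right)
  next
    case (Cons a u)
    then show ?case by (simp add: good_Cons)
  qed
  show "shuffle F G (u @ mat_scale c x # v) = c * shuffle F G (u @ x # v)"
    using assms
  proof (induction u arbitrary: F G)
    case Nil
    then show ?case by (simp add: good_scale_Nil shuffle_scale_left shuffle_scale_right algebra_simps)
  next
    case (Cons a u)
    then show ?case by (simp add: good_Cons algebra_simps)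
  qed
  show "shuffle F G (u @ x # y # v) - shuffle F G (u @ y # x # v) = shuffle F G (u @ gl_bracket x y # v)"
    using assms
  proof (induction u arbitrary: F G)
    case Nil
    \<comment> \<open>The terms in which one of \<open>x\<close>, \<open>y\<close> goes to
      \<open>F\<close> and the other to \<open>G\<close> arise for both orders of the two letters
      and cancel.\<close>
    have "shuffle (\<lambda>v. F (gl_bracket x y # v)) G v =
        shuffle (\<lambda>v. F (x # y # v)) G v - shuffle (\<lambda>v. F (y # x # v)) G v"
      "shuffle F (\<lambda>v. G (gl_bracket x y # v)) v =
        shuffle F (\<lambda>v. G (x # y # v)) v - shuffle F (\<lambda>v. G (y # x # v)) v"
      unfolding shuffle_diff_left[symmetric] shuffle_diff_right[symmetric]
      by (simp_all add: good_bracket_Nil Nil)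
    then show ?case by (simp add: algebra_simps)
  next
    case (Cons a u)
    have "shuffle F G ((a # u) @ x # y # v) - shuffle F G ((a # u) @ y # x # v) =
       (shuffle (\<lambda>v. F (a # v)) G (u @ x # y # v) - shuffle (\<lambda>v. F (a # v)) G (u @ y # x # v)) +
       (shuffle F (\<lambda>v. G (a # v)) (u @ x # y # v) - shuffle F (\<lambda>v. G (a # v)) (u @ y # x # v))"
      by simp
    also have "\<dots> = shuffle (\<lambda>v. F (a # v)) G (u @ gl_bracket x y # v) + shuffle F (\<lambda>v. G (a # v)) (u @ gl_bracket x y # v)"
      by (simp only: Cons.IH Cons.prems good_Cons)
    finally show ?case by simp
  qed
qed

definition counit :: "'g list \<Rightarrow> complex" where
  "counit w = (if w = [] then 1 else 0)"

lemma good_counit: "good counit"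
  by (intro goodI) (auto simp: counit_def)

subsection \<open>Matrix coefficients\<close>

text \<open>A non-unital algebra has no empty product. The value 0 at \<open>[]\<close> is a
  placeholder; \<open>coeff_functional\<close> treats the empty word separately.\<close>

fun mat_word :: "'w::nonunital_complex_algebra matr list \<Rightarrow> 'w matr" where
  "mat_word [] = 0"
| "mat_word [x] = x"
| "mat_word (x # y # w) = mmul x (mat_word (y # w))"

lemma mat_word_Cons: "w \<noteq> [] \<Longrightarrow> mat_word (x # w) = mmul x (mat_word w)"
  by (cases w) auto

lemma mat_word_append: "u \<noteq> [] \<Longrightarrow> v \<noteq> [] \<Longrightarrow> mat_word (u @ v) = mmul (mat_word u) (mat_word v)"
  by (induction u rule: mat_word.induct) (auto simp: mat_word_Cons mmul_assoc)

definition coeff_functional :: "('w::nonunital_complex_algebra matr \<Rightarrow> complex) \<Rightarrow> 'w matr list \<Rightarrow> complex" where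
  "coeff_functional f w = (if w = [] then 0 else f (mat_word w))"

text \<open>Only the associative product of the letters enters, and there the bracket of two
  neighbours is their commutator. The value at the empty word is unconstrained, since every relation
  involves a letter.\<close>

lemma good_coeff_functional:
  assumes "\<And>A B. f (A + B) = f A + f B" "\<And>c A. f (mat_scale c A) = c * f A"
  shows "good (coeff_functional f)"
proof -
  have fd: "f (A - B) = f A - f B" for A B using assms(1)[of "A - B" B] by simp
  have mw: "mat_word (u @ x # v) = (if u = [] then if v = [] then x else mmul x (mat_word v)
     else mmul (mat_word u) (if v = [] then x else mmul x (mat_word v)))" for u v and x :: "'a matr"
    by (cases "u = []") (auto simp: mat_word_append mat_word_Cons)
  show ?thesis
  proof (intro goodI)
    fix u v :: "'a matr list" and x y :: "'a matr" and c
    show "coeff_functional f (u @ (x + y) # v) = coeff_functional f (u @ x # v) + coeff_functional f (u @ y # v)"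
      by (simp add: coeff_functional_def mw mmul_add_left mmul_add_right assms)
    show "coeff_functional f (u @ mat_scale c x # v) = c * coeff_functional f (u @ x # v)"
      by (simp add: coeff_functional_def mw mmul_scale_left mmul_scale_right assms)
    show "coeff_functional f (u @ x # y # v) - coeff_functional f (u @ y # x # v) = coeff_functional f (u @ gl_bracket x y # v)"
      by (simp add: coeff_functional_def mw mat_word_Cons gl_bracket_def mmul_diff_left mmul_diff_right fd mmul_assoc)
  qed
qed

section \<open>The enveloping algebra of the Lie algebra of all finitely supported matrices\<close>

definition lin :: "('g list \<Rightarrow> complex) \<Rightarrow> 'g falg \<Rightarrow> complex" where
  "lin F p = (\<Sum>w\<in>keys p. lookup p w * F (letters w))"

lemma lin_superset:
  "finite S \<Longrightarrow> keys p \<subseteq> S \<Longrightarrow> lin F p = (\<Sum>w\<in>S. lookup p w * F (letters w))"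
  unfolding lin_def by (intro sum.mono_neutral_left) (auto simp: in_keys_iff)

lemma lin_add: "lin F (p + q) = lin F p + lin F q"
proof -
  let ?S = "keys p \<union> keys q"
  have "finite ?S" by simp
  then show ?thesis
    using Poly_Mapping.keys_add[of p q]
    by (simp add: lin_superset[of ?S] lookup_add distrib_right sum.distrib)
qed

lemma lin_uminus: "lin F (- p) = - lin F p"
  by (simp add: lin_def sum_negf)

lemma lin_diff: "lin F (p - q) = lin F p - lin F q"
  using lin_add[of F p "- q"] lin_uminus[of F q] by simp

lemma lin_zero [simp]: "lin F 0 = 0"
  by (simp add: lin_def)

lemma lin_single: "lin F (single w c) = c * F (letters w)"
  by (auto simp: lin_def)

lemma single_Word_mult:
  "single (Word u) c * single (Word v) b = single (Word (u @ v)) (c * b)"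
  by (simp add: mult_single plus_fmon_def)

lemma lin_single_mult: "lin F (single (Word u) c * p) = c * lin (\<lambda>v. F (u @ v)) p"
proof (induction p rule: poly_mapping_single_add_induct)
  case (single k b)
  then show ?case by (cases k) (simp add: single_Word_mult lin_single)
next
  case (add p q)
  then show ?case by (simp add: distrib_left lin_add)
qed

lemma lin_mult_single: "lin F (p * single (Word u) c) = c * lin (\<lambda>v. F (v @ u)) p"
proof (induction p rule: poly_mapping_single_add_induct)
  case (single k b)
  then show ?case by (cases k) (simp add: single_Word_mult lin_single)
next
  case (add p q)
  then show ?case by (simp add: distrib_right distrib_left lin_add)
qed

text \<open>Dividing by the joint kernel of the good functionals, instead of the ideal generated by the
  relations, makes all good functionals available on the quotient \<open>env\<close>.  That nothing more than the
  ideal is divided out is the Poincare-Birkhoff-Witt theorem (\<open>Uideal_eq\<close> below).\<close>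

definition Jker :: "'w::nonunital_complex_algebra matr falg set" where
  "Jker = {p. \<forall>F. good F \<longrightarrow> lin F p = 0}"

lemma Jker_zero: "0 \<in> Jker"
  and Jker_add: "p \<in> Jker \<Longrightarrow> q \<in> Jker \<Longrightarrow> p + q \<in> Jker"
  and Jker_uminus: "p \<in> Jker \<Longrightarrow> - p \<in> Jker"
  by (auto simp: Jker_def lin_add lin_uminus)

lemma Jker_mult_left: "p \<in> Jker \<Longrightarrow> q * p \<in> Jker"
proof (induction q rule: poly_mapping_single_add_induct)
  case (single k c)
  then show ?case by (cases k) (auto simp: Jker_def lin_single_mult good_shift)
next
  case (add q q')
  then show ?case by (simp add: distrib_right Jker_add)
qed

lemma Jker_mult_right: "p \<in> Jker \<Longrightarrow> p * q \<in> Jker"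
proof (induction q rule: poly_mapping_single_add_induct)
  case (single k c)
  then show ?case by (cases k) (auto simp: Jker_def lin_mult_single good_shift_right)
next
  case (add q q')
  then show ?case by (simp add: distrib_left Jker_add)
qed

section \<open>The quotient algebra \<open>env\<close>\<close>

definition jrel :: "'w::nonunital_complex_algebra matr falg \<Rightarrow> 'w matr falg \<Rightarrow> bool" where
  "jrel p q \<longleftrightarrow> p - q \<in> Jker"

lemma equivp_jrel: "equivp jrel"
proof (rule equivpI)
  show "reflp jrel" by (simp add: reflp_def jrel_def Jker_zero)
  show "symp jrel" using Jker_uminus by (fastforce simp: symp_def jrel_def)
  have "jrel p r" if "jrel p q" "jrel q r" for p q r :: "'a matr falg"
    using Jker_add[of "p - q" "q - r"] that by (simp add: jrel_def)
  then show "transp (jrel :: 'a matr falg \<Rightarrow> _)" by (blast intro: transpI)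
qed

lifting_forget poly_mapping.lifting

quotient_type (overloaded) 'w env = "'w::nonunital_complex_algebra matr falg" / jrel
  by (rule equivp_jrel)

instantiation env :: (nonunital_complex_algebra) ring_1
begin

lift_definition zero_env :: "'a env" is 0 .
lift_definition one_env :: "'a env" is 1 .
lift_definition plus_env :: "'a env \<Rightarrow> 'a env \<Rightarrow> 'a env" is "(+)"
proof -
  fix p q p' q' :: "'a matr falg" assume "jrel p q" "jrel p' q'"
  then have "(p - q) + (p' - q') \<in> Jker" by (simp add: jrel_def Jker_add)
  then show "jrel (p + p') (q + q')" by (simp add: jrel_def algebra_simps)
qed
lift_definition uminus_env :: "'a env \<Rightarrow> 'a env" is uminus
proof -
  fix p q :: "'a matr falg" assume "jrel p q"
  then have "- (p - q) \<in> Jker" unfolding jrel_def by (rule Jker_uminus)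
  then show "jrel (- p) (- q)" by (simp add: jrel_def)
qed
lift_definition minus_env :: "'a env \<Rightarrow> 'a env \<Rightarrow> 'a env" is "(-)"
proof -
  fix p q p' q' :: "'a matr falg" assume "jrel p q" "jrel p' q'"
  then have "(p - q) + - (p' - q') \<in> Jker" unfolding jrel_def by (intro Jker_add Jker_uminus)
  then show "jrel (p - p') (q - q')" by (simp add: jrel_def algebra_simps)
qed
lift_definition times_env :: "'a env \<Rightarrow> 'a env \<Rightarrow> 'a env" is "(*)"
proof -
  fix p q p' q' :: "'a matr falg" assume "jrel p q" "jrel p' q'"
  then have "(p - q) * p' + q * (p' - q') \<in> Jker"
    unfolding jrel_def by (intro Jker_add Jker_mult_left Jker_mult_right)
  then show "jrel (p * p') (q * q')" by (simp add: jrel_def algebra_simps)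
qed

instance
proof
  \<comment> \<open>The counit takes the value 1 at the unit and so separates it from 0.\<close>
  obtain F :: "'a matr list \<Rightarrow> complex" where F: "F = counit" by blast
  have "good F" "lin F 1 = 1" using good_counit lin_single[of F 0 1] by (simp_all add: F counit_def) (simp add: zero_fmon_def)
  then have "(1::'a matr falg) \<notin> Jker" by (auto simp: Jker_def)
  then show "(0::'a env) \<noteq> 1" by transfer (auto simp: jrel_def dest: Jker_uminus)
qed (transfer; simp add: jrel_def algebra_simps Jker_zero)+

end

text \<open>A functional that is not good need not respect the quotient. The default value 0 makes
  \<open>evalF F\<close> well defined and linear for every \<open>F\<close>.\<close>

lift_definition evalF :: "('w::nonunital_complex_algebra matr list \<Rightarrow> complex) \<Rightarrow> 'w env \<Rightarrow> complex"
  is "\<lambda>F p. if good F then lin F p else 0"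
  by (auto simp: jrel_def Jker_def lin_diff)

definition clsE :: "'w::nonunital_complex_algebra matr falg \<Rightarrow> 'w env" where
  "clsE = abs_env"

lemma clsE_transfer [transfer_rule]: "rel_fun (=) cr_env (\<lambda>p. p) clsE"
  by (auto simp: rel_fun_def cr_env_def clsE_def env.abs_eq_iff)

definition scal :: "complex \<Rightarrow> 'w::nonunital_complex_algebra env" where
  "scal c = clsE (cst c)"

definition gE :: "'w::nonunital_complex_algebra matr \<Rightarrow> 'w env" where
  "gE A = clsE (gen A)"

lemma clsE_add: "clsE (p + q) = clsE p + clsE q"
  and clsE_mult: "clsE (p * q) = clsE p * clsE q"
  and clsE_diff: "clsE (p - q) = clsE p - clsE q"
  and clsE_zero [simp]: "clsE 0 = 0"
  and clsE_one [simp]: "clsE 1 = 1"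
  by (transfer; simp add: jrel_def Jker_zero)+

lemma clsE_cst: "clsE (cst c) = scal c" and clsE_gen: "clsE (gen A) = gE A"
  by (simp_all add: scal_def gE_def)

lemma clsE_sum: "clsE (sum f S) = (\<Sum>x\<in>S. clsE (f x))"
  by (induction S rule: infinite_finite_induct) (auto simp: clsE_add)

lemma clsE_eq_iff: "clsE p = clsE q \<longleftrightarrow> p - q \<in> Jker"
  by transfer (simp add: jrel_def)

lemma clsE_eq_0_iff: "clsE p = 0 \<longleftrightarrow> p \<in> Jker"
  by transfer (simp add: jrel_def)

lemma clsE_surj: obtains p where "u = clsE p"
  unfolding clsE_def using env.abs_induct[of "\<lambda>u. \<exists>p. u = abs_env p" u] by blast

lemma evalF_clsE: "good F \<Longrightarrow> evalF F (clsE p) = lin F p"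
  by transfer simp

lemma cst_add: "cst (a + b) = cst a + cst b"
  and cst_mult: "cst (a * b) = cst a * cst b"
  and cst_0 [simp]: "cst 0 = 0" and cst_1 [simp]: "cst 1 = 1"
  by (simp_all add: cst_def single_add mult_single)

lemma cst_commute: "cst c * p = p * cst c"
proof (induction p rule: poly_mapping_single_add_induct)
  case (single k c')
  then show ?case by (cases k) (simp add: cst_def mult_single mult.commute)
next
  case (add p q)
  then show ?case by (simp add: algebra_simps)
qed

lemma cst_mult_single: "cst c * single k b = single k (c * b)"
  by (simp add: cst_def mult_single)

lemma scal_add: "scal (a + b) = scal a + scal b"
  and scal_mult: "scal (a * b) = scal a * scal b"
  and scal_0 [simp]: "scal 0 = 0"
  and scal_1 [simp]: "scal 1 = 1"
  by (simp_all flip: clsE_cst add: cst_add cst_mult clsE_add clsE_mult)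

lemma scal_commute: "scal c * u = u * scal c"
  by (rule clsE_surj[of u]) (metis clsE_cst clsE_mult cst_commute)

lemma scal_left_commute: "u * (scal c * v) = scal c * (u * v)"
  by (metis scal_commute mult.assoc)

global_interpretation env: vector_space "\<lambda>c u. scal c * (u :: 'w::nonunital_complex_algebra env)"
  by unfold_locales (simp_all add: distrib_left distrib_right scal_add scal_mult mult.assoc)

lemma lin_gen_mult: "lin F (gen x * p) = lin (\<lambda>v. F (x # v)) p"
  by (simp add: gen_def lin_single_mult)

lemma gE_add: "gE (A + B) = gE A + gE B"
  unfolding clsE_gen[symmetric] clsE_add[symmetric] clsE_eq_iff
  by (auto simp: Jker_def lin_diff lin_add gen_def lin_single good_add_Nil)

lemma gE_scale: "gE (mat_scale c A) = scal c * gE A"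
  unfolding clsE_gen[symmetric] clsE_cst[symmetric] clsE_mult[symmetric] clsE_eq_iff
  by (auto simp: Jker_def lin_diff lin_add gen_def cst_mult_single lin_single good_scale_Nil)

lemma gE_bracket: "gE A * gE B - gE B * gE A = gE (gl_bracket A B)"
  unfolding clsE_gen[symmetric] clsE_mult[symmetric] clsE_diff[symmetric] clsE_eq_iff
  by (auto simp: Jker_def lin_diff gen_def single_Word_mult lin_single good_bracket_Nil)

lemma gE_zero [simp]: "gE 0 = 0"
  using gE_add[of 0 0] by simp

lemma gE_diff: "gE (A - B) = gE A - gE B"
  using gE_add[of "A - B" B] by simp

lemma evalF_add: "evalF F (u + v) = evalF F u + evalF F v"
  and evalF_diff: "evalF F (u - v) = evalF F u - evalF F v"
  and evalF_zero [simp]: "evalF F 0 = 0"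
  by (transfer; auto simp: lin_add lin_diff)+

lemma evalF_scal: "evalF F (scal c * u) = c * evalF F u"
proof -
  obtain p where u: "u = clsE p" by (rule clsE_surj)
  have "lin F (cst c * p) = c * lin F p"
    using lin_single_mult[of F "[]" c p] by (simp add: cst_def zero_fmon_def)
  moreover have "evalF F (clsE q) = (if good F then lin F q else 0)" for q
    by transfer simp
  ultimately show ?thesis by (simp add: u scal_def flip: clsE_mult)
qed

lemma evalF_sum: "evalF F (sum f S) = (\<Sum>x\<in>S. evalF F (f x))"
  by (induction S rule: infinite_finite_induct) (auto simp: evalF_add)

lemma single_Word_eq: "single (Word ws) c = cst c * prod_list (map gen ws)"
proof (induction ws arbitrary: c)
  case Nil
  then show ?case by (simp add: cst_def zero_fmon_def)
next
  case (Cons x ws)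
  have "single (Word (x # ws)) c = gen x * single (Word ws) c"
    by (simp add: gen_def single_Word_mult)
  also have "\<dots> = cst c * (gen x * prod_list (map gen ws))"
    unfolding Cons by (metis cst_commute mult.assoc)
  finally show ?case by simp
qed

abbreviation gEs :: "'w::nonunital_complex_algebra matr list \<Rightarrow> 'w env" where
  "gEs ws \<equiv> prod_list (map gE ws)"

lemma clsE_prod_list: "clsE (prod_list ps) = prod_list (map clsE ps)"
  by (induction ps) (auto simp: clsE_mult)

lemma clsE_single: "clsE (single (Word ws) c) = scal c * gEs ws"
  by (simp add: single_Word_eq clsE_mult clsE_cst clsE_prod_list o_def clsE_gen)

lemma evalF_gEs:
  assumes "good F" shows "evalF F (gEs ws) = F ws"
  using clsE_single[of ws 1] evalF_clsE[OF assms, of "single (Word ws) 1"]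
  by (simp add: lin_single)

lemma evalF_mult_gEs: "good F \<Longrightarrow> evalF F (u * gEs ws) = evalF (\<lambda>v. F (v @ ws)) u"
proof -
  assume F: "good F"
  obtain p where u: "u = clsE p" by (rule clsE_surj)
  have "u * gEs ws = clsE (p * single (Word ws) 1)"
    by (simp add: u clsE_mult clsE_single)
  then show ?thesis using F by (simp add: evalF_clsE lin_mult_single u good_shift_right)
qed

lemma env_eq_0I: "(\<And>F. good F \<Longrightarrow> evalF F u = 0) \<Longrightarrow> u = 0"
  by transfer (auto simp: jrel_def Jker_def)

section \<open>The action by derivations\<close>

lemma env_eqI: "(\<And>F. good F \<Longrightarrow> evalF F u = evalF F v) \<Longrightarrow> u = v"
  using env_eq_0I[of "u - v"] by (simp add: evalF_diff)

lemma env_induct [case_names word add]: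
  assumes "\<And>c ws. P (scal c * gEs ws)" "\<And>u v. P u \<Longrightarrow> P v \<Longrightarrow> P (u + v)"
  shows "P u"
proof -
  obtain p where u: "u = clsE p" by (rule clsE_surj)
  show ?thesis unfolding u
  proof (induction p rule: poly_mapping_single_add_induct)
    case (single k c)
    then show ?case by (cases k) (simp add: clsE_single assms)
  qed (simp add: clsE_add assms)
qed

lemma evalF_gE_mult: "good F \<Longrightarrow> evalF F (gE x * u) = evalF (\<lambda>v. F (x # v)) u"
proof -
  assume F: "good F"
  obtain p where u: "u = clsE p" by (rule clsE_surj)
  show ?thesis using F by (simp add: u evalF_clsE lin_gen_mult good_Cons flip: clsE_gen clsE_mult)
qed

text \<open>The transpose of the derivation of the free algebra induced by \<open>D\<close>. Once it
  preserves good functionals, the derivation descends to \<open>env\<close>.\<close>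

definition deriv_functional :: "('g \<Rightarrow> 'g) \<Rightarrow> ('g list \<Rightarrow> complex) \<Rightarrow> 'g list \<Rightarrow> complex" where
  "deriv_functional D F w = (\<Sum>k<length w. F (w[k := D (w ! k)]))"

lemma deriv_functional_Nil [simp]: "deriv_functional D F [] = 0"
  by (simp add: deriv_functional_def)

lemma deriv_functional_Cons [simp]:
  "deriv_functional D F (x # w) = F (D x # w) + deriv_functional D (\<lambda>v. F (x # v)) w"
  by (simp add: deriv_functional_def sum.lessThan_Suc_shift del: sum.lessThan_Suc)

lemma lin_sum: "lin F (sum f S) = (\<Sum>x\<in>S. lin F (f x))"
  by (induction S rule: infinite_finite_induct) (auto simp: lin_add)

lemma lin_word_derivation: "lin F (word_derivation D p) = lin (deriv_functional D F) p"
  by (simp add: word_derivation_def lin_sum lin_single lin_def[of "deriv_functional D F"]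
      deriv_functional_def sum_distrib_left)

lemma deriv_functional_add: "deriv_functional D (\<lambda>v. F v + G v) w = deriv_functional D F w + deriv_functional D G w"
  and deriv_functional_diff: "deriv_functional D (\<lambda>v. F v - G v) w = deriv_functional D F w - deriv_functional D G w"
  and deriv_functional_scale: "deriv_functional D (\<lambda>v. c * F v) w = c * deriv_functional D F w"
  by (simp_all add: deriv_functional_def sum.distrib sum_subtractf sum_distrib_left)

lemma good_deriv_functional:
  assumes D: "\<And>x y. D (x + y) = D x + D y" "\<And>c x. D (mat_scale c x) = mat_scale c (D x)"
    "\<And>x y. D (gl_bracket x y) = gl_bracket (D x) y + gl_bracket x (D y)"
    and "good F"
  shows "good (deriv_functional D F)"
proof (intro goodI)
  fix u v :: "'a matr list" and x y :: "'a matr" and c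
  show "deriv_functional D F (u @ (x + y) # v) = deriv_functional D F (u @ x # v) + deriv_functional D F (u @ y # v)"
    using \<open>good F\<close>
    by (induction u arbitrary: F)
      (simp_all add: D good_add_Nil deriv_functional_add good_Cons good_add[where u="_ # _", simplified])
  show "deriv_functional D F (u @ mat_scale c x # v) = c * deriv_functional D F (u @ x # v)"
    using \<open>good F\<close>
    by (induction u arbitrary: F)
      (simp_all add: D good_scale_Nil deriv_functional_scale good_Cons good_scale[where u="_ # _", simplified] distrib_left)
  show "deriv_functional D F (u @ x # y # v) - deriv_functional D F (u @ y # x # v) = deriv_functional D F (u @ gl_bracket x y # v)"
    using \<open>good F\<close>
  proof (induction u arbitrary: F)
    case Nil
    have "deriv_functional D (\<lambda>v. F (gl_bracket x y # v)) v =
      deriv_functional D (\<lambda>v. F (x # y # v)) v - deriv_functional D (\<lambda>v. F (y # x # v)) v"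
      by (simp add: Nil good_bracket_Nil flip: deriv_functional_diff)
    moreover have "F (D (gl_bracket x y) # v) = F (D x # y # v) - F (y # D x # v) + (F (x # D y # v) - F (D y # x # v))"
      by (simp only: D good_add_Nil[OF Nil] good_bracket_Nil[OF Nil])
    ultimately show ?case by simp
  next
    case (Cons a u)
    have "F (D a # u @ x # y # v) - F (D a # u @ y # x # v) = F (D a # u @ gl_bracket x y # v)"
      using good_bracket[OF Cons.prems, of "D a # u"] by simp
    with Cons.IH[OF good_Cons[OF Cons.prems, of a]] show ?case by (simp add: algebra_simps)
  qed
qed

lemma good_ad_functional: "good F \<Longrightarrow> good (deriv_functional (gl_ad A) F)"
  by (rule good_deriv_functional) (simp_all add: gl_ad_add gl_ad_scale gl_ad_bracket)

lift_definition adE :: "complex matr \<Rightarrow> 'w::nonunital_complex_algebra env \<Rightarrow> 'w env"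
  is "\<lambda>A. word_derivation (gl_ad A)"
  by (auto simp: jrel_def Jker_def lin_diff lin_word_derivation good_ad_functional)

lemma adE_clsE: "adE A (clsE p) = clsE (word_derivation (gl_ad A) p)"
  by transfer (simp add: jrel_def Jker_zero)

lemma evalF_adE: "good F \<Longrightarrow> evalF F (adE A u) = evalF (deriv_functional (gl_ad A) F) u"
  by (rule clsE_surj[of u]) (simp add: adE_clsE evalF_clsE lin_word_derivation good_ad_functional)

lemma adE_add: "adE A (u + v) = adE A u + adE A v"
  and adE_diff: "adE A (u - v) = adE A u - adE A v"
  and adE_scal: "adE A (scal c * u) = scal c * adE A u"
  by (rule env_eqI; simp add: evalF_adE evalF_add evalF_diff evalF_scal)+

lemma adE_zero [simp]: "adE A 0 = 0"
  using adE_add[of A 0 0] by simp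

lemma adE_sum: "adE A (sum f S) = (\<Sum>x\<in>S. adE A (f x))"
  by (induction S rule: infinite_finite_induct) (auto simp: adE_add)

lemma adE_one [simp]: "adE A 1 = 0"
  by (rule env_eqI) (use evalF_gEs[OF good_ad_functional, of _ A "[]"] in \<open>simp add: evalF_adE\<close>)

lemma evalF_functional_add:
  assumes "good F" "good G"
  shows "evalF (\<lambda>v. F v + G v) u = evalF F u + evalF G u"
proof -
  obtain p where u: "u = clsE p" by (rule clsE_surj)
  have "good (\<lambda>v. F v + G v)"
    using good_add[OF assms(1)] good_add[OF assms(2)] good_scale[OF assms(1)] good_scale[OF assms(2)]
      good_bracket[OF assms(1)] good_bracket[OF assms(2)]
    by (intro goodI) (simp_all add: distrib_left flip: good_bracket[OF assms(1)] good_bracket[OF assms(2)])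
  then show ?thesis
    by (simp add: u evalF_clsE assms lin_def distrib_left sum.distrib)
qed

lemma adE_gE_mult: "adE A (gE x * u) = gE (gl_ad A x) * u + gE x * adE A u"
proof (rule env_eqI)
  fix F :: "'a matr list \<Rightarrow> complex" assume F: "good F"
  have "evalF F (adE A (gE x * u)) = evalF (\<lambda>v. F (gl_ad A x # v) + deriv_functional (gl_ad A) (\<lambda>v. F (x # v)) v) u"
    using F by (simp add: evalF_adE evalF_gE_mult good_ad_functional)
  also have "\<dots> = evalF F (gE (gl_ad A x) * u + gE x * adE A u)"
    using F by (simp add: evalF_functional_add good_Cons good_ad_functional evalF_add evalF_gE_mult evalF_adE)
  finally show "evalF F (adE A (gE x * u)) = \<dots>" .
qed

lemma adE_gE: "adE A (gE x) = gE (gl_ad A x)"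
  using adE_gE_mult[of A x 1] by simp

lemma adE_mult: "adE A (u * v) = adE A u * v + u * adE A v"
proof (induction u rule: env_induct)
  case (word c ws)
  have "adE A (gEs ws * v) = adE A (gEs ws) * v + gEs ws * adE A v"
    by (induction ws) (simp_all add: adE_gE_mult mult.assoc distrib_left distrib_right add.assoc)
  then show ?case by (simp add: mult.assoc adE_scal distrib_left)
next
  case (add u u')
  then show ?case by (simp add: distrib_right adE_add)
qed

section \<open>Coordinate functionals\<close>

locale algebra_basis =
  fixes X :: "'w::nonunital_complex_algebra set"
  assumes basis: "is_linear_basis X"
begin

lemma indep: "nuca.independent X" and span_X: "nuca.span X = UNIV"
  using basis by (auto simp: is_linear_basis_def)

definition crd :: "'w \<Rightarrow> 'w \<Rightarrow> complex" where
  "crd x v = nuca.representation X v x"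

lemma crd_add: "crd x (v + v') = crd x v + crd x v'"
  and crd_scale: "crd x (scaleC c v) = c * crd x v"
  by (simp_all add: crd_def nuca.representation_add nuca.representation_scale indep span_X)

lemma crd_basis: "x' \<in> X \<Longrightarrow> crd x x' = (if x = x' then 1 else 0)"
  by (simp add: crd_def nuca.representation_basis indep)

lemma crd_zero [simp]: "crd x 0 = 0"
  using crd_add[of x 0 0] by simp

text \<open>The dual basis vector of \<open>Emat a b x\<close>, extended from matrices to words
  through the product of the letters.\<close>

definition edge_functional :: "nat \<times> nat \<times> 'w \<Rightarrow> 'w matr list \<Rightarrow> complex" where
  "edge_functional = (\<lambda>(a, b, x). coeff_functional (\<lambda>A. crd x (lookup A (a, b))))"

lemma good_edge_functional: "good (edge_functional g)"
  by (cases g) (auto simp: edge_functional_def lookup_add lookup_mat_scale crd_add crd_scale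
      intro!: good_coeff_functional)

definition Phi :: "(nat \<times> nat \<times> 'w) list \<Rightarrow> 'w matr list \<Rightarrow> complex" where
  "Phi gs = foldr (\<lambda>g. shuffle (edge_functional g)) gs counit"

lemma Phi_Nil: "Phi [] = counit" and Phi_Cons: "Phi (g # gs) = shuffle (edge_functional g) (Phi gs)"
  by (simp_all add: Phi_def)

lemma good_Phi: "good (Phi gs)"
  by (induction gs) (simp_all add: Phi_Nil Phi_Cons good_counit good_shuffle good_edge_functional)

end

section \<open>Convolutions evaluated on short words\<close>

abbreviation Em :: "nat \<times> nat \<times> 'w::nonunital_complex_algebra \<Rightarrow> 'w matr" where
  "Em \<equiv> \<lambda>(a, b, x). Emat a b x"

text \<open>Any letter given to \<open>F\<close> leaves fewer than \<open>k\<close> letters for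
  \<open>G\<close>, so only the term with all letters at \<open>G\<close> survives.\<close>

lemma shuffle_low:
  assumes "\<And>v. length v < k \<Longrightarrow> G v = 0" "length w \<le> k"
  shows "shuffle F G w = F [] * G w"
  using assms
proof (induction w arbitrary: F G k)
  case (Cons x w)
  have "shuffle (\<lambda>v. F (x # v)) G w = F [x] * G w" "G w = 0"
    using Cons.IH[of k G] Cons.prems by auto
  moreover have "shuffle F (\<lambda>v. G (x # v)) w = F [] * G (x # w)"
    using Cons.IH[of "k - 1" "\<lambda>v. G (x # v)" F] Cons.prems by auto
  ultimately show ?case by simp
qed simp

text \<open>At most one letter can be spared from \<open>G\<close>, and \<open>F [] = 0\<close>
  demands that one be spared.\<close>

lemma shuffle_next:
  assumes "\<And>v. length v < k \<Longrightarrow> G v = 0" "length w \<le> Suc k" "F [] = 0"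
  shows "shuffle F G w = (\<Sum>i<length w. F [w ! i] * G (take i w @ drop (Suc i) w))"
  using assms
proof (induction w arbitrary: F G k)
  case (Cons x w)
  have 1: "shuffle (\<lambda>v. F (x # v)) G w = F [x] * G w"
    using shuffle_low[of k G w "\<lambda>v. F (x # v)"] Cons.prems by auto
  have 2: "shuffle F (\<lambda>v. G (x # v)) w = (\<Sum>i<length w. F [w ! i] * G (x # take i w @ drop (Suc i) w))"
  proof (cases k)
    case 0
    then show ?thesis using Cons.prems by simp
  next
    case (Suc k')
    then show ?thesis using Cons.IH[of k' "\<lambda>v. G (x # v)" F] Cons.prems by auto
  qed
  show ?case by (simp add: 1 2 sum.lessThan_Suc_shift del: sum.lessThan_Suc)
qed simp

context algebra_basis
begin

text \<open>Each factor vanishes on the empty word and so needs a letter of its own.\<close>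

lemma Phi_short: "length w < length gs \<Longrightarrow> Phi gs w = 0"
proof (induction gs arbitrary: w)
  case (Cons g gs)
  have "edge_functional g [] = 0" by (cases g) (simp add: edge_functional_def coeff_functional_def)
  then show ?case using shuffle_low[of "length gs" "Phi gs" w "edge_functional g"] Cons by (auto simp: Phi_Cons)
qed simp

lemma edge_functional_Em:
  assumes "snd (snd h) \<in> X" "snd (snd g) \<in> X"
  shows "edge_functional g [Em h] = (if g = h then 1 else 0)"
  using assms
  by (auto simp: edge_functional_def coeff_functional_def Emat_def lookup_single when_def crd_basis
      crd_zero split: prod.splits)

text \<open>The value is the permanent of a matrix of zeros and ones: it counts the ways to match
  \<open>gs\<close> with \<open>hs\<close>. Only integrality and the criterion for positivity are
  recorded, because they already exclude cancellation in the sums over paths.\<close>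

lemma Phi_edges:
  assumes "snd ` snd ` set gs \<subseteq> X" "snd ` snd ` set hs \<subseteq> X" "length hs \<le> length gs"
  shows "\<exists>n. Phi gs (map Em hs) = of_nat n \<and> (n > 0 \<longleftrightarrow> mset gs = mset hs)"
  using assms
proof (induction gs arbitrary: hs)
  case Nil
  then show ?case by (auto simp: Phi_Nil counit_def intro!: exI[of _ 1])
next
  case (Cons g gs)
  define rem where "rem i = take i hs @ drop (Suc i) hs" for i
  have rem: "mset hs = add_mset (hs ! i) (mset (rem i))" "length (rem i) \<le> length gs" "set (rem i) \<subseteq> set hs"
    if "i < length hs" for i
    using that Cons.prems(3) arg_cong[OF id_take_nth_drop[OF that], of mset]
    by (auto simp: rem_def dest: in_set_takeD in_set_dropD)
  have "\<exists>n. Phi gs (map Em (rem i)) = of_nat n \<and> (n > 0 \<longleftrightarrow> mset gs = mset (rem i))" if "i < length hs" for i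
    using Cons.prems rem[OF that] by (intro Cons.IH) auto
  then obtain n where n: "\<And>i. i < length hs \<Longrightarrow> Phi gs (map Em (rem i)) = of_nat (n i) \<and> (n i > 0 \<longleftrightarrow> mset gs = mset (rem i))"
    by metis
  have e0: "edge_functional g [] = 0" by (cases g) (simp add: edge_functional_def coeff_functional_def)
  \<comment> \<open>Expansion of the permanent along its first row: \<open>g\<close> is matched with
    the letter at \<open>i\<close>, the list \<open>gs\<close> with what remains.\<close>
  have "Phi (g # gs) (map Em hs) = (\<Sum>i<length hs. edge_functional g [Em (hs ! i)] * Phi gs (map Em (rem i)))"
    unfolding Phi_Cons
    by (subst shuffle_next[of "length gs"]) (use Cons.prems e0 in \<open>auto simp: Phi_short rem_def take_map drop_map\<close>)
  also have "\<dots> = (\<Sum>i<length hs. of_nat (if g = hs ! i then n i else 0))"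
    using Cons.prems n by (intro sum.cong) (auto simp: edge_functional_Em subset_iff)
  also have "\<dots> = of_nat (\<Sum>i<length hs. if g = hs ! i then n i else 0)" by simp
  finally have eq: "Phi (g # gs) (map Em hs) = of_nat (\<Sum>i<length hs. if g = hs ! i then n i else 0)" .
  define Z where "Z = (\<Sum>i<length hs. if g = hs ! i then n i else 0)"
  have "Z = 0 \<longleftrightarrow> (\<forall>i<length hs. g = hs ! i \<longrightarrow> n i = 0)"
    unfolding Z_def by (auto simp: sum_eq_0_iff)
  then have "Z > 0 \<longleftrightarrow> (\<exists>i<length hs. g = hs ! i \<and> n i > 0)" by auto
  also have "\<dots> \<longleftrightarrow> (\<exists>i<length hs. g = hs ! i \<and> mset gs = mset (rem i))" using n by auto
  also have "\<dots> \<longleftrightarrow> mset (g # gs) = mset hs"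
  proof
    assume "mset (g # gs) = mset hs"
    then have "g \<in> set hs" by (metis list.set_intros(1) set_mset_mset)
    then obtain i where "i < length hs" "g = hs ! i" by (auto simp: in_set_conv_nth)
    with rem(1)[of i] \<open>mset (g # gs) = mset hs\<close> show "\<exists>i<length hs. g = hs ! i \<and> mset gs = mset (rem i)"
      by auto
  qed (use rem(1) in auto)
  finally have "Z > 0 \<longleftrightarrow> mset (g # gs) = mset hs" .
  moreover have "Phi (g # gs) (map Em hs) = of_nat Z" using eq by (simp only: Z_def)
  ultimately show ?case by (intro exI[of _ Z] conjI)
qed

end

section \<open>Sorting\<close>

lemma ex_sorted_perm:
  assumes "linear_order_on T r" "set ws \<subseteq> T"
  shows "\<exists>ws'. mset ws' = mset ws \<and> ws' \<in> weakly_increasing_lists r T"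
proof -
  have r: "trans r" "total_on T r" "refl_on T r"
    using assms(1) by (auto simp: linear_order_on_def partial_order_on_def preorder_on_def)
  have tr: "\<And>x y z. (x, y) \<in> r \<Longrightarrow> (y, z) \<in> r \<Longrightarrow> (x, z) \<in> r" using r(1) by (rule transD)
  have tot: "(x, y) \<in> r \<or> (y, x) \<in> r" if "x \<in> T" "y \<in> T" for x y
    using r(2,3) that by (cases "x = y") (auto simp: total_on_def dest: refl_onD)
  have ins: "\<exists>ws'. mset ws' = add_mset a (mset ws) \<and> sorted_wrt (\<lambda>t t'. (t, t') \<in> r) ws'"
    if "a \<in> T" "set ws \<subseteq> T" "sorted_wrt (\<lambda>t t'. (t, t') \<in> r) ws" for a ws
    using that
  proof (induction ws)
    case Nil
    then show ?case by (auto intro!: exI[of _ "[a]"])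
  next
    case (Cons b ws)
    show ?case
    proof (cases "(a, b) \<in> r")
      case True
      then have "sorted_wrt (\<lambda>t t'. (t, t') \<in> r) (a # b # ws)" using Cons.prems tr by auto
      then show ?thesis by (intro exI[of _ "a # b # ws"]) auto
    next
      case False
      then have ba: "(b, a) \<in> r" using tot Cons.prems by auto
      from Cons obtain ws' where ws': "mset ws' = add_mset a (mset ws)" "sorted_wrt (\<lambda>t t'. (t, t') \<in> r) ws'" by auto
      then have "set ws' = insert a (set ws)" by (metis set_mset_add_mset_insert set_mset_mset)
      then have "sorted_wrt (\<lambda>t t'. (t, t') \<in> r) (b # ws')" using Cons.prems ba ws' by auto
      then show ?thesis using ws' by (intro exI[of _ "b # ws'"]) auto
    qed
  qed
  show ?thesis using assms(2)
  proof (induction ws)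
    case Nil
    then show ?case by (auto simp: weakly_increasing_lists_def)
  next
    case (Cons a ws)
    then obtain ws' where "mset ws' = mset ws" "set ws' \<subseteq> T" "sorted_wrt (\<lambda>t t'. (t, t') \<in> r) ws'"
      by (auto simp: weakly_increasing_lists_def)
    with ins[of a ws'] Cons.prems obtain ws'' where "mset ws'' = mset (a # ws)" "sorted_wrt (\<lambda>t t'. (t, t') \<in> r) ws''"
      by auto
    moreover from this(1) have "set ws'' = set (a # ws)" by (metis set_mset_mset)
    ultimately show ?case using Cons.prems
      by (intro exI[of _ ws'']) (auto simp: weakly_increasing_lists_def)
  qed
qed

lemma sorted_perm_unique:
  assumes "linear_order_on T r" "ws \<in> weakly_increasing_lists r T" "ws' \<in> weakly_increasing_lists r T" "mset ws = mset ws'"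
  shows "ws = ws'"
  using assms(2-)
proof (induction ws arbitrary: ws')
  case (Cons a ws)
  then obtain b v where ws': "ws' = b # v" by (cases ws') auto
  have refl: "(x, x) \<in> r" if "x \<in> T" for x
    using assms(1) that by (auto simp: linear_order_on_def partial_order_on_def preorder_on_def refl_on_def)
  have "set (a # ws) = set (b # v)" using Cons.prems(3) by (metis set_mset_mset ws')
  then have "b \<in> insert a (set ws)" "a \<in> insert b (set v)" by auto
  then have "(a, b) \<in> r" "(b, a) \<in> r" using Cons.prems(1,2) refl by (auto simp: weakly_increasing_lists_def ws')
  then have "a = b" using assms(1) by (auto simp: linear_order_on_def partial_order_on_def antisym_def)
  then show ?case using Cons.IH[of v] Cons.prems by (auto simp: weakly_increasing_lists_def ws')
qed (auto simp: weakly_increasing_lists_def)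

text \<open>In the application \<open>S K\<close> is the span of the sorted products of weight at most \<open>K\<close>; commuting
  two neighbours costs an error of smaller weight, which is sorted recursively.\<close>

lemma sorting_span:
  fixes S :: "nat \<Rightarrow> 'v::ab_group_add set" and pr :: "'t list \<Rightarrow> 'v"
  assumes r: "linear_order_on T r" and wt: "\<And>t. t \<in> T \<Longrightarrow> 1 \<le> wt t"
    and zero: "\<And>K. 0 \<in> S K" and add: "\<And>K a b. a \<in> S K \<Longrightarrow> b \<in> S K \<Longrightarrow> a + b \<in> S K"
    and mono: "\<And>K. S K \<subseteq> S (Suc K)"
    and srt: "\<And>ws K. ws \<in> weakly_increasing_lists r T \<Longrightarrow> sum_list (map wt ws) \<le> K \<Longrightarrow> pr ws \<in> S K"
    and swp: "\<And>us a b vs K. set (us @ a # b # vs) \<subseteq> T \<Longrightarrow> sum_list (map wt (us @ a # b # vs)) \<le> Suc K \<Longrightarrow>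
      (\<And>ws. set ws \<subseteq> T \<Longrightarrow> sum_list (map wt ws) \<le> K \<Longrightarrow> pr ws \<in> S K) \<Longrightarrow>
      pr (us @ a # b # vs) - pr (us @ b # a # vs) \<in> S K"
    and ws: "set ws \<subseteq> T" "sum_list (map wt ws) \<le> K"
  shows "pr ws \<in> S K"
  using ws
proof (induction K arbitrary: ws)
  case 0
  then have "ws = []" using wt by (cases ws) fastforce+
  then show ?case using srt[of ws 0] 0 by (simp add: weakly_increasing_lists_def)
next
  case (Suc K)
  have trans: "x - z \<in> S K" if "x - y \<in> S K" "y - z \<in> S K" for x y z
    using add[OF that] by simp
  have move: "pr (us @ a # p @ q) - pr (us @ p @ a # q) \<in> S K"
    if "set (us @ a # p @ q) \<subseteq> T" "sum_list (map wt (us @ a # p @ q)) \<le> Suc K" for us a p q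
    using that
  proof (induction p arbitrary: us)
    case Nil
    then show ?case by (simp add: zero)
  next
    case (Cons b p)
    have "pr (us @ a # b # p @ q) - pr (us @ b # a # p @ q) \<in> S K"
      using Cons.prems Suc.IH by (intro swp) auto
    moreover have "pr ((us @ [b]) @ a # p @ q) - pr ((us @ [b]) @ p @ a # q) \<in> S K"
      using Cons.prems by (intro Cons.IH) auto
    ultimately show ?case by (auto intro: trans)
  qed
  \<comment> \<open>Selection sort modulo \<open>S K\<close>: the first letter \<open>a\<close> of
    \<open>w\<close> is brought to the front of \<open>w'\<close>, joins the fixed prefix, and the
    remaining letters follow.\<close>
  have perm: "pr (us @ w) - pr (us @ w') \<in> S K"
    if "mset w = mset w'" "set (us @ w) \<subseteq> T" "sum_list (map wt (us @ w)) \<le> Suc K" for us w w'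
    using that
  proof (induction w arbitrary: us w')
    case Nil
    then show ?case by (simp add: zero)
  next
    case (Cons a w)
    from Cons.prems(1) have "a \<in> set w'" by (metis list.set_intros(1) set_mset_mset)
    then obtain p q where w': "w' = p @ a # q" by (auto simp: in_set_conv_decomp)
    then have m: "mset w = mset (p @ q)" using Cons.prems(1) by simp
    then have s: "set w = set (p @ q)" "sum_list (map wt w) = sum_list (map wt (p @ q))"
      by (metis set_mset_mset) (metis m mset_map sum_mset_sum_list)
    have "pr ((us @ [a]) @ w) - pr ((us @ [a]) @ p @ q) \<in> S K"
      using Cons.prems m by (intro Cons.IH) auto
    moreover have "pr (us @ a # p @ q) - pr (us @ p @ a # q) \<in> S K"
      using Cons.prems s by (intro move) auto
    ultimately show ?case by (auto intro: trans simp: w')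
  qed
  obtain ws' where ws': "mset ws' = mset ws" "ws' \<in> weakly_increasing_lists r T"
    using ex_sorted_perm[OF r Suc.prems(1)] by blast
  have "sum_list (map wt ws') = sum_list (map wt ws)"
    by (metis ws'(1) mset_map sum_mset_sum_list)
  then have "pr ws' \<in> S (Suc K)" using srt[OF ws'(2)] Suc.prems by simp
  moreover have "pr ws - pr ws' \<in> S (Suc K)"
    using perm[of ws ws' "[]"] ws' Suc.prems mono by auto
  ultimately show ?case using add[of "pr ws - pr ws'" "Suc K" "pr ws'"] by simp
qed

section \<open>Presentation of the enveloping algebras inside the big one\<close>

abbreviation Fc :: "nat \<Rightarrow> 'w::nonunital_complex_algebra matr falg set" where
  "Fc N \<equiv> carrier (Ufree N)"

lemma Ufree_simps [simp]:
  "monoid.mult (Ufree N) = (*)" "add (Ufree N) = (+)" "one (Ufree N) = 1" "zero (Ufree N) = 0"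
  by (simp_all add: free_alg_def)

lemma Fc_iff: "p \<in> Fc N \<longleftrightarrow> (\<forall>w\<in>keys p. set (letters w) \<subseteq> gl N)"
  by (simp add: free_alg_def)

lemma Fc_add: "p \<in> Fc N \<Longrightarrow> q \<in> Fc N \<Longrightarrow> p + q \<in> Fc N"
  and Fc_mult: "p \<in> Fc N \<Longrightarrow> q \<in> Fc N \<Longrightarrow> p * q \<in> Fc N"
  and Fc_0: "0 \<in> Fc N" and Fc_1: "1 \<in> Fc N"
proof -
  interpret ring "Ufree N" by (rule ring_free_alg)
  show "p \<in> Fc N \<Longrightarrow> q \<in> Fc N \<Longrightarrow> p + q \<in> Fc N" "p \<in> Fc N \<Longrightarrow> q \<in> Fc N \<Longrightarrow> p * q \<in> Fc N" "0 \<in> Fc N" "1 \<in> Fc N"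
    using a_closed[of p q] m_closed[of p q] zero_closed one_closed by simp_all
qed

lemma Fc_uminus: "p \<in> Fc N \<Longrightarrow> - p \<in> Fc N"
  by (auto simp: Fc_iff)

lemma Fc_diff: "p \<in> Fc N \<Longrightarrow> q \<in> Fc N \<Longrightarrow> p - q \<in> Fc N"
  using Fc_add[of p N "- q"] Fc_uminus[of q N] by simp

lemma Fc_single: "set ws \<subseteq> gl N \<Longrightarrow> single (Word ws) c \<in> Fc N"
  by (auto simp: Fc_iff)

lemma Fc_gen: "x \<in> gl N \<Longrightarrow> gen x \<in> Fc N"
  by (simp add: gen_def Fc_single)

lemma Fc_cst: "cst c \<in> Fc N"
  using Fc_single[of "[]" N c] by (simp add: cst_def zero_fmon_def)

lemma Fc_gens: "set ws \<subseteq> gl N \<Longrightarrow> prod_list (map gen ws) \<in> Fc N"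
  by (induction ws) (auto intro: Fc_mult Fc_gen Fc_1)

lemma cst_left_commute: "p * (cst c * q) = cst c * (p * q)"
  unfolding mult.assoc[symmetric] cst_commute[of c p] ..

lemma Fc_sum: "(\<And>x. x \<in> S \<Longrightarrow> f x \<in> Fc N) \<Longrightarrow> sum f S \<in> Fc N"
  by (induction S rule: infinite_finite_induct) (auto intro: Fc_0 Fc_add)

lemma gl_mono: "N \<le> M \<Longrightarrow> gl N \<subseteq> gl M"
  by (fastforce simp: gl_def)

lemma Fc_mono: "N \<le> M \<Longrightarrow> Fc N \<subseteq> Fc M"
  unfolding subset_iff Fc_iff using gl_mono[of N M] by blast

lemma Fc_letters: "p \<in> Fc N \<Longrightarrow> Word ws \<in> keys p \<Longrightarrow> set ws \<subseteq> gl N"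
  by (metis Fc_iff fmon.sel)

lemma a_inv_Ufree: "p \<in> Fc N \<Longrightarrow> a_inv (Ufree N) p = - p"
proof -
  assume p: "p \<in> Fc N"
  interpret ring "Ufree N" by (rule ring_free_alg)
  show ?thesis using p minus_equality[of "- p" p] by (simp add: Fc_uminus)
qed

lemma ideal_UfreeI:
  assumes "I \<subseteq> Fc N" "0 \<in> I" "\<And>p q. p \<in> I \<Longrightarrow> q \<in> I \<Longrightarrow> p + q \<in> I" "\<And>p. p \<in> I \<Longrightarrow> - p \<in> I"
    "\<And>p q. p \<in> I \<Longrightarrow> q \<in> Fc N \<Longrightarrow> q * p \<in> I" "\<And>p q. p \<in> I \<Longrightarrow> q \<in> Fc N \<Longrightarrow> p * q \<in> I"
  shows "ideal I (Ufree N)"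
proof (rule idealI[OF ring_free_alg])
  show "subgroup I (add_monoid (Ufree N))"
  proof
    fix x assume "x \<in> I"
    then show "inv\<^bsub>add_monoid (Ufree N)\<^esub> x \<in> I"
      using a_inv_Ufree[of x N] assms unfolding a_inv_def by auto
  qed (use assms in auto)
qed (use assms in auto)

lemma uea_relations_subset: "uea_relations (gl N) mat_scale gl_bracket \<subseteq> Fc N"
  by (auto simp: uea_relations_def intro!: Fc_diff Fc_mult Fc_gen Fc_cst gl_add gl_scale gl_bracket_closed)

lemma ideal_Uideal: "ideal (Uideal N) (Ufree N)"
  unfolding uea_ideal_def by (rule ring.genideal_ideal[OF ring_free_alg uea_relations_subset])

lemma Uideal_relations: "uea_relations (gl N) mat_scale gl_bracket \<subseteq> Uideal N"
  unfolding uea_ideal_def by (rule ring.genideal_self[OF ring_free_alg uea_relations_subset])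

lemma Uideal_rel_add: "x \<in> gl N \<Longrightarrow> y \<in> gl N \<Longrightarrow> gen (x + y) - gen x - gen y \<in> Uideal N"
  and Uideal_rel_scale: "x \<in> gl N \<Longrightarrow> gen (mat_scale c x) - cst c * gen x \<in> Uideal N"
  and Uideal_rel_bracket: "x \<in> gl N \<Longrightarrow> y \<in> gl N \<Longrightarrow> gen x * gen y - gen y * gen x - gen (gl_bracket x y) \<in> Uideal N"
  by (rule subsetD[OF Uideal_relations], unfold uea_relations_def, blast)+

lemma Uideal_Fc: "p \<in> Uideal N \<Longrightarrow> p \<in> Fc N"
  using ideal.Icarr[OF ideal_Uideal] by auto

lemma Uideal_0: "0 \<in> Uideal N"
  and Uideal_add: "p \<in> Uideal N \<Longrightarrow> q \<in> Uideal N \<Longrightarrow> p + q \<in> Uideal N"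
  and Uideal_mult_left: "p \<in> Uideal N \<Longrightarrow> q \<in> Fc N \<Longrightarrow> q * p \<in> Uideal N"
  and Uideal_mult_right: "p \<in> Uideal N \<Longrightarrow> q \<in> Fc N \<Longrightarrow> p * q \<in> Uideal N"
proof -
  interpret ideal "Uideal N" "Ufree N" by (rule ideal_Uideal)
  show "0 \<in> Uideal N" "p \<in> Uideal N \<Longrightarrow> q \<in> Uideal N \<Longrightarrow> p + q \<in> Uideal N"
    "p \<in> Uideal N \<Longrightarrow> q \<in> Fc N \<Longrightarrow> q * p \<in> Uideal N" "p \<in> Uideal N \<Longrightarrow> q \<in> Fc N \<Longrightarrow> p * q \<in> Uideal N"
    using additive_subgroup.zero_closed[OF is_additive_subgroup] additive_subgroup.a_closed[OF is_additive_subgroup, of p q]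
      I_l_closed[of p q] I_r_closed[of p q] by simp_all
qed

text \<open>The easy inclusion: the joint kernel is an ideal containing the relations.\<close>

lemma Uideal_subset_Jker: "Uideal N \<subseteq> Jker"
proof -
  have "ideal (Jker \<inter> Fc N) (Ufree N)"
    by (rule ideal_UfreeI)
      (auto intro: Jker_zero Jker_add Jker_uminus Jker_mult_left Jker_mult_right Fc_0 Fc_add Fc_uminus Fc_mult)
  moreover have "uea_relations (gl N) mat_scale gl_bracket \<subseteq> Jker"
    by (auto simp: uea_relations_def simp flip: clsE_eq_0_iff
        simp: clsE_diff clsE_mult clsE_gen clsE_cst gE_add gE_scale gE_bracket)
  ultimately show ?thesis
    unfolding uea_ideal_def
    using ring.genideal_minimal[OF ring_free_alg, of "Jker \<inter> Fc N" "gl N"] uea_relations_subset by blast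
qed

lemma sum_keys_add:
  fixes h :: "'i \<Rightarrow> 'c::comm_monoid_add \<Rightarrow> 'v::comm_monoid_add"
  assumes "\<And>i. h i 0 = 0" "\<And>i a b. h i (a + b) = h i a + h i b"
  shows "(\<Sum>i\<in>keys (c + c'). h i (lookup (c + c') i)) =
    (\<Sum>i\<in>keys c. h i (lookup c i)) + (\<Sum>i\<in>keys c'. h i (lookup c' i))"
proof -
  let ?S = "keys c \<union> keys c'"
  have *: "(\<Sum>i\<in>keys b. h i (lookup b i)) = (\<Sum>i\<in>?S. h i (lookup b i))"
    if "keys b \<subseteq> ?S" for b
    using that by (intro sum.mono_neutral_left) (auto simp: in_keys_iff assms)
  show ?thesis
    unfolding *[OF Poly_Mapping.keys_add] *[OF Un_upper1] *[OF Un_upper2]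
    by (simp add: lookup_add assms sum.distrib)
qed

section \<open>Sorted edge words span modulo the relations\<close>

context algebra_basis
begin

definition edges :: "nat \<Rightarrow> (nat \<times> nat \<times> 'w) set" where
  "edges N = {1..N} \<times> {1..N} \<times> X"

lemma Em_gl: "e \<in> edges N \<Longrightarrow> Em e \<in> gl N"
  by (auto simp: edges_def intro: gl_Emat)

lemma Fc_edge_word: "set ws \<subseteq> edges N \<Longrightarrow> prod_list (map gen (map Em ws)) \<in> Fc N"
proof (rule Fc_gens)
  assume "set ws \<subseteq> edges N"
  then show "set (map Em ws) \<subseteq> gl N" using Em_gl unfolding set_map by blast
qed

text \<open>The filtered span of sorted edge words modulo the ideal. As an inductive set it lets
  \<open>pbw_expand\<close> read off the coefficients by induction.\<close>

inductive_set pbw :: "((nat \<times> nat \<times> 'w) \<times> (nat \<times> nat \<times> 'w)) set \<Rightarrow> nat \<Rightarrow> nat \<Rightarrow> 'w matr falg set"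
  for r :: "((nat \<times> nat \<times> 'w) \<times> (nat \<times> nat \<times> 'w)) set" and N K :: nat where
  pbw_ideal: "p \<in> Uideal N \<Longrightarrow> p \<in> pbw r N K"
| pbw_word: "ws \<in> weakly_increasing_lists r (edges N) \<Longrightarrow> length ws \<le> K \<Longrightarrow>
     single (Word (map Em ws)) c \<in> pbw r N K"
| pbw_add: "p \<in> pbw r N K \<Longrightarrow> q \<in> pbw r N K \<Longrightarrow> p + q \<in> pbw r N K"

lemma pbw_cong: "p - q \<in> Uideal N \<Longrightarrow> q \<in> pbw r N K \<Longrightarrow> p \<in> pbw r N K"
proof -
  assume "p - q \<in> Uideal N" "q \<in> pbw r N K"
  then have "(p - q) + q \<in> pbw r N K" by (rule pbw_add[OF pbw_ideal])
  then show ?thesis by simp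
qed

lemma pbw_mono: "p \<in> pbw r N K \<Longrightarrow> K \<le> K' \<Longrightarrow> p \<in> pbw r N K'"
  by (induction rule: pbw.induct) (auto intro: pbw.intros)

lemma pbw_cst: "p \<in> pbw r N K \<Longrightarrow> cst c * p \<in> pbw r N K"
proof (induction rule: pbw.induct)
  case (pbw_ideal p)
  then show ?case by (intro pbw.pbw_ideal Uideal_mult_left Fc_cst)
qed (auto simp: cst_mult_single distrib_left intro: pbw.intros)

text \<open>The linear relations expand one letter into matrix units with entries in
  \<open>X\<close>, while the context \<open>L\<close>, \<open>R\<close> stays fixed.\<close>

lemma pbw_matrix:
  assumes L: "L \<in> Fc N" and R: "R \<in> Fc N"
    and E: "\<And>e. e \<in> edges N \<Longrightarrow> L * gen (Em e) * R \<in> pbw r N K"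
    and A: "A \<in> gl N"
  shows "L * gen A * R \<in> pbw r N K"
proof -
  have LR: "L * p * R \<in> Uideal N" if "p \<in> Uideal N" for p
    using that L R by (intro Uideal_mult_left Uideal_mult_right)
  have plus: "L * gen (x + y) * R \<in> pbw r N K"
    if "x \<in> gl N" "y \<in> gl N" "L * gen x * R \<in> pbw r N K" "L * gen y * R \<in> pbw r N K" for x y
  proof (rule pbw_cong)
    have "gen (x + y) - gen x - gen y \<in> Uideal N"
      using that(1,2) by (rule Uideal_rel_add)
    from LR[OF this] show "L * gen (x + y) * R - (L * gen x * R + L * gen y * R) \<in> Uideal N"
      by (simp add: algebra_simps)
  qed (use that in \<open>auto intro: pbw_add\<close>)
  have scale: "L * gen (mat_scale c x) * R \<in> pbw r N K"
    if "x \<in> gl N" "L * gen x * R \<in> pbw r N K" for c x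
  proof (rule pbw_cong)
    have "gen (mat_scale c x) - cst c * gen x \<in> Uideal N"
      using that(1) by (rule Uideal_rel_scale)
    from LR[OF this] have "L * gen (mat_scale c x) * R - L * (cst c * gen x) * R \<in> Uideal N"
      by (simp add: algebra_simps)
    also have "L * (cst c * gen x) * R = cst c * (L * gen x * R)"
      by (simp only: cst_left_commute mult.assoc)
    finally show "L * gen (mat_scale c x) * R - cst c * (L * gen x * R) \<in> Uideal N" .
  qed (use that in \<open>auto intro: pbw_cst\<close>)
  have zero: "L * gen 0 * R \<in> pbw r N K"
  proof (rule pbw_ideal)
    have "gen (mat_scale 0 0) - cst 0 * gen (0 :: 'w matr) \<in> Uideal N"
      by (rule Uideal_rel_scale) (simp add: gl_def)
    moreover have "mat_scale 0 0 = (0 :: 'w matr)"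
      by (rule poly_mapping_eqI) (simp add: lookup_mat_scale)
    ultimately have "gen (0 :: 'w matr) \<in> Uideal N" by simp
    then show "L * gen 0 * R \<in> Uideal N" by (rule LR)
  qed
  show ?thesis using A
  proof (induction rule: gl_eq_span_Emat_induct)
    case zero
    then show ?case by (rule \<open>L * gen 0 * R \<in> pbw r N K\<close>)
  next
    case (Emat i j x)
    have "x \<in> nuca.span X" by (simp add: span_X)
    then show ?case
    proof (induction rule: nuca.span_induct_alt)
      case base
      then show ?case by (simp add: zero)
    next
      case (step c x y)
      have "L * gen (Emat i j (scaleC c x)) * R \<in> pbw r N K"
        using E[of "(i, j, x)"] Emat step(1) scale[of "Emat i j x" c] gl_Emat[of i N j x]
        by (simp add: edges_def mat_scale_Emat)
      then show ?case using step Emat by (simp add: Emat_add plus gl_Emat)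
    qed
  next
    case (add A B)
    then show ?case by (simp add: plus)
  qed
qed

text \<open>Sorting with all letters of weight 1: exchanging two neighbours costs a word in which
  their bracket replaces them, one letter shorter. The bracket is a matrix but in general no edge,
  so it goes through \<open>pbw_matrix\<close>.\<close>

lemma pbw_edge_word:
  assumes r: "linear_order_on (edges N) r" and "set ws \<subseteq> edges N" "length ws \<le> K"
  shows "single (Word (map Em ws)) 1 \<in> pbw r N K"
proof (rule sorting_span[where S="pbw r N" and wt="\<lambda>_. 1" and T="edges N" and r=r
      and pr="\<lambda>ws. single (Word (map Em ws)) 1"])
  fix us vs K and a b :: "nat \<times> nat \<times> 'w"
  assume ab: "set (us @ a # b # vs) \<subseteq> edges N" "sum_list (map (\<lambda>_. 1) (us @ a # b # vs)) \<le> Suc K"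
    and IH: "\<And>ws. set ws \<subseteq> edges N \<Longrightarrow> sum_list (map (\<lambda>_. 1) ws) \<le> K \<Longrightarrow>
       single (Word (map Em ws)) 1 \<in> pbw r N K"
  define L R where "L = prod_list (map gen (map Em us))" and "R = prod_list (map gen (map Em vs))"
  have LR: "L \<in> Fc N" "R \<in> Fc N"
    using ab unfolding L_def R_def by (auto intro!: Fc_edge_word simp del: map_map)
  have gl: "Em a \<in> gl N" "Em b \<in> gl N" using ab Em_gl by auto
  have single: "single (Word (map Em (us @ w @ vs))) 1 = L * prod_list (map gen (map Em w)) * R" for w
    by (simp add: single_Word_eq L_def R_def mult.assoc)
  have "L * gen (Em e) * R \<in> pbw r N K" if "e \<in> edges N" for e
    using single[of "[e]"] IH[of "us @ e # vs"] that ab by (simp add: sum_list_triv)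
  then have br: "L * gen (gl_bracket (Em a) (Em b)) * R \<in> pbw r N K"
    by (rule pbw_matrix[OF LR _ gl_bracket_closed[OF gl]])
  have "gen (Em a) * gen (Em b) - gen (Em b) * gen (Em a) - gen (gl_bracket (Em a) (Em b)) \<in> Uideal N"
    using gl by (rule Uideal_rel_bracket)
  then have "L * (gen (Em a) * gen (Em b) - gen (Em b) * gen (Em a) - gen (gl_bracket (Em a) (Em b))) * R \<in> Uideal N"
    using LR by (intro Uideal_mult_left Uideal_mult_right)
  then have "L * (gen (Em a) * gen (Em b)) * R - L * (gen (Em b) * gen (Em a)) * R - L * gen (gl_bracket (Em a) (Em b)) * R \<in> Uideal N"
    by (simp add: algebra_simps)
  from pbw_cong[OF this br]
  show "single (Word (map Em (us @ a # b # vs))) 1 - single (Word (map Em (us @ b # a # vs))) 1 \<in> pbw r N K"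
    using single[of "[a, b]"] single[of "[b, a]"] by simp
qed (use assms in \<open>auto intro: pbw.intros pbw_mono Uideal_0 simp: sum_list_triv\<close>)

lemma pbw_Fc:
  assumes r: "linear_order_on (edges N) r" and p: "p \<in> Fc N"
  shows "\<exists>K. p \<in> pbw r N K"
proof -
  \<comment> \<open>The letters to the left have been expanded into edges already; the first letter
    of \<open>As\<close> is the next one.\<close>
  have word: "prod_list (map gen (map Em us)) * prod_list (map gen As) \<in> pbw r N (length us + length As)"
    if "set us \<subseteq> edges N" "set As \<subseteq> gl N" for us As
    using that
  proof (induction As arbitrary: us)
    case Nil
    then show ?case using pbw_edge_word[OF r, of us "length us"] by (simp add: single_Word_eq)
  next
    case (Cons A As)
    have "prod_list (map gen (map Em us)) * gen A * prod_list (map gen As) \<in> pbw r N (length us + length (A # As))"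
    proof (rule pbw_matrix)
      show "prod_list (map gen (map Em us)) \<in> Fc N" "prod_list (map gen As) \<in> Fc N"
        using Cons.prems Fc_gens[of As N] by (auto intro!: Fc_edge_word simp del: map_map)
      fix e :: "nat \<times> nat \<times> 'w" assume "e \<in> edges N"
      then show "prod_list (map gen (map Em us)) * gen (Em e) * prod_list (map gen As) \<in> pbw r N (length us + length (A # As))"
        using Cons.IH[of "us @ [e]"] Cons.prems by (simp add: mult.assoc)
    qed (use Cons.prems in auto)
    then show ?case by (simp add: mult.assoc)
  qed
  have "\<exists>K. (\<Sum>k\<in>S. single k (lookup p k)) \<in> pbw r N K"
    if "finite S" "S \<subseteq> keys p" for S
    using that
  proof (induction S rule: finite_induct)
    case empty
    then show ?case by (auto intro: pbw_ideal Uideal_0)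
  next
    case (insert k S)
    then obtain K where K: "(\<Sum>k\<in>S. single k (lookup p k)) \<in> pbw r N K" by auto
    obtain ws where ws: "k = Word ws" by (cases k)
    then have "set ws \<subseteq> gl N" using Fc_letters[OF p(1), of ws] insert.prems by auto
    then have "single k (lookup p k) \<in> pbw r N (length ws)"
      using word[of "[]" ws] by (simp add: ws single_Word_eq pbw_cst)
    then have "single k (lookup p k) + (\<Sum>k\<in>S. single k (lookup p k)) \<in> pbw r N (length ws + K)"
      using K by (intro pbw_add) (auto intro: pbw_mono)
    then show ?case using insert.hyps by auto
  qed
  from this[OF finite_keys order_refl] show ?thesis by (simp add: poly_mapping_sum_single)
qed

lemma pbw_expand:
  assumes "p \<in> pbw r N K"
  shows "\<exists>c. keys c \<subseteq> weakly_increasing_lists r (edges N) \<and>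
     p - (\<Sum>ws\<in>keys c. single (Word (map Em ws)) (lookup c ws)) \<in> Uideal N"
  using assms
proof (induction rule: pbw.induct)
  case (pbw_ideal p)
  then show ?case by (auto intro!: exI[of _ 0])
next
  case (pbw_word ws c)
  then show ?case
    by (intro exI[of _ "single ws c"]) (auto simp: Uideal_0)
next
  case (pbw_add p q)
  define s where "s c = (\<Sum>ws\<in>keys c. single (Word (map Em ws)) (lookup c ws))"
    for c :: "(nat \<times> nat \<times> 'w) list \<Rightarrow>\<^sub>0 complex"
  from pbw_add obtain c c' where c: "keys c \<subseteq> weakly_increasing_lists r (edges N)" "p - s c \<in> Uideal N"
    "keys c' \<subseteq> weakly_increasing_lists r (edges N)" "q - s c' \<in> Uideal N" by (auto simp: s_def)
  have "s (c + c') = s c + s c'"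
    unfolding s_def by (rule sum_keys_add) (simp_all add: single_add)
  then have "p + q - s (c + c') \<in> Uideal N"
    using Uideal_add[OF c(2,4)] by (simp add: algebra_simps)
  moreover have "keys (c + c') \<subseteq> weakly_increasing_lists r (edges N)"
    using c Poly_Mapping.keys_add[of c c'] by blast
  ultimately show ?case unfolding s_def by blast
qed

lemma ex_edge_order: "\<exists>r. linear_order_on (edges N) r"
  using well_order_on[of "edges N"] by (auto simp: well_order_on_def)

text \<open>A combination of sorted edge words is detected by the functional of a longest word in it.\<close>

lemma Uideal_if_Phi_zero:
  assumes p: "p \<in> Fc N" and zero: "\<And>gs. set gs \<subseteq> edges N \<Longrightarrow> lin (Phi gs) p = 0"
  shows "p \<in> Uideal N"
proof -
  obtain r where r: "linear_order_on (edges N) r" using ex_edge_order by blast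
  obtain K where "p \<in> pbw r N K" using pbw_Fc[OF r p] by blast
  from pbw_expand[OF this] obtain c where c: "keys c \<subseteq> weakly_increasing_lists r (edges N)"
    "p - (\<Sum>ws\<in>keys c. single (Word (map Em ws)) (lookup c ws)) \<in> Uideal N"
    by blast
  have in_edges: "set ws \<subseteq> edges N" if "ws \<in> keys c" for ws
    using c that by (auto simp: weakly_increasing_lists_def)
  have sum0: "(\<Sum>ws\<in>keys c. lookup c ws * Phi gs (map Em ws)) = 0" if "set gs \<subseteq> edges N" for gs
  proof -
    have "lin (Phi gs) (p - (\<Sum>ws\<in>keys c. single (Word (map Em ws)) (lookup c ws))) = 0"
      using c(2) Uideal_subset_Jker good_Phi by (auto simp: Jker_def)
    then show ?thesis using zero[OF that] by (simp add: lin_diff lin_sum lin_single)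
  qed
  have "c = 0"
  proof (rule ccontr)
    assume "c \<noteq> 0"
    then have ne: "keys c \<noteq> {}" by simp
    define m where "m = Max (length ` keys c)"
    have "m \<in> length ` keys c" unfolding m_def using ne by (intro Max_in) auto
    then obtain gs where gs: "gs \<in> keys c" "length gs = m" by auto
    have le: "length ws \<le> length gs" if "ws \<in> keys c" for ws
      using that gs(2) by (auto simp: m_def)
    have X: "snd ` snd ` set ws \<subseteq> X" if "ws \<in> keys c" for ws
      using in_edges[OF that] by (force simp: edges_def)
    have "Phi gs (map Em ws) = 0" if "ws \<in> keys c" "ws \<noteq> gs" for ws
      using Phi_edges[OF X[OF gs(1)] X[OF that(1)] le[OF that(1)]] sorted_perm_unique[OF r, of gs ws] that c(1) gs(1)
      by auto
    then have "(\<Sum>ws\<in>keys c. lookup c ws * Phi gs (map Em ws)) = lookup c gs * Phi gs (map Em gs)"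
      using gs(1) by (subst sum.remove[OF _ gs(1)]) (auto intro!: sum.neutral)
    with sum0[OF in_edges[OF gs(1)]] Phi_edges[OF X[OF gs(1)] X[OF gs(1)]] gs(1)
    show False by (auto simp: in_keys_iff)
  qed
  then show ?thesis using c(2) by simp
qed

text \<open>Thus the enveloping algebra at every level injects into the single algebra
  \<open>env\<close>. From here on different levels are compared as nested subsets of
  \<open>env\<close>, and the canonical map between them is an inclusion.\<close>

lemma Uideal_eq: "Uideal N = Jker \<inter> (Fc N :: 'w matr falg set)"
proof
  show "Uideal N \<subseteq> Jker \<inter> (Fc N :: 'w matr falg set)" using Uideal_subset_Jker Uideal_Fc by blast
  show "Jker \<inter> (Fc N :: 'w matr falg set) \<subseteq> Uideal N"
    by (rule subsetI, rule Uideal_if_Phi_zero) (simp_all add: Jker_def good_Phi)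
qed

section \<open>The enveloping algebras as subalgebras of \<open>env\<close>\<close>

definition Ualg :: "nat \<Rightarrow> 'w env set" where
  "Ualg N = clsE ` Fc N"

text \<open>The elements of \<open>Ugl N\<close> are the fibres of the map from the free algebra on \<open>gl N\<close> to \<open>env\<close>.\<close>

definition fib :: "nat \<Rightarrow> 'w env \<Rightarrow> 'w matr falg set" where
  "fib N u = {q \<in> Fc N. clsE q = u}"

lemma cls_eq_fib:
  assumes p: "p \<in> Fc N"
  shows "cls N p = fib N (clsE p)"
proof (intro equalityI subsetI)
  fix q
  {
    assume "q \<in> cls N p"
    then obtain h where "h \<in> Uideal N" "q = h + p" by (auto simp: cls_def a_r_coset_def r_coset_def)
    moreover from this have "h \<in> Fc N" "clsE h = 0" by (auto simp: Uideal_eq clsE_eq_0_iff)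
    ultimately show "q \<in> fib N (clsE p)" using p by (simp add: fib_def clsE_add Fc_add)
  next
    assume "q \<in> fib N (clsE p)"
    then have "q - p \<in> Uideal N" using p by (auto simp: Uideal_eq fib_def clsE_eq_iff Fc_diff)
    then show "q \<in> cls N p" by (force simp: cls_def a_r_coset_def r_coset_def)
  }
qed

lemma fib_inj: "u \<in> Ualg N \<Longrightarrow> fib N u = fib N v \<longleftrightarrow> u = v"
  by (auto simp: Ualg_def fib_def)

lemma carrier_Ugl: "carrier (Ugl N) = fib N ` Ualg N"
proof -
  have "carrier (Ugl N) = cls N ` Fc N"
    by (auto simp: uea_def Let_def FactRing_def A_RCOSETS_def RCOSETS_def cls_def a_r_coset_def)
  then show ?thesis by (auto simp: Ualg_def cls_eq_fib image_image intro!: image_cong)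
qed

lemma Ualg_0: "0 \<in> Ualg N" and Ualg_1: "1 \<in> Ualg N" and Ualg_scal: "scal c \<in> Ualg N"
  and Ualg_add: "u \<in> Ualg N \<Longrightarrow> v \<in> Ualg N \<Longrightarrow> u + v \<in> Ualg N"
  and Ualg_mult: "u \<in> Ualg N \<Longrightarrow> v \<in> Ualg N \<Longrightarrow> u * v \<in> Ualg N"
proof -
  show "0 \<in> Ualg N" "1 \<in> Ualg N" "scal c \<in> Ualg N"
    unfolding Ualg_def using imageI[OF Fc_0, of clsE N] imageI[OF Fc_1, of clsE N] imageI[OF Fc_cst[of c N], of clsE]
    by (simp_all add: clsE_cst)
  show "u + v \<in> Ualg N" "u * v \<in> Ualg N" if uv: "u \<in> Ualg N" "v \<in> Ualg N" for u v
  proof -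
    obtain p q where "p \<in> Fc N" "q \<in> Fc N" "u = clsE p" "v = clsE q" using uv by (auto simp: Ualg_def)
    then show "u + v \<in> Ualg N" "u * v \<in> Ualg N"
      unfolding Ualg_def by (auto simp flip: clsE_add clsE_mult intro!: imageI Fc_add Fc_mult)
  qed
qed

lemma Ualg_scale: "u \<in> Ualg N \<Longrightarrow> scal c * u \<in> Ualg N"
  by (simp add: Ualg_mult Ualg_scal)

lemma Ualg_uminus: "u \<in> Ualg N \<Longrightarrow> - u \<in> Ualg N"
  using Ualg_scale[of u N "-1"] by (simp add: env.scale_minus_left[of 1, simplified])

lemma Ualg_diff: "u \<in> Ualg N \<Longrightarrow> v \<in> Ualg N \<Longrightarrow> u - v \<in> Ualg N"
  using Ualg_add[of u N "- v"] Ualg_uminus[of v N] by simp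

lemma Ualg_mono: "N \<le> M \<Longrightarrow> Ualg N \<subseteq> Ualg M"
  unfolding Ualg_def by (intro image_mono Fc_mono)

lemma Ualg_induct [consumes 1, case_names word add]:
  assumes "u \<in> Ualg N" "\<And>c ws. set ws \<subseteq> gl N \<Longrightarrow> P (scal c * gEs ws)" "\<And>u v. P u \<Longrightarrow> P v \<Longrightarrow> P (u + v)"
  shows "P u"
proof -
  obtain p where p: "p \<in> Fc N" "u = clsE p" using assms(1) by (auto simp: Ualg_def)
  have "P (clsE (\<Sum>k\<in>S. single k (lookup p k)))"
    if "finite S" "S \<subseteq> keys p" for S
    using that
  proof (induction S rule: finite_induct)
    case empty
    then show ?case using assms(2)[of "[]" 0] by simp
  next
    case (insert k S)
    obtain ws where ws: "k = Word ws" by (cases k)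
    then have "set ws \<subseteq> gl N" using Fc_letters[OF p(1), of ws] insert.prems by auto
    then show ?case using insert by (simp add: clsE_add assms ws clsE_single)
  qed
  from this[OF finite_keys order_refl] show ?thesis by (simp add: poly_mapping_sum_single p)
qed

lemma cls_mult: "p \<in> Fc N \<Longrightarrow> q \<in> Fc N \<Longrightarrow> cls N p \<otimes>\<^bsub>Ugl N\<^esub> cls N q = cls N (p * q)"
  and cls_add: "p \<in> Fc N \<Longrightarrow> q \<in> Fc N \<Longrightarrow> cls N p \<oplus>\<^bsub>Ugl N\<^esub> cls N q = cls N (p + q)"
proof -
  have hom: "cls N \<in> ring_hom (Ufree N) (Ufree N Quot Uideal N)"
    using ideal.rcos_ring_hom[OF ideal_Uideal, of N] unfolding cls_def[abs_def] by simp
  show "p \<in> Fc N \<Longrightarrow> q \<in> Fc N \<Longrightarrow> cls N p \<otimes>\<^bsub>Ugl N\<^esub> cls N q = cls N (p * q)"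
    using ring_hom_mult[OF hom, of p q] by (simp add: uea_def Let_def)
  show "p \<in> Fc N \<Longrightarrow> q \<in> Fc N \<Longrightarrow> cls N p \<oplus>\<^bsub>Ugl N\<^esub> cls N q = cls N (p + q)"
    using ring_hom_add[OF hom, of p q] by (simp add: uea_def Let_def)
qed

lemma fib_ops:
  assumes "u \<in> Ualg N" "v \<in> Ualg N"
  shows "fib N u \<otimes>\<^bsub>Ugl N\<^esub> fib N v = fib N (u * v)"
    and "fib N u \<oplus>\<^bsub>Ugl N\<^esub> fib N v = fib N (u + v)"
proof -
  obtain p q where pq: "p \<in> Fc N" "q \<in> Fc N" and uv: "u = clsE p" "v = clsE q"
    using assms by (auto simp: Ualg_def)
  show "fib N u \<otimes>\<^bsub>Ugl N\<^esub> fib N v = fib N (u * v)" "fib N u \<oplus>\<^bsub>Ugl N\<^esub> fib N v = fib N (u + v)"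
    using cls_mult[OF pq] cls_add[OF pq] pq
    by (simp_all add: uv cls_eq_fib Fc_mult Fc_add clsE_mult clsE_add)
qed

lemma fib_scale:
  assumes "u \<in> Ualg N"
  shows "c \<odot>\<^bsub>Ugl N\<^esub> fib N u = fib N (scal c * u)"
proof -
  obtain p where p: "p \<in> Fc N" and u: "u = clsE p" using assms by (auto simp: Ualg_def)
  have "c \<odot>\<^bsub>Ugl N\<^esub> cls N p = cls N (cst c) \<otimes>\<^bsub>Ugl N\<^esub> cls N p"
    by (simp add: uea_def Let_def cls_def)
  then show ?thesis
    using cls_mult[OF Fc_cst p] p by (simp add: u cls_eq_fib Fc_mult Fc_cst clsE_mult clsE_cst)
qed

lemma fib_0: "\<zero>\<^bsub>Ugl N\<^esub> = fib N 0" and fib_1: "\<one>\<^bsub>Ugl N\<^esub> = fib N 1"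
proof -
  have "\<one>\<^bsub>Ugl N\<^esub> = (cls N 1 :: 'w matr falg set)" by (simp add: uea_def Let_def FactRing_def cls_def)
  then show "\<one>\<^bsub>Ugl N\<^esub> = fib N 1" by (simp add: cls_eq_fib Fc_1)
  have "\<zero>\<^bsub>Ugl N\<^esub> = (Uideal N :: 'w matr falg set)" by (simp add: uea_def Let_def FactRing_def)
  also have "\<dots> = fib N 0" by (auto simp: Uideal_eq fib_def clsE_eq_0_iff)
  finally show "\<zero>\<^bsub>Ugl N\<^esub> = fib N 0" .
qed

lemma induced_fib:
  assumes "u \<in> Ualg M" and "\<And>p. p \<in> Fc M \<Longrightarrow> h p \<in> Fc N \<and> clsE (h p) = H (clsE p)"
  shows "induced N h (fib M u) = fib N (H u)"
proof -
  have "fib M u \<noteq> {}" using assms(1) by (auto simp: Ualg_def fib_def)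
  moreover have "cls N (h p) = fib N (H u)" if "p \<in> fib M u" for p
    using that assms(2)[of p] by (auto simp: fib_def cls_eq_fib)
  ultimately show ?thesis by (simp add: induced_def)
qed

lemma emb_fib: "u \<in> Ualg (N - 1) \<Longrightarrow> emb N (fib (N - 1) u) = fib N u"
  unfolding emb_def using Fc_mono[of "N - 1" N] by (intro induced_fib[where H="\<lambda>u. u"]) auto

lemma Fc_word_derivation:
  assumes "\<And>x. x \<in> gl N \<Longrightarrow> D x \<in> gl N" "p \<in> Fc N"
  shows "word_derivation D p \<in> Fc N"
  unfolding word_derivation_def
proof (intro Fc_sum Fc_single)
    fix w k assume wk: "w \<in> keys p" "k \<in> {..<length (letters w)}"
    then have s: "set (letters w) \<subseteq> gl N" using assms(2) by (simp add: Fc_iff)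
    moreover have "letters w ! k \<in> set (letters w)" using wk by simp
    ultimately have "D (letters w ! k) \<in> gl N" using assms(1) by blast
    then show "set ((letters w)[k := D (letters w ! k)]) \<subseteq> gl N"
      using set_update_subset_insert[of "letters w" k "D (letters w ! k)"] s by blast
qed

lemma act_fib: "A \<in> gl N \<Longrightarrow> u \<in> Ualg N \<Longrightarrow> act N A (fib N u) = fib N (adE A u)"
  unfolding act_def by (rule induced_fib) (auto simp: adE_clsE gl_ad_closed intro: Fc_word_derivation)

end

section \<open>The generators and their recursion\<close>

definition EE :: "nat \<Rightarrow> nat \<Rightarrow> 'w::nonunital_complex_algebra \<Rightarrow> 'w env" where
  "EE i j x = gE (Emat i j x)"

lemma EE_add: "EE i j (x + y) = EE i j x + EE i j y"
  by (simp add: EE_def Emat_add gE_add)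

lemma EE_scale: "EE i j (scaleC c x) = scal c * EE i j x"
  by (simp add: EE_def gE_scale flip: mat_scale_Emat)

lemma EE_bracket:
  "EE i j x * EE k l y - EE k l y * EE i j x =
     (if k = j then EE i l (x * y) else 0) - (if i = l then EE k j (y * x) else 0)"
  by (simp add: EE_def gE_bracket gl_bracket_Emat gE_diff)

text \<open>\<open>TT c N\<close> is \<open>t\<^sub>i\<^sub>j(x;N;s)\<close> with \<open>c = -N-s\<close>; the value at the empty word is Kronecker's delta.\<close>

fun TT :: "complex \<Rightarrow> nat \<Rightarrow> nat \<Rightarrow> nat \<Rightarrow> 'w::nonunital_complex_algebra list \<Rightarrow> 'w env" where
  "TT c N i j [] = (if i = j then 1 else 0)"
| "TT c N i j [x] = EE i j x"
| "TT c N i j (x # y # w) = (\<Sum>a=1..N. EE i a x * TT c N a j (y # w)) + scal c * TT c N i j ((x * y) # w)"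

lemma scal_pull:
  "EE i j x * (scal c * v) = scal c * (EE i j x * v)"
  "TT b N i j xs * (scal c * v) = scal c * (TT b N i j xs * v)"
  by (rule scal_left_commute)+

text \<open>Kronecker's delta at the empty word makes the recursion uniform: for
  \<open>w = []\<close> the sum picks out \<open>a = j\<close>, whence the condition on
  \<open>j\<close>.\<close>

lemma TT_0_Cons:
  "j \<in> {1..N} \<Longrightarrow> TT 0 N i j (x # w) = (\<Sum>a=1..N. EE i a x * TT 0 N a j w)"
  by (cases w) (simp_all add: if_distrib[of "\<lambda>z. _ * z"] cong: if_cong)

text \<open>The shape of the recursions for \<open>TT\<close>: the last letter is either dropped or
  multiplied into its neighbour, and both words are shorter.\<close>

lemma snoc_induct [consumes 1, case_names single snoc]:
  fixes w :: "'w::times list"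
  assumes "w \<noteq> []" "\<And>x. P [x]" "\<And>us x y. P (us @ [x]) \<Longrightarrow> P (us @ [x * y]) \<Longrightarrow> P (us @ [x, y])"
  shows "P w"
  using assms(1)
proof (induction "length w" arbitrary: w rule: less_induct)
  case less
  then obtain v y where w: "w = v @ [y]" by (cases w rule: rev_cases) auto
  show ?case
  proof (cases v rule: rev_cases)
    case Nil
    then show ?thesis by (simp add: w assms(2))
  next
    case (snoc us x)
    then have "P (us @ [x])" "P (us @ [x * y])" using less by (auto simp: w)
    then show ?thesis using assms(3)[of us x y] by (simp add: w snoc)
  qed
qed

lemma cons_induct [consumes 1, case_names single cons]:
  fixes w :: "'w::times list"
  assumes "w \<noteq> []" "\<And>x. P [x]" "\<And>x y w. P (y # w) \<Longrightarrow> P ((x * y) # w) \<Longrightarrow> P (x # y # w)"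
  shows "P w"
  using assms(1)
proof (induction "length w" arbitrary: w rule: less_induct)
  case less
  then obtain x v where w: "w = x # v" by (cases w) auto
  show ?case
  proof (cases v)
    case Nil
    then show ?thesis by (simp add: w assms(2))
  next
    case (Cons y u)
    then have "P (y # u)" "P ((x * y) # u)" using less by (auto simp: w)
    then show ?thesis using assms(3)[of y u x] by (simp add: w Cons)
  qed
qed

text \<open>The sum over compositions behind \<open>TT\<close> can be read from either end. The left
  ideal is generated by the last column, which calls for a recursion at the last letter beside the
  defining one.\<close>

lemma TT_snoc:
  "TT c N i j (us @ [x, y]) = (\<Sum>a=1..N. TT c N i a (us @ [x]) * EE a j y) + scal c * TT c N i j (us @ [x * y])"
proof (induction "length us" arbitrary: us x i)
  case 0
  then show ?case by simp
next
  case (Suc n)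
  then obtain z us' where us: "us = z # us'" and n: "n = length us'" by (cases us) auto
  have IH: "TT c N b j (us' @ [x, y]) = (\<Sum>a=1..N. TT c N b a (us' @ [x]) * EE a j y) + scal c * TT c N b j (us' @ [x * y])" for b
    using Suc(1)[OF n] by simp
  \<comment> \<open>The first letter is contracted with its right neighbour, which is
    \<open>u\<close> itself when \<open>v\<close> is empty.\<close>
  have step: "TT c N i l (z # v @ [u]) = (\<Sum>b=1..N. EE i b z * TT c N b l (v @ [u])) +
      scal c * TT c N i l (case v of [] \<Rightarrow> [z * u] | h # v' \<Rightarrow> (z * h) # v' @ [u])" for v u l
    by (cases v) simp_all
  have s1: "TT c N i j (us @ [x, y]) = (\<Sum>b=1..N. EE i b z * TT c N b j (us' @ [x, y])) +
      scal c * TT c N i j (case us' of [] \<Rightarrow> [z * x, y] | h # v' \<Rightarrow> (z * h) # v' @ [x, y])"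
    by (cases us') (simp_all add: us)
  have s2: "TT c N i j (case us' of [] \<Rightarrow> [z * x, y] | h # v' \<Rightarrow> (z * h) # v' @ [x, y]) =
     (\<Sum>a=1..N. TT c N i a (case us' of [] \<Rightarrow> [z * x] | h # v' \<Rightarrow> (z * h) # v' @ [x]) * EE a j y) +
     scal c * TT c N i j (case us' of [] \<Rightarrow> [z * (x * y)] | h # v' \<Rightarrow> (z * h) # v' @ [x * y])"
  proof (cases us')
    case Nil
    then show ?thesis by (simp add: mult.assoc)
  next
    case (Cons h v')
    then show ?thesis using Suc(1)[of "(z * h) # v'" i x] n by simp
  qed
  have "TT c N i j (us @ [x, y]) =
      (\<Sum>b=1..N. EE i b z * ((\<Sum>a=1..N. TT c N b a (us' @ [x]) * EE a j y) + scal c * TT c N b j (us' @ [x * y]))) +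
      scal c * ((\<Sum>a=1..N. TT c N i a (case us' of [] \<Rightarrow> [z * x] | h # v' \<Rightarrow> (z * h) # v' @ [x]) * EE a j y) +
     scal c * TT c N i j (case us' of [] \<Rightarrow> [z * (x * y)] | h # v' \<Rightarrow> (z * h) # v' @ [x * y]))"
    unfolding s1 IH s2 ..
  also have "\<dots> = (\<Sum>b=1..N. \<Sum>a=1..N. EE i b z * TT c N b a (us' @ [x]) * EE a j y) +
      (\<Sum>a=1..N. scal c * TT c N i a (case us' of [] \<Rightarrow> [z * x] | h # v' \<Rightarrow> (z * h) # v' @ [x]) * EE a j y) +
      scal c * ((\<Sum>b=1..N. EE i b z * TT c N b j (us' @ [x * y])) +
     scal c * TT c N i j (case us' of [] \<Rightarrow> [z * (x * y)] | h # v' \<Rightarrow> (z * h) # v' @ [x * y]))"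
    by (simp add: distrib_left sum.distrib sum_distrib_left scal_pull mult.assoc add_ac)
  also have "(\<Sum>b=1..N. \<Sum>a=1..N. EE i b z * TT c N b a (us' @ [x]) * EE a j y) =
      (\<Sum>a=1..N. \<Sum>b=1..N. EE i b z * TT c N b a (us' @ [x]) * EE a j y)" by (rule sum.swap)
  finally show ?case
    by (simp add: us step distrib_right sum.distrib sum_distrib_right)
qed

subsection \<open>Degree filtration\<close>

definition Ffil :: "nat \<Rightarrow> nat \<Rightarrow> 'w::nonunital_complex_algebra env set" where
  "Ffil N k = clsE ` {p \<in> Fc N. \<forall>w\<in>keys p. length (letters w) \<le> k}"

lemma Ffil_add: "u \<in> Ffil N k \<Longrightarrow> v \<in> Ffil N k \<Longrightarrow> u + v \<in> Ffil N k"
proof -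
  assume "u \<in> Ffil N k" "v \<in> Ffil N k"
  then obtain p q where pq: "p \<in> Fc N" "q \<in> Fc N" "u = clsE p" "v = clsE q"
    "\<forall>w\<in>keys p. length (letters w) \<le> k" "\<forall>w\<in>keys q. length (letters w) \<le> k"
    by (auto simp: Ffil_def)
  then have "u + v = clsE (p + q)" "p + q \<in> Fc N" "\<forall>w\<in>keys (p + q). length (letters w) \<le> k"
    using Poly_Mapping.keys_add[of p q] by (auto simp: clsE_add Fc_add)
  then show ?thesis by (auto simp: Ffil_def)
qed

lemma Ffil_mult: "u \<in> Ffil N k \<Longrightarrow> v \<in> Ffil N l \<Longrightarrow> u * v \<in> Ffil N (k + l)"
proof -
  assume "u \<in> Ffil N k" "v \<in> Ffil N l"
  then obtain p q where pq: "p \<in> Fc N" "q \<in> Fc N" "u = clsE p" "v = clsE q"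
    "\<forall>w\<in>keys p. length (letters w) \<le> k" "\<forall>w\<in>keys q. length (letters w) \<le> l"
    by (auto simp: Ffil_def)
  have "length (letters w) \<le> k + l" if "w \<in> keys (p * q)" for w
  proof -
    obtain a b where "w = a + b" "a \<in> keys p" "b \<in> keys q"
      using keys_mult[of p q] \<open>w \<in> _\<close> by blast
    then show ?thesis using pq(5,6) by (simp add: plus_fmon_def add_mono)
  qed
  then show ?thesis using pq Fc_mult[of p N q] by (auto simp: Ffil_def simp flip: clsE_mult)
qed

lemma Ffil_mono: "k \<le> l \<Longrightarrow> Ffil N k \<subseteq> Ffil N l"
  by (force simp: Ffil_def)

lemma keys_cst: "w \<in> keys (cst c) \<Longrightarrow> w = Word []"
  and keys_gen: "w \<in> keys (gen x) \<Longrightarrow> w = Word [x]"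
  by (auto simp: cst_def gen_def zero_fmon_def split: if_splits)

lemma Ffil_scal: "scal c \<in> Ffil N k"
  unfolding Ffil_def by (rule image_eqI[of _ _ "cst c"]) (auto simp: clsE_cst Fc_cst dest: keys_cst)

lemma Ffil_0: "0 \<in> Ffil N k" and Ffil_1: "1 \<in> Ffil N k"
  using Ffil_scal[of 0] Ffil_scal[of 1] by simp_all

lemma Ffil_scale: "u \<in> Ffil N k \<Longrightarrow> scal c * u \<in> Ffil N k"
  using Ffil_mult[OF Ffil_scal[of c N 0]] by force

lemma Ffil_sum: "(\<And>x. x \<in> S \<Longrightarrow> f x \<in> Ffil N k) \<Longrightarrow> sum f S \<in> Ffil N k"
  by (induction S rule: infinite_finite_induct) (auto intro: Ffil_0 Ffil_add)

lemma Ffil_gE: "A \<in> gl N \<Longrightarrow> gE A \<in> Ffil N 1"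
  unfolding Ffil_def by (rule image_eqI[of _ _ "gen A"]) (auto simp: clsE_gen Fc_gen dest: keys_gen)

lemma Ffil_EE: "i \<in> {1..N} \<Longrightarrow> j \<in> {1..N} \<Longrightarrow> EE i j x \<in> Ffil N 1"
  unfolding EE_def by (intro Ffil_gE gl_Emat)

lemma Ffil_EE_mult:
  "i \<in> {1..N} \<Longrightarrow> j \<in> {1..N} \<Longrightarrow> u \<in> Ffil N k \<Longrightarrow> EE i j x * u \<in> Ffil N (Suc k)"
  using Ffil_mult[OF Ffil_EE[of i N j x], of u k] by simp

lemma Ffil_TT: "i \<in> {1..N} \<Longrightarrow> j \<in> {1..N} \<Longrightarrow> TT c N i j xs \<in> Ffil N (length xs)"
proof (induction c N i j xs rule: TT.induct)
  case (3 c N i j x y w)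
  have "scal c * TT c N i j ((x * y) # w) \<in> Ffil N (Suc (Suc (length w)))"
    using 3 by (intro Ffil_scale subsetD[OF Ffil_mono[of "Suc (length w)" "Suc (Suc (length w))"]]) auto
  moreover have "(\<Sum>a=1..N. EE i a x * TT c N a j (y # w)) \<in> Ffil N (Suc (Suc (length w)))"
    using 3 by (intro Ffil_sum Ffil_EE_mult) auto
  ultimately show ?case by (simp add: Ffil_add)
next
  case (2 c N i j x)
  then show ?case using Ffil_EE[of i N j x] by simp
qed (simp_all add: Ffil_0 Ffil_1)

text \<open>Each contraction costs a letter, so the terms weighted by the parameter have smaller
  degree.\<close>

lemma TT_top_degree:
  "i \<in> {1..N} \<Longrightarrow> j \<in> {1..N} \<Longrightarrow> xs \<noteq> [] \<Longrightarrow> TT c N i j xs - TT 0 N i j xs \<in> Ffil N (length xs - 1)"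
proof (induction c N i j xs rule: TT.induct)
  case (3 c N i j x y w)
  have "(\<Sum>a=1..N. EE i a x * (TT c N a j (y # w) - TT 0 N a j (y # w))) \<in> Ffil N (Suc (length w))"
    using 3 by (intro Ffil_sum Ffil_EE_mult) auto
  moreover have "scal c * TT c N i j ((x * y) # w) \<in> Ffil N (Suc (length w))"
    using Ffil_scale[OF Ffil_TT[of i N j c "(x * y) # w"], of c] 3 by simp
  ultimately have "(\<Sum>a=1..N. EE i a x * (TT c N a j (y # w) - TT 0 N a j (y # w))) + scal c * TT c N i j ((x * y) # w) \<in> Ffil N (Suc (length w))"
    by (rule Ffil_add)
  then show ?case by (simp add: right_diff_distrib sum_subtractf algebra_simps)
qed (auto simp: Ffil_0)

lemma (in algebra_basis) Ffil_Ualg: "Ffil N k \<subseteq> Ualg N"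
  by (auto simp: Ffil_def Ualg_def)

lemma (in algebra_basis) TT_Ualg: "i \<in> {1..N} \<Longrightarrow> j \<in> {1..N} \<Longrightarrow> TT c N i j xs \<in> Ualg N"
  using Ffil_TT Ffil_Ualg by blast

lemma (in algebra_basis) EE_Ualg: "i \<in> {1..N} \<Longrightarrow> j \<in> {1..N} \<Longrightarrow> EE i j x \<in> Ualg N"
  using Ffil_EE Ffil_Ualg by blast

subsection \<open>Invariance\<close>

lemma adE_add_matrix: "adE (A + B) u = adE A u + adE B u"
proof (induction u rule: env_induct)
  case (word c ws)
  have "adE (A + B) (gEs ws) = adE A (gEs ws) + adE B (gEs ws)"
    by (induction ws) (simp_all add: adE_gE_mult gl_ad_add_left gE_add algebra_simps)
  then show ?case by (simp add: adE_scal distrib_left)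
qed (simp add: adE_add)

lemma adE_EE:
  "adE (Emat p q a) (EE i j x) = (if q = i then scal a * EE p j x else 0) - (if j = p then scal a * EE i q x else 0)"
proof -
  have "lact (Emat p q a) (Emat i j x) = (if q = i then Emat p j (scaleC a x) else 0)"
    by (rule mat_prod_Emat) auto
  moreover have "ract (Emat i j x) (Emat p q a) = (if j = p then Emat i q (scaleC a x) else 0)"
    by (rule mat_prod_Emat) auto
  ultimately show ?thesis
    by (simp add: EE_def adE_gE gl_ad_def gE_diff gE_scale flip: mat_scale_Emat)
qed

text \<open>These elements transform like matrix units: at a summation index the contributions of
  its two neighbouring factors cancel.\<close>

lemma adE_TT:
  assumes "p \<in> {1..N}" "q \<in> {1..N}" "xs \<noteq> []"
  shows "adE (Emat p q a) (TT c N i j xs) =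
     (if q = i then scal a * TT c N p j xs else 0) - (if j = p then scal a * TT c N i q xs else 0)"
  using assms
proof (induction c N i j xs rule: TT.induct)
  case (3 c N i j x y w)
  have sum_eq: "(\<Sum>b=1..N. if b = p then f b else 0) = f p" "(\<Sum>b=1..N. if q = b then f b else 0) = f q" for f :: "nat \<Rightarrow> 'a env"
    using 3 by auto
  have "adE (Emat p q a) (\<Sum>b=1..N. EE i b x * TT c N b j (y # w)) =
     (\<Sum>b=1..N. ((if q = i then scal a * EE p b x else 0) - (if b = p then scal a * EE i q x else 0)) * TT c N b j (y # w) +
       EE i b x * ((if q = b then scal a * TT c N p j (y # w) else 0) - (if j = p then scal a * TT c N b q (y # w) else 0)))"
    using 3 by (simp add: adE_sum adE_mult adE_EE)
  also have "\<dots> = (\<Sum>b=1..N. (if q = i then scal a * EE p b x * TT c N b j (y # w) else 0) -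
       (if b = p then scal a * EE i q x * TT c N b j (y # w) else 0) +
       ((if q = b then scal a * (EE i b x * TT c N p j (y # w)) else 0) - (if j = p then scal a * (EE i b x * TT c N b q (y # w)) else 0)))"
    by (intro sum.cong refl) (simp add: left_diff_distrib right_diff_distrib scal_pull)
  also have "\<dots> = (if q = i then scal a * (\<Sum>b=1..N. EE p b x * TT c N b j (y # w)) else 0) -
      (if j = p then scal a * (\<Sum>b=1..N. EE i b x * TT c N b q (y # w)) else 0)"
    unfolding sum.distrib sum_subtractf sum_eq by (simp add: sum_distrib_left mult.assoc)
  finally show ?case using 3
    by (simp add: adE_add adE_scal distrib_left right_diff_distrib mult.commute[of a c] flip: mult.assoc scal_mult)
qed (simp_all add: adE_EE)

lemma adE_TT_zero:
  assumes "A \<in> gl_sub d N" "i \<in> {1..d}" "j \<in> {1..d}" "xs \<noteq> []"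
  shows "adE A (TT c N i j xs) = 0"
proof -
  have "adE (\<Sum>k\<in>S. single k (lookup A k)) (TT c N i j xs) = 0"
    if "finite S" "S \<subseteq> {d+1..N} \<times> {d+1..N}" for S
    using that
  proof (induction S rule: finite_induct)
    case empty
    have "adE 0 (TT c N i j xs) = 0" using adE_add_matrix[of 0 0 "TT c N i j xs"] by simp
    then show ?case by simp
  next
    case (insert k S)
    obtain p q where k: "k = (p, q)" by (cases k)
    have "adE (single k (lookup A k)) (TT c N i j xs) = 0"
      using adE_TT[of p N q xs "lookup A k" c i j] insert.prems assms by (auto simp: k Emat_def)
    then show ?case using insert by (simp add: adE_add_matrix)
  qed
  moreover have "keys A \<subseteq> {d+1..N} \<times> {d+1..N}" using assms(1) by (simp add: gl_sub_def)
  ultimately show ?thesis by (metis poly_mapping_sum_single finite_keys)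
qed

section \<open>The ideals\<close>

context algebra_basis
begin

text \<open>Sums of multiples of the generators in place of the intersection \<open>I_plus\<close>,
  so that closure properties follow by induction.\<close>

inductive_set Iplus :: "nat \<Rightarrow> 'w env set" for N :: nat where
  Iplus_zero: "0 \<in> Iplus N"
| Iplus_gen: "u \<in> Ualg N \<Longrightarrow> i \<in> {1..N} \<Longrightarrow> u * EE i N x \<in> Iplus N"
| Iplus_add: "u \<in> Iplus N \<Longrightarrow> v \<in> Iplus N \<Longrightarrow> u + v \<in> Iplus N"

inductive_set Iminus :: "nat \<Rightarrow> 'w env set" for N :: nat where
  Iminus_zero: "0 \<in> Iminus N"
| Iminus_gen: "u \<in> Ualg N \<Longrightarrow> j \<in> {1..N} \<Longrightarrow> EE N j x * u \<in> Iminus N"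
| Iminus_add: "u \<in> Iminus N \<Longrightarrow> v \<in> Iminus N \<Longrightarrow> u + v \<in> Iminus N"

lemma Iplus_mult_left: "v \<in> Iplus N \<Longrightarrow> u \<in> Ualg N \<Longrightarrow> u * v \<in> Iplus N"
  by (induction rule: Iplus.induct) (auto simp: distrib_left mult.assoc[symmetric] intro: Iplus.intros Ualg_mult)

lemma Iminus_mult_right: "v \<in> Iminus N \<Longrightarrow> u \<in> Ualg N \<Longrightarrow> v * u \<in> Iminus N"
  by (induction rule: Iminus.induct) (auto simp: distrib_right mult.assoc intro: Iminus.intros Ualg_mult)

lemma Iplus_scale: "v \<in> Iplus N \<Longrightarrow> scal c * v \<in> Iplus N"
  by (intro Iplus_mult_left Ualg_scal)

lemma Iminus_scale: "v \<in> Iminus N \<Longrightarrow> scal c * v \<in> Iminus N"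
  by (simp add: scal_commute Iminus_mult_right Ualg_scal)

lemma Iplus_uminus: "v \<in> Iplus N \<Longrightarrow> - v \<in> Iplus N"
  using Iplus_scale[of v N "-1"] by (simp add: env.scale_minus_left[of 1, simplified])

lemma Iminus_uminus: "v \<in> Iminus N \<Longrightarrow> - v \<in> Iminus N"
  using Iminus_scale[of v N "-1"] by (simp add: env.scale_minus_left[of 1, simplified])

lemma Iplus_diff: "u \<in> Iplus N \<Longrightarrow> v \<in> Iplus N \<Longrightarrow> u - v \<in> Iplus N"
  using Iplus_add[of u N "- v"] Iplus_uminus[of v N] by simp

lemma Iminus_diff: "u \<in> Iminus N \<Longrightarrow> v \<in> Iminus N \<Longrightarrow> u - v \<in> Iminus N"
  using Iminus_add[of u N "- v"] Iminus_uminus[of v N] by simp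

lemma Iplus_sum: "(\<And>a. a \<in> S \<Longrightarrow> f a \<in> Iplus N) \<Longrightarrow> sum f S \<in> Iplus N"
  by (induction S rule: infinite_finite_induct) (auto intro: Iplus.intros)

lemma Iminus_sum: "(\<And>a. a \<in> S \<Longrightarrow> f a \<in> Iminus N) \<Longrightarrow> sum f S \<in> Iminus N"
  by (induction S rule: infinite_finite_induct) (auto intro: Iminus.intros)

lemma Iplus_EE: "i \<in> {1..N} \<Longrightarrow> EE i N x \<in> Iplus N"
  using Iplus_gen[OF Ualg_1] by simp

lemma Iminus_EE: "j \<in> {1..N} \<Longrightarrow> EE N j x \<in> Iminus N"
  using Iminus_gen[OF Ualg_1] by simp

lemma Iplus_Ualg: "u \<in> Iplus N \<Longrightarrow> u \<in> Ualg N"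
  by (induction rule: Iplus.induct) (auto intro!: Ualg_0 Ualg_mult Ualg_add EE_Ualg)

lemma Iminus_Ualg: "u \<in> Iminus N \<Longrightarrow> u \<in> Ualg N"
  by (induction rule: Iminus.induct) (auto intro!: Ualg_0 Ualg_mult Ualg_add EE_Ualg)

text \<open>Bracketing with an element of the smaller \<open>gl M\<close> keeps the last column
  inside the last column; hence the left ideal also absorbs right multiplication by the smaller
  algebra.\<close>

lemma Iplus_mult_EE:
  assumes "v \<in> Iplus (Suc M)" "k \<in> {1..M}" "l \<in> {1..M}"
  shows "v * EE k l y \<in> Iplus (Suc M)"
  using assms(1)
proof (induction rule: Iplus.induct)
  case (Iplus_gen u i x)
  have "EE i (Suc M) x * EE k l y = EE k l y * EE i (Suc M) x - (if i = l then EE k (Suc M) (y * x) else 0)"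
    using EE_bracket[of i "Suc M" x k l y] assms by (simp add: algebra_simps)
  then have "u * EE i (Suc M) x * EE k l y = u * EE k l y * EE i (Suc M) x - u * (if i = l then EE k (Suc M) (y * x) else 0)"
    by (simp add: mult.assoc right_diff_distrib)
  moreover have "u * EE k l y * EE i (Suc M) x \<in> Iplus (Suc M)"
    using Iplus_gen assms by (intro Iplus.Iplus_gen Ualg_mult EE_Ualg) auto
  moreover have "u * (if i = l then EE k (Suc M) (y * x) else 0) \<in> Iplus (Suc M)"
    using Iplus_gen assms by (auto intro: Iplus.intros)
  ultimately show ?case by (simp add: Iplus_diff)
qed (auto simp: distrib_right intro: Iplus.intros)

lemma Iminus_mult_EE:
  assumes "v \<in> Iminus (Suc M)" "k \<in> {1..M}" "l \<in> {1..M}"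
  shows "EE k l y * v \<in> Iminus (Suc M)"
  using assms(1)
proof (induction rule: Iminus.induct)
  case (Iminus_gen u j x)
  have "EE k l y * EE (Suc M) j x = EE (Suc M) j x * EE k l y - (if k = j then EE (Suc M) l (x * y) else 0)"
    using EE_bracket[of k l y "Suc M" j x] assms by (simp add: algebra_simps)
  then have "EE k l y * (EE (Suc M) j x * u) = EE (Suc M) j x * (EE k l y * u) - (if k = j then EE (Suc M) l (x * y) else 0) * u"
    by (simp add: left_diff_distrib flip: mult.assoc)
  moreover have "EE (Suc M) j x * (EE k l y * u) \<in> Iminus (Suc M)"
    using Iminus_gen assms by (intro Iminus.Iminus_gen Ualg_mult EE_Ualg) auto
  moreover have "(if k = j then EE (Suc M) l (x * y) else 0) * u \<in> Iminus (Suc M)"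
    using Iminus_gen assms by (auto intro: Iminus.intros)
  ultimately show ?case by (simp add: Iminus_diff)
qed (auto simp: distrib_left intro: Iminus.intros)

lemma Iplus_mult_gE: "A \<in> gl M \<Longrightarrow> v \<in> Iplus (Suc M) \<Longrightarrow> v * gE A \<in> Iplus (Suc M)"
  by (induction arbitrary: v rule: gl_eq_span_Emat_induct)
    (auto simp: gE_add distrib_left simp flip: EE_def intro: Iplus.intros Iplus_mult_EE)

lemma Iminus_mult_gE: "A \<in> gl M \<Longrightarrow> v \<in> Iminus (Suc M) \<Longrightarrow> gE A * v \<in> Iminus (Suc M)"
  by (induction arbitrary: v rule: gl_eq_span_Emat_induct)
    (auto simp: gE_add distrib_right simp flip: EE_def intro: Iminus.intros Iminus_mult_EE)

lemma Iplus_mult_right: "u \<in> Ualg M \<Longrightarrow> v \<in> Iplus (Suc M) \<Longrightarrow> v * u \<in> Iplus (Suc M)"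
proof (induction rule: Ualg_induct)
  case (word c ws)
  have "v * gEs ws \<in> Iplus (Suc M)" if "set ws \<subseteq> gl M" "v \<in> Iplus (Suc M)" for v
    using that by (induction ws arbitrary: v) (auto simp: Iplus_mult_gE simp flip: mult.assoc)
  then show ?case using word by (simp add: scal_left_commute[of v] Iplus_scale)
qed (auto simp: distrib_left intro: Iplus.intros)

lemma Iminus_mult_left: "u \<in> Ualg M \<Longrightarrow> v \<in> Iminus (Suc M) \<Longrightarrow> u * v \<in> Iminus (Suc M)"
proof (induction rule: Ualg_induct)
  case (word c ws)
  have "gEs ws * v \<in> Iminus (Suc M)" if "set ws \<subseteq> gl M" "v \<in> Iminus (Suc M)" for v
    using that by (induction ws arbitrary: v) (auto simp: Iminus_mult_gE mult.assoc)
  then show ?case using word by (simp add: mult.assoc Iminus_scale)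
qed (auto simp: distrib_right intro: Iminus.intros)

lemma sum_Suc_interval: "(\<Sum>a=1..Suc M. f a) = (\<Sum>a=1..M. f a) + f (Suc M)" for f :: "nat \<Rightarrow> 'b::comm_monoid_add"
  by simp

section \<open>The generators modulo the two ideals\<close>

lemma TT_last_column: "w \<noteq> [] \<Longrightarrow> i \<in> {1..N} \<Longrightarrow> TT c N i N w \<in> Iplus N"
proof (induction w rule: snoc_induct)
  case (snoc us x y)
  then show ?case unfolding TT_snoc by (intro Iplus_add Iplus_sum Iplus_gen Iplus_scale TT_Ualg) auto
qed (simp add: Iplus_EE)

lemma TT_last_row: "w \<noteq> [] \<Longrightarrow> j \<in> {1..N} \<Longrightarrow> TT c N N j w \<in> Iminus N"
proof (induction w rule: cons_induct)
  case (cons x y w)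
  then show ?case by (auto intro!: Iminus_add Iminus_sum Iminus_gen Iminus_scale TT_Ualg)
qed (simp add: Iminus_EE)

text \<open>Only the last letter of \<open>w\<close> interacts with \<open>EE N j y\<close> modulo
  the left ideal: it absorbs \<open>y\<close>, and the other summand of the bracket is an
  \<open>EE N N\<close>, which lies in the ideal.\<close>

lemma TT_last_column_commutator:
  assumes "w \<noteq> []" "i \<in> {1..N}" "j \<in> {1..N}" "j \<noteq> N"
  shows "TT c N i N w * EE N j y - EE N j y * TT c N i N w - TT c N i j (butlast w @ [last w * y]) \<in> Iplus N"
  using assms(1)
proof (induction w rule: snoc_induct)
  case (single x)
  have "EE i N x * EE N j y - EE N j y * EE i N x - EE i j (x * y) = - (if i = j then EE N N (y * x) else 0)"
    using EE_bracket[of i N x N j y] by simp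
  moreover have "(if i = j then EE N N (y * x) else 0) \<in> Iplus N"
    using assms by (auto intro: Iplus_zero Iplus_EE)
  ultimately show ?case by (simp add: Iplus_uminus)
next
  case (snoc us x z)
  let ?T = "\<lambda>a. TT c N i a (us @ [x])" and ?F = "EE N j y"
  let ?U = "TT c N i N (us @ [x * z])"
  have a: "?T a * EE a N z * ?F - ?F * (?T a * EE a N z) - ?T a * EE a j (z * y) \<in> Iplus N" if "a \<in> {1..N}" for a
  \<comment> \<open>The commutator of \<open>?T a\<close> with \<open>?F\<close> need not be
    evaluated, because \<open>EE a N z\<close> follows it on the right.\<close>
  proof -
    have "EE a N z * ?F = ?F * EE a N z + (EE a j (z * y) - (if a = j then EE N N (y * z) else 0))"
      using EE_bracket[of a N z N j y] by (simp add: algebra_simps)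
    then have "?T a * (EE a N z * ?F) = ?T a * (?F * EE a N z) + (?T a * EE a j (z * y) - ?T a * (if a = j then EE N N (y * z) else 0))"
      by (simp only: distrib_left right_diff_distrib)
    then have "?T a * EE a N z * ?F - ?F * (?T a * EE a N z) - ?T a * EE a j (z * y) =
       (?T a * ?F - ?F * ?T a) * EE a N z - ?T a * (if a = j then EE N N (y * z) else 0)"
      by (simp add: left_diff_distrib mult.assoc)
    moreover have "(?T a * ?F - ?F * ?T a) * EE a N z \<in> Iplus N"
      using that assms by (intro Iplus_gen Ualg_diff Ualg_mult TT_Ualg EE_Ualg) auto
    moreover have "?T a * (if a = j then EE N N (y * z) else 0) \<in> Iplus N"
      using that assms by (auto intro!: Iplus_gen Iplus_zero TT_Ualg)
    ultimately show ?thesis by (simp add: Iplus_diff)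
  qed
  have "(\<Sum>a=1..N. ?T a * EE a N z * ?F - ?F * (?T a * EE a N z) - ?T a * EE a j (z * y)) +
     scal c * (?U * ?F - ?F * ?U - TT c N i j (us @ [x * z * y])) \<in> Iplus N"
    using snoc(2) a by (intro Iplus_add Iplus_sum Iplus_scale) auto
  then show ?case
    using TT_snoc[of c N i j us x "z * y"] TT_snoc[of c N i N us x z]
    by (simp add: butlast_append distrib_left distrib_right sum_distrib_left sum_distrib_right sum_subtractf sum.distrib
       right_diff_distrib scal_pull mult.assoc algebra_simps)
qed

lemma TT_last_row_commutator:
  assumes "w \<noteq> []" "i \<in> {1..N}" "j \<in> {1..N}" "i \<noteq> N"
  shows "EE i N y * TT c N N j w - TT c N N j w * EE i N y - TT c N i j ((y * hd w) # tl w) \<in> Iminus N"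
  using assms(1)
proof (induction w rule: cons_induct)
  case (single x)
  have "EE i N y * EE N j x - EE N j x * EE i N y - EE i j (y * x) = - (if i = j then EE N N (x * y) else 0)"
    using EE_bracket[of i N y N j x] by simp
  moreover have "(if i = j then EE N N (x * y) else 0) \<in> Iminus N"
    using assms by (auto intro: Iminus_zero Iminus_EE)
  ultimately show ?case by (simp add: Iminus_uminus)
next
  case (cons x z w)
  let ?T = "\<lambda>a. TT c N a j (z # w)" and ?G = "EE i N y"
  let ?U = "TT c N N j ((x * z) # w)"
  have a: "?G * (EE N a x * ?T a) - EE N a x * ?T a * ?G - EE i a (y * x) * ?T a \<in> Iminus N" if "a \<in> {1..N}" for a
  proof -
    have "?G * EE N a x = EE N a x * ?G + (EE i a (y * x) - (if i = a then EE N N (x * y) else 0))"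
      using EE_bracket[of i N y N a x] by (simp add: algebra_simps)
    then have "?G * EE N a x * ?T a = EE N a x * ?G * ?T a + (EE i a (y * x) * ?T a - (if i = a then EE N N (x * y) else 0) * ?T a)"
      by (simp only: distrib_right left_diff_distrib)
    then have "?G * (EE N a x * ?T a) - EE N a x * ?T a * ?G - EE i a (y * x) * ?T a =
       EE N a x * (?G * ?T a - ?T a * ?G) - (if i = a then EE N N (x * y) else 0) * ?T a"
      by (simp add: right_diff_distrib mult.assoc)
    moreover have "EE N a x * (?G * ?T a - ?T a * ?G) \<in> Iminus N"
      using that assms by (intro Iminus_gen Ualg_diff Ualg_mult TT_Ualg EE_Ualg) auto
    moreover have "(if i = a then EE N N (x * y) else 0) * ?T a \<in> Iminus N"
      using that assms by (auto intro!: Iminus_gen Iminus_zero TT_Ualg)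
    ultimately show ?thesis by (simp add: Iminus_diff)
  qed
  have "(\<Sum>a=1..N. ?G * (EE N a x * ?T a) - EE N a x * ?T a * ?G - EE i a (y * x) * ?T a) +
     scal c * (?G * ?U - ?U * ?G - TT c N i j ((y * (x * z)) # w)) \<in> Iminus N"
    using cons(2) a by (intro Iminus_add Iminus_sum Iminus_scale) auto
  then show ?case
    by (simp add: distrib_left distrib_right sum_distrib_left sum_distrib_right sum_subtractf sum.distrib
       right_diff_distrib scal_pull mult.assoc algebra_simps)
qed

text \<open>In the recursion at the last letter, level \<open>Suc M\<close> has the additional
  summand through the vertex \<open>Suc M\<close>. Moving its right factor to the left puts it into
  the ideal, and the commutator leaves one copy of the contracted word, which turns \<open>c\<close>
  into \<open>c + 1\<close>.\<close>

lemma TT_stable_plus: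
  assumes "w \<noteq> []" "i \<in> {1..M}" "j \<in> {1..M}"
  shows "TT c (Suc M) i j w - TT (c + 1) M i j w \<in> Iplus (Suc M)"
  using assms(1,3)
proof (induction w arbitrary: j rule: snoc_induct)
  case (single x)
  then show ?case by (simp add: Iplus_zero)
next
  case (snoc us x y)
  let ?T = "\<lambda>a. TT c (Suc M) i a (us @ [x])" and ?T' = "\<lambda>a. TT (c + 1) M i a (us @ [x])"
  let ?U = "TT c (Suc M) i j (us @ [x * y])" and ?U' = "TT (c + 1) M i j (us @ [x * y])"
  let ?F = "EE (Suc M) j y"
  have "(\<Sum>a=1..M. (?T a - ?T' a) * EE a j y) + ?F * ?T (Suc M) + (?T (Suc M) * ?F - ?F * ?T (Suc M) - ?U) +
     scal (c + 1) * (?U - ?U') \<in> Iplus (Suc M)"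
    using snoc assms(2) TT_last_column_commutator[of "us @ [x]" i "Suc M" j c y]
    by (intro Iplus_add Iplus_sum Iplus_scale Iplus_mult_EE Iplus_mult_left TT_last_column EE_Ualg) auto
  also have "(\<Sum>a=1..M. (?T a - ?T' a) * EE a j y) + ?F * ?T (Suc M) + (?T (Suc M) * ?F - ?F * ?T (Suc M) - ?U) +
     scal (c + 1) * (?U - ?U') = TT c (Suc M) i j (us @ [x, y]) - TT (c + 1) M i j (us @ [x, y])"
    unfolding TT_snoc sum_Suc_interval
    by (simp add: scal_add left_diff_distrib right_diff_distrib distrib_right sum_subtractf)
  finally show ?case .
qed

lemma TT_stable_minus:
  assumes "w \<noteq> []" "i \<in> {1..M}" "j \<in> {1..M}"
  shows "TT c (Suc M) i j w - TT (c + 1) M i j w \<in> Iminus (Suc M)"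
  using assms(1,2)
proof (induction w arbitrary: i rule: cons_induct)
  case (single x)
  then show ?case by (simp add: Iminus_zero)
next
  case (cons x y w)
  let ?T = "\<lambda>a. TT c (Suc M) a j (y # w)" and ?T' = "\<lambda>a. TT (c + 1) M a j (y # w)"
  let ?U = "TT c (Suc M) i j ((x * y) # w)" and ?U' = "TT (c + 1) M i j ((x * y) # w)"
  let ?G = "EE i (Suc M) x"
  have "(\<Sum>a=1..M. EE i a x * (?T a - ?T' a)) + ?T (Suc M) * ?G + (?G * ?T (Suc M) - ?T (Suc M) * ?G - ?U) +
     scal (c + 1) * (?U - ?U') \<in> Iminus (Suc M)"
    using cons assms(3) TT_last_row_commutator[of "y # w" i "Suc M" j x c]
    by (intro Iminus_add Iminus_sum Iminus_scale Iminus_mult_EE Iminus_mult_right TT_last_row EE_Ualg) auto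
  also have "(\<Sum>a=1..M. EE i a x * (?T a - ?T' a)) + ?T (Suc M) * ?G + (?G * ?T (Suc M) - ?T (Suc M) * ?G - ?U) +
     scal (c + 1) * (?U - ?U') = TT c (Suc M) i j (x # y # w) - TT (c + 1) M i j (x # y # w)"
    unfolding TT.simps sum_Suc_interval
    by (simp add: scal_add left_diff_distrib right_diff_distrib distrib_right sum_subtractf)
  finally show ?case .
qed

subsection \<open>The smaller algebra meets the ideals trivially\<close>

text \<open>The functionals built from edges in \<open>edges M\<close> vanish on the left ideal, because a product of
  matrices that ends with \<open>Emat i (Suc M) x\<close> has only the last column.\<close>

lemma lookup_mat_word_column:
  assumes "b \<noteq> N"
  shows "lookup (mat_word (w @ [Emat i N x])) (a, b) = 0"
proof (cases "w = []")
  case True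
  then show ?thesis using assms by (simp add: Emat_def lookup_single)
next
  case False
  define B C where "B = mat_word w" and "C = Emat i N x"
  obtain S where "finite S" "keys B \<subseteq> S \<times> S" "keys C \<subseteq> S \<times> S"
    by (rule common_index_set[of B C C])
  then have "lookup (mmul B C) (a, b) = (\<Sum>k\<in>S. lookup B (a, k) * lookup C (k, b))"
    by (intro lookup_mat_prod) auto
  also have "\<dots> = 0" using assms by (intro sum.neutral) (simp add: C_def Emat_def lookup_single)
  finally show ?thesis using False by (simp add: mat_word_append B_def C_def)
qed

lemma shuffle_zero: "shuffle (\<lambda>v. 0) G w = 0" "shuffle F (\<lambda>v. 0) w = 0"
  using shuffle_scale_left[of 0 "\<lambda>v. 0" G w] shuffle_scale_right[of F 0 "\<lambda>v. 0" w] by simp_all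

lemma Phi_last_column:
  "set gs \<subseteq> edges M \<Longrightarrow> Phi gs (w @ [Emat i (Suc M) x]) = 0"
proof (induction gs arbitrary: w)
  case Nil
  then show ?case by (simp add: Phi_Nil counit_def)
next
  case (Cons g gs)
  have "edge_functional g (v @ [Emat i (Suc M) x]) = 0" for v
    using Cons.prems by (auto simp: edge_functional_def coeff_functional_def lookup_mat_word_column edges_def split: prod.splits)
  moreover have "Phi gs (v @ [Emat i (Suc M) x]) = 0" for v using Cons by simp
  ultimately show ?case by (simp add: Phi_Cons shuffle_snoc shuffle_zero)
qed

lemma evalF_Phi_Iplus:
  assumes "set gs \<subseteq> edges M"
  shows "evalF (Phi gs) (u * EE i (Suc M) x) = 0"
proof -
  obtain p where u: "u = clsE p" by (rule clsE_surj)
  have "evalF (Phi gs) (u * gEs [Emat i (Suc M) x]) = evalF (\<lambda>v. Phi gs (v @ [Emat i (Suc M) x])) u"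
    by (rule evalF_mult_gEs[OF good_Phi])
  also have "\<dots> = 0"
    using good_shift_right[OF good_Phi, of gs "[Emat i (Suc M) x]"]
    by (simp add: u evalF_clsE Phi_last_column[OF assms] lin_def)
  finally show ?thesis by (simp add: EE_def)
qed

lemma Ualg_eq_0_if_Phi:
  assumes "u \<in> Ualg M" "\<And>gs. set gs \<subseteq> edges M \<Longrightarrow> evalF (Phi gs) u = 0"
  shows "u = 0"
proof -
  obtain p where p: "p \<in> Fc M" "u = clsE p" using assms(1) by (auto simp: Ualg_def)
  then have "p \<in> Uideal M"
    using assms(2) by (intro Uideal_if_Phi_zero) (auto simp: evalF_clsE good_Phi)
  then show ?thesis using p by (auto simp: clsE_eq_0_iff Uideal_eq)
qed

lemma evalF_Phi_Ffil:
  assumes "u \<in> Ffil N k" "k < length gs"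
  shows "evalF (Phi gs) u = 0"
proof -
  obtain p where p: "u = clsE p" "\<forall>w\<in>keys p. length (letters w) \<le> k"
    using assms(1) by (auto simp: Ffil_def)
  then have "Phi gs (letters w) = 0" if "w \<in> keys p" for w
    using that assms(2) by (intro Phi_short) (meson le_less_trans)
  then show ?thesis by (simp add: p(1) evalF_clsE good_Phi lin_def)
qed

end

section \<open>The generators in the quotient presentation\<close>

lemma list_bounded_Suc:
  "{as. length as = Suc m \<and> set as \<subseteq> S} = (\<lambda>(a, as). a # as) ` (S \<times> {as. length as = m \<and> set as \<subseteq> S})"
  by (auto simp: length_Suc_conv image_iff)

lemma clsE_e_free_single: "clsE (e_free N i j [x]) = EE i j x"
  by (simp add: e_free_def clsE_gen EE_def conj_commute cong: conj_cong)

lemma clsE_e_free_Cons: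
  "clsE (e_free N i j (x # y # w)) = (\<Sum>a=1..N. EE i a x * clsE (e_free N a j (y # w)))"
proof -
  define L where "L m = {as. length as = m \<and> set as \<subseteq> {1..N}}" for m
  have fin: "finite (L m)" for m
    unfolding L_def using finite_lists_length_eq[of "{1..N}" m] by (simp add: conj_commute)
  define P where "P as i xs = (\<Prod>k\<leftarrow>[0..<length xs]. EE ((i # as @ [j]) ! k) ((i # as @ [j]) ! (k + 1)) (xs ! k))"
    for as i and xs :: "'a list"
  have e: "clsE (e_free N i j xs) = (\<Sum>as\<in>L (length xs - 1). P as i xs)" for i xs
    by (simp add: e_free_def clsE_sum clsE_prod_list o_def clsE_gen L_def P_def EE_def)
  have P: "P (a # as) i (x # xs) = EE i a x * P as a xs" for a as i x xs
  proof -
    have "[0..<length (x # xs)] = 0 # map Suc [0..<length xs]"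
      by (simp add: upt_conv_Cons map_Suc_upt del: upt_Suc)
    then show ?thesis by (simp add: P_def o_def del: upt_Suc)
  qed
  have "clsE (e_free N i j (x # y # w)) = (\<Sum>as\<in>(\<lambda>(a, as). a # as) ` ({1..N} \<times> L (length w)). P as i (x # y # w))"
    unfolding e L_def by (simp add: list_bounded_Suc)
  also have "\<dots> = (\<Sum>(a, as)\<in>{1..N} \<times> L (length w). EE i a x * P as a (y # w))"
    by (subst sum.reindex) (auto simp: inj_on_def P intro!: sum.cong)
  also have "\<dots> = (\<Sum>a=1..N. \<Sum>as\<in>L (length w). EE i a x * P as a (y # w))"
    by (rule sum.cartesian_product[symmetric])
  also have "\<dots> = (\<Sum>a=1..N. EE i a x * clsE (e_free N a j (y # w)))"
    by (simp add: e sum_distrib_left)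
  finally show ?thesis .
qed

lemma contract_Nil_iff: "xs \<rhd> \<nu> = [] \<longleftrightarrow> \<nu> = []"
  by (cases \<nu>) auto

lemma length_contract [simp]: "length (xs \<rhd> \<nu>) = length \<nu>"
  by (induction xs \<nu> rule: contract.induct) auto

lemma prod_tuple_merge: "prod_tuple ((x * y) # u) = prod_tuple (x # y # u)"
  by (cases u) (auto simp: mult.assoc)

lemma finite_compositions: "finite (compositions m)"
proof (rule finite_subset)
  have "length \<nu> \<le> sum_list \<nu>" if "\<forall>k\<in>set \<nu>. 0 < k" for \<nu> :: "nat list"
    using that by (induction \<nu>) auto
  then show "compositions m \<subseteq> {\<nu>. set \<nu> \<subseteq> {..m} \<and> length \<nu> \<le> m}"
    using member_le_sum_list by (fastforce simp: compositions_def)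
qed (simp add: finite_lists_length_le)

lemma compositions_1: "compositions (Suc 0) = {[1]}"
proof -
  have "\<nu> = [1]" if "\<nu> \<in> compositions (Suc 0)" for \<nu>
    using that by (cases \<nu>; cases "tl \<nu>") (auto simp: compositions_def)
  then show ?thesis by (auto simp: compositions_def)
qed

text \<open>The first part is 1 or larger; these alternatives become the two terms of the recursion
  for \<open>TT\<close>.\<close>

lemma compositions_Suc_Suc:
  "compositions (Suc (Suc m)) = Cons 1 ` compositions (Suc m) \<union> (\<lambda>\<nu>. Suc (hd \<nu>) # tl \<nu>) ` compositions (Suc m)"
  (is "?L = ?A \<union> ?B")
proof (intro equalityI subsetI)
  fix \<nu> assume \<nu>: "\<nu> \<in> ?L"
  then obtain k \<mu> where k: "\<nu> = k # \<mu>" by (cases \<nu>) (auto simp: compositions_def)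
  show "\<nu> \<in> ?A \<union> ?B"
  proof (cases "k = 1")
    case True
    then show ?thesis using \<nu> by (auto simp: k compositions_def)
  next
    case False
    then have "(k - 1) # \<mu> \<in> compositions (Suc m)" "k = Suc (k - 1)" using \<nu> by (auto simp: k compositions_def)
    then show ?thesis by (force simp: k image_iff)
  qed
next
  fix \<nu> assume "\<nu> \<in> ?A \<union> ?B"
  then show "\<nu> \<in> ?L"
  proof
    assume "\<nu> \<in> ?B"
    then obtain \<mu> where \<mu>: "\<mu> \<in> compositions (Suc m)" "\<nu> = Suc (hd \<mu>) # tl \<mu>" by auto
    then show ?thesis by (cases \<mu>) (auto simp: compositions_def)
  qed (auto simp: compositions_def)
qed

lemma length_composition_le: "\<nu> \<in> compositions m \<Longrightarrow> length \<nu> \<le> m"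
proof -
  have "length \<nu> \<le> sum_list \<nu>" if "\<forall>k\<in>set \<nu>. 0 < k" for \<nu> :: "nat list"
    using that by (induction \<nu>) auto
  then show "\<nu> \<in> compositions m \<Longrightarrow> length \<nu> \<le> m" by (auto simp: compositions_def)
qed

lemma TT_eq_sum_compositions:
  "xs \<noteq> [] \<Longrightarrow> TT c N i j xs =
     (\<Sum>\<nu>\<in>compositions (length xs). scal (c ^ (length xs - length \<nu>)) * clsE (e_free N i j (xs \<rhd> \<nu>)))"
proof (induction xs arbitrary: i rule: cons_induct)
  case (single x)
  then show ?case by (simp add: compositions_1 clsE_e_free_single)
next
  case (cons x y w)
  let ?C = "compositions (Suc (length w))" and ?inc = "\<lambda>\<nu>. Suc (hd \<nu>) # tl \<nu>" and ?n = "Suc (Suc (length w))"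
  let ?h = "\<lambda>\<nu>. scal (c ^ (?n - length \<nu>)) * clsE (e_free N i j ((x # y # w) \<rhd> \<nu>))"
  have pos: "\<forall>k\<in>set \<nu>. 0 < k" "\<nu> \<noteq> []" "length \<nu> \<le> Suc (length w)" if "\<nu> \<in> ?C" for \<nu>
    using that length_composition_le[OF that] by (auto simp: compositions_def)
  have inj: "inj_on ?inc ?C"
    using pos(2) by (auto simp: inj_on_def intro: list.expand)
  have "(\<Sum>\<nu>\<in>compositions ?n. ?h \<nu>) = (\<Sum>\<nu>\<in>Cons 1 ` ?C. ?h \<nu>) + (\<Sum>\<nu>\<in>?inc ` ?C. ?h \<nu>)"
    unfolding compositions_Suc_Suc
  proof (rule sum.union_disjoint)
    show "Cons 1 ` ?C \<inter> ?inc ` ?C = {}"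
    proof -
      have "hd \<nu> \<noteq> 0" if "\<nu> \<in> ?C" for \<nu> using pos[OF that] by (cases \<nu>) auto
      then show ?thesis by force
    qed
  qed (simp_all add: finite_compositions)
  also have "(\<Sum>\<nu>\<in>Cons 1 ` ?C. ?h \<nu>) = (\<Sum>\<nu>\<in>?C. ?h (1 # \<nu>))"
    by (subst sum.reindex) (auto simp: inj_on_def)
  also have "\<dots> = (\<Sum>\<nu>\<in>?C. \<Sum>a=1..N. EE i a x * (scal (c ^ (length (y # w) - length \<nu>)) * clsE (e_free N a j ((y # w) \<rhd> \<nu>))))"
  proof (rule sum.cong[OF refl])
    fix \<nu> assume \<nu>: "\<nu> \<in> ?C"
    obtain z zs where z: "(y # w) \<rhd> \<nu> = z # zs"
      using pos(2)[OF \<nu>] contract_Nil_iff by (metis list.exhaust)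
    show "?h (1 # \<nu>) = (\<Sum>a=1..N. EE i a x * (scal (c ^ (length (y # w) - length \<nu>)) * clsE (e_free N a j ((y # w) \<rhd> \<nu>))))"
      by (simp add: z clsE_e_free_Cons sum_distrib_left scal_pull)
  qed
  also have "\<dots> = (\<Sum>a=1..N. EE i a x * TT c N a j (y # w))"
    by (subst sum.swap) (simp add: cons.IH(1) sum_distrib_left)
  also have "(\<Sum>\<nu>\<in>?inc ` ?C. ?h \<nu>) = (\<Sum>\<nu>\<in>?C. ?h (?inc \<nu>))"
    by (subst sum.reindex[OF inj]) simp
  also have "\<dots> = (\<Sum>\<nu>\<in>?C. scal c * (scal (c ^ (length ((x * y) # w) - length \<nu>)) * clsE (e_free N i j (((x * y) # w) \<rhd> \<nu>))))"
  proof (rule sum.cong[OF refl])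
    fix \<nu> assume \<nu>: "\<nu> \<in> ?C"
    then obtain k \<mu> where k: "\<nu> = Suc k # \<mu>"
      using pos[OF \<nu>] by (cases \<nu>) (auto simp: gr0_conv_Suc)
    \<comment> \<open>Enlarging the first part by one multiplies the first two letters together. The
      number of parts stays the same while the word was one letter longer, which accounts for one
      factor \<open>c\<close>.\<close>
    have h1: "(x # y # w) \<rhd> ?inc \<nu> = ((x * y) # w) \<rhd> \<nu>" by (simp add: k prod_tuple_merge)
    have h2: "?n - length (?inc \<nu>) = Suc (length ((x * y) # w) - length \<nu>)"
      using pos[OF \<nu>] by (simp add: k)
    show "?h (?inc \<nu>) = scal c * (scal (c ^ (length ((x * y) # w) - length \<nu>)) * clsE (e_free N i j (((x * y) # w) \<rhd> \<nu>)))"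
      unfolding h1 h2 power_Suc scal_mult mult.assoc ..
  qed
  also have "\<dots> = scal c * TT c N i j ((x * y) # w)"
    by (simp add: cons.IH(2) sum_distrib_left)
  finally show ?case by simp
qed

context algebra_basis
begin

lemma e_free_Fc:
  assumes "i \<in> {1..N}" "j \<in> {1..N}" "xs \<noteq> []"
  shows "e_free N i j xs \<in> Fc N"
  unfolding e_free_def
proof (rule Fc_sum)
  fix as assume as: "as \<in> {as. length as = length xs - 1 \<and> set as \<subseteq> {1..N}}"
  have r: "(i # as @ [j]) ! k \<in> {1..N}" if "k \<le> length xs" for k
  proof -
    have "(i # as @ [j]) ! k \<in> set (i # as @ [j])" using that as assms(3) by (intro nth_mem) auto
    then show ?thesis using as assms by auto
  qed
  have "Emat ((i # as @ [j]) ! k) ((i # as @ [j]) ! (k + 1)) (xs ! k) \<in> gl N" if "k < length xs" for k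
    using r[of k] r[of "k + 1"] that by (intro gl_Emat) auto
  then have "set (map (\<lambda>k. Emat ((i # as @ [j]) ! k) ((i # as @ [j]) ! (k + 1)) (xs ! k)) [0..<length xs]) \<subseteq> gl N"
    by auto
  from Fc_gens[OF this]
  show "(\<Prod>k\<leftarrow>[0..<length xs]. gen (Emat ((i # as @ [j]) ! k) ((i # as @ [j]) ! (k + 1)) (xs ! k))) \<in> Fc N"
    by (simp add: o_def)
qed

lemma t_fin_eq_fib:
  assumes "i \<in> {1..N}" "j \<in> {1..N}" "xs \<noteq> []"
  shows "t_fin s N i j xs = fib N (TT (- of_nat N - s) N i j xs)"
proof -
  have "xs \<rhd> \<nu> \<noteq> []" if "\<nu> \<in> compositions (length xs)" for \<nu>
    using that assms(3) by (auto simp: contract_Nil_iff compositions_def)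
  then show ?thesis
    unfolding t_fin_def TT_eq_sum_compositions[OF assms(3)]
    by (subst cls_eq_fib) (auto intro!: Fc_sum Fc_mult Fc_cst e_free_Fc assms simp: clsE_sum clsE_mult clsE_cst)
qed

end

section \<open>Stable sequences\<close>

context algebra_basis
begin

text \<open>A concrete form of the carrier of \<open>A_alg\<close>: the projection to the smaller algebra is replaced by
  the explicit requirement that consecutive terms differ by an element of both ideals.\<close>

definition stable_seq :: "nat \<Rightarrow> (nat \<Rightarrow> 'w env) \<Rightarrow> bool" where
  "stable_seq d u \<longleftrightarrow> (\<forall>N\<ge>d. u N \<in> Ualg N) \<and> (\<forall>N\<ge>d. \<forall>A\<in>gl_sub d N. adE A (u N) = 0) \<and>
     (\<forall>M\<ge>d. u (Suc M) - u M \<in> Iplus (Suc M) \<inter> Iminus (Suc M)) \<and> (\<exists>k. \<forall>N\<ge>d. u N \<in> Ffil N k)"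

lemma stable_seqD:
  assumes "stable_seq d u"
  shows "N \<ge> d \<Longrightarrow> u N \<in> Ualg N" "N \<ge> d \<Longrightarrow> A \<in> gl_sub d N \<Longrightarrow> adE A (u N) = 0"
    "N \<ge> d \<Longrightarrow> u (Suc N) - u N \<in> Iplus (Suc N)" "N \<ge> d \<Longrightarrow> u (Suc N) - u N \<in> Iminus (Suc N)"
  using assms by (auto simp: stable_seq_def)

lemma stable_seq_zero: "stable_seq d (\<lambda>N. 0)"
  using Ualg_0 Ffil_0 by (auto simp: stable_seq_def intro: Iplus_zero Iminus_zero)

lemma stable_seq_one: "stable_seq d (\<lambda>N. 1)"
  using Ualg_1 Ffil_1 by (auto simp: stable_seq_def intro: Iplus_zero Iminus_zero)

lemma stable_seq_add: "stable_seq d u \<Longrightarrow> stable_seq d v \<Longrightarrow> stable_seq d (\<lambda>N. u N + v N)"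
proof -
  assume uv: "stable_seq d u" "stable_seq d v"
  then obtain k l where kl: "\<forall>N\<ge>d. u N \<in> Ffil N k" "\<forall>N\<ge>d. v N \<in> Ffil N l" by (auto simp: stable_seq_def)
  have "\<forall>N\<ge>d. u N + v N \<in> Ffil N (max k l)"
    using kl by (meson Ffil_add Ffil_mono max.cobounded1 max.cobounded2 subsetD)
  then show ?thesis
    using stable_seqD[OF uv(1)] stable_seqD[OF uv(2)]
    by (auto simp: stable_seq_def adE_add add_diff_add intro!: Ualg_add Iplus_add Iminus_add)
qed

lemma stable_seq_scale: "stable_seq d u \<Longrightarrow> stable_seq d (\<lambda>N. scal c * u N)"
proof -
  assume u: "stable_seq d u"
  then obtain k where k: "\<forall>N\<ge>d. u N \<in> Ffil N k" by (auto simp: stable_seq_def)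
  then have "\<forall>N\<ge>d. scal c * u N \<in> Ffil N k" by (auto intro: Ffil_scale)
  moreover have "scal c * u (Suc M) - scal c * u M = scal c * (u (Suc M) - u M)" for M
    by (simp add: right_diff_distrib)
  ultimately show ?thesis
    using stable_seqD[OF u] by (auto simp: stable_seq_def adE_scal intro!: Ualg_scale Iplus_scale Iminus_scale)
qed

lemma stable_seq_mult: "stable_seq d u \<Longrightarrow> stable_seq d v \<Longrightarrow> stable_seq d (\<lambda>N. u N * v N)"
proof -
  assume uv: "stable_seq d u" "stable_seq d v"
  note u = stable_seqD[OF uv(1)] and v = stable_seqD[OF uv(2)]
  obtain k l where kl: "\<forall>N\<ge>d. u N \<in> Ffil N k" "\<forall>N\<ge>d. v N \<in> Ffil N l" using uv by (auto simp: stable_seq_def)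
  then have "\<forall>N\<ge>d. u N * v N \<in> Ffil N (k + l)" by (auto intro: Ffil_mult)
  moreover have "u (Suc M) * v (Suc M) - u M * v M \<in> Iplus (Suc M) \<inter> Iminus (Suc M)" if M: "M \<ge> d" for M
  proof -
    define a b where "a = u (Suc M) - u M" and "b = v (Suc M) - v M"
    have ab: "a \<in> Iplus (Suc M)" "a \<in> Iminus (Suc M)" "b \<in> Iplus (Suc M)" "b \<in> Iminus (Suc M)"
      using u(3,4)[OF M] v(3,4)[OF M] by (simp_all add: a_def b_def)
    have "u M \<in> Ualg (Suc M)" "v M \<in> Ualg (Suc M)" using u(1)[OF M] v(1)[OF M] Ualg_mono[of M "Suc M"] by auto
    \<comment> \<open>The factors next to \<open>a\<close> and \<open>b\<close> are taken at level
      \<open>M\<close>, because each one-sided ideal admits multiplication on its other side by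
      elements of the smaller algebra.\<close>
    then have "u M * b + a * v M + a * b \<in> Iplus (Suc M)" "u M * b + a * v M + a * b \<in> Iminus (Suc M)"
      using u(1)[OF M] v(1)[OF M] ab
      by (intro Iplus_add Iminus_add; auto intro: Iplus_mult_left Iplus_mult_right Iminus_mult_left Iminus_mult_right Iplus_Ualg)+
    moreover have "u (Suc M) * v (Suc M) - u M * v M = u M * b + a * v M + a * b"
      by (simp add: a_def b_def algebra_simps)
    ultimately show ?thesis by simp
  qed
  ultimately show ?thesis
    using u(1,2) v(1,2) by (auto simp: stable_seq_def adE_mult intro!: Ualg_mult)
qed

lemma stable_seq_sum: "(\<And>i. i \<in> I \<Longrightarrow> stable_seq d (f i)) \<Longrightarrow> stable_seq d (\<lambda>N. \<Sum>i\<in>I. f i N)"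
  by (induction I rule: infinite_finite_induct) (auto intro: stable_seq_zero stable_seq_add)

abbreviation TTs :: "complex \<Rightarrow> nat \<Rightarrow> nat \<times> nat \<times> 'w list \<Rightarrow> 'w env" where
  "TTs s N \<equiv> \<lambda>(i, j, xs). TT (- of_nat N - s) N i j xs"

lemma stable_seq_TTs:
  assumes "t \<in> triples d UNIV"
  shows "stable_seq d (\<lambda>N. TTs s N t)"
proof -
  obtain i j xs where t: "t = (i, j, xs)" by (cases t)
  have ij: "i \<in> {1..d}" "j \<in> {1..d}" "xs \<noteq> []" using assms by (auto simp: t triples_def words_def)
  \<comment> \<open>Raising the level by one lowers the parameter by one, exactly the shift in
    \<open>TT_stable_plus\<close> and \<open>TT_stable_minus\<close>.\<close>
  have c: "- of_nat M - s = - of_nat (Suc M) - s + 1" for M by simp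
  have "TT (- of_nat (Suc M) - s) (Suc M) i j xs - TT (- of_nat M - s) M i j xs \<in> Iplus (Suc M) \<inter> Iminus (Suc M)"
    if "M \<ge> d" for M
    unfolding c[of M] using ij that by (intro IntI TT_stable_plus TT_stable_minus) auto
  moreover have "TT (- of_nat N - s) N i j xs \<in> Ffil N (length xs)" if "N \<ge> d" for N
    using ij that by (intro Ffil_TT) auto
  ultimately show ?thesis
    using ij by (auto simp: t stable_seq_def adE_TT_zero intro!: TT_Ualg)
qed

subsection \<open>Compatibility with the projections\<close>

lemma carrier_fibE:
  assumes "a \<in> carrier (Ugl N)"
  obtains u where "u \<in> Ualg N" "a = fib N u"
  using assms by (auto simp: carrier_Ugl)

lemma add_inv_fib: "u \<in> Ualg N \<Longrightarrow> m_inv (add_monoid (Ugl N)) (fib N u) = fib N (- u)"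
  unfolding m_inv_def
proof (rule the_equality)
  assume u: "u \<in> Ualg N"
  then show "fib N (- u) \<in> carrier (add_monoid (Ugl N)) \<and>
     fib N u \<otimes>\<^bsub>add_monoid (Ugl N)\<^esub> fib N (- u) = \<one>\<^bsub>add_monoid (Ugl N)\<^esub> \<and>
     fib N (- u) \<otimes>\<^bsub>add_monoid (Ugl N)\<^esub> fib N u = \<one>\<^bsub>add_monoid (Ugl N)\<^esub>"
    by (simp add: carrier_Ugl fib_ops fib_0 Ualg_uminus)
  fix b assume b: "b \<in> carrier (add_monoid (Ugl N)) \<and>
     fib N u \<otimes>\<^bsub>add_monoid (Ugl N)\<^esub> b = \<one>\<^bsub>add_monoid (Ugl N)\<^esub> \<and>
     b \<otimes>\<^bsub>add_monoid (Ugl N)\<^esub> fib N u = \<one>\<^bsub>add_monoid (Ugl N)\<^esub>"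
  then obtain v where v: "v \<in> Ualg N" "b = fib N v" by (auto elim: carrier_fibE)
  then have "u + v = 0" using b u by (simp add: fib_ops fib_0 fib_inj Ualg_add)
  then show "b = fib N (- u)" using v by (simp add: add_eq_0_iff)
qed

lemma Iplus_I_plus:
  assumes "v \<in> Iplus N"
  shows "fib N v \<in> I_plus N"
  unfolding I_plus_def
proof (intro InterI)
  fix I :: "'w matr falg set set"
  assume "I \<in> {I. left_ideal I (Ugl N) \<and> {cls N (gen (Emat i N x)) | i x. i \<in> {1..N}} \<subseteq> I}"
  then have sub: "additive_subgroup I (Ugl N)" and mult: "\<And>a x. a \<in> carrier (Ugl N) \<Longrightarrow> x \<in> I \<Longrightarrow> a \<otimes>\<^bsub>Ugl N\<^esub> x \<in> I"
    and gens: "\<And>i x. i \<in> {1..N} \<Longrightarrow> cls N (gen (Emat i N x)) \<in> I"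
    unfolding left_ideal_def by blast+
  have E: "fib N (EE i N x) \<in> I" if "i \<in> {1..N}" for i x
    using gens[OF that, of x] that by (simp add: cls_eq_fib Fc_gen gl_Emat clsE_gen EE_def)
  show "fib N v \<in> I" using assms
  proof (induction rule: Iplus.induct)
    case Iplus_zero
    then show ?case using additive_subgroup.zero_closed[OF sub] by (simp add: fib_0)
  next
    case (Iplus_gen u i x)
    then show ?case using mult[OF _ E[of i x], of "fib N u"] EE_Ualg[of i N N x] by (simp add: carrier_Ugl fib_ops)
  next
    case (Iplus_add u v)
    then show ?case using additive_subgroup.a_closed[OF sub, of "fib N u" "fib N v"] by (simp add: fib_ops Iplus_Ualg)
  qed
qed

lemma Iminus_I_minus:
  assumes "v \<in> Iminus N"
  shows "fib N v \<in> I_minus N"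
  unfolding I_minus_def
proof (intro InterI)
  fix I :: "'w matr falg set set"
  assume "I \<in> {I. right_ideal I (Ugl N) \<and> {cls N (gen (Emat N j x)) | j x. j \<in> {1..N}} \<subseteq> I}"
  then have sub: "additive_subgroup I (Ugl N)" and mult: "\<And>a x. a \<in> carrier (Ugl N) \<Longrightarrow> x \<in> I \<Longrightarrow> x \<otimes>\<^bsub>Ugl N\<^esub> a \<in> I"
    and gens: "\<And>j x. j \<in> {1..N} \<Longrightarrow> cls N (gen (Emat N j x)) \<in> I"
    unfolding right_ideal_def by blast+
  have E: "fib N (EE N j x) \<in> I" if "j \<in> {1..N}" for j x
    using gens[OF that, of x] that by (simp add: cls_eq_fib Fc_gen gl_Emat clsE_gen EE_def)
  show "fib N v \<in> I" using assms
  proof (induction rule: Iminus.induct)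
    case Iminus_zero
    then show ?case using additive_subgroup.zero_closed[OF sub] by (simp add: fib_0)
  next
    case (Iminus_gen u j x)
    then show ?case using mult[OF _ E[of j x], of "fib N u"] EE_Ualg[of N N j x] by (simp add: carrier_Ugl fib_ops)
  next
    case (Iminus_add u v)
    then show ?case using additive_subgroup.a_closed[OF sub, of "fib N u" "fib N v"] by (simp add: fib_ops Iminus_Ualg)
  qed
qed

text \<open>An intersection of left ideals is exploited through one member: \<open>V\<close> is the
  largest left ideal on which all functionals of edge words in \<open>edges M\<close> vanish, and it
  contains the last column.\<close>

lemma I_plus_Phi:
  assumes "fib (Suc M) w \<in> I_plus (Suc M)" "w \<in> Ualg (Suc M)" "set gs \<subseteq> edges M"
  shows "evalF (Phi gs) w = 0"
proof -
  let ?N = "Suc M"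
  define V where "V = {w \<in> Ualg ?N. \<forall>v\<in>Ualg ?N. \<forall>gs. set gs \<subseteq> edges M \<longrightarrow> evalF (Phi gs) (v * w) = 0}"
  have V: "V \<subseteq> Ualg ?N" by (auto simp: V_def)
  have evm: "evalF F (- u) = - evalF F u" for F and u :: "'w env"
    using evalF_diff[of F 0 u] by simp
  have "left_ideal (fib ?N ` V) (Ugl ?N)"
    unfolding left_ideal_def
  proof (intro conjI ballI)
    show "additive_subgroup (fib ?N ` V) (Ugl ?N)"
    proof (rule additive_subgroup.intro, rule subgroup.intro)
      show "fib ?N ` V \<subseteq> carrier (add_monoid (Ugl ?N))" using V by (auto simp: carrier_Ugl)
    next
      fix a b assume "a \<in> fib ?N ` V" "b \<in> fib ?N ` V"
      then obtain u v where uv: "u \<in> V" "v \<in> V" "a = fib ?N u" "b = fib ?N v" by auto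
      then have "u + v \<in> V" by (auto simp: V_def distrib_left evalF_add Ualg_add)
      moreover have "fib ?N u \<oplus>\<^bsub>Ugl ?N\<^esub> fib ?N v = fib ?N (u + v)" using uv V by (intro fib_ops) auto
      ultimately show "a \<otimes>\<^bsub>add_monoid (Ugl ?N)\<^esub> b \<in> fib ?N ` V" by (simp add: uv)
    next
      have "0 \<in> V" by (simp add: V_def Ualg_0)
      then show "\<one>\<^bsub>add_monoid (Ugl ?N)\<^esub> \<in> fib ?N ` V" by (simp add: fib_0)
    next
      fix a assume "a \<in> fib ?N ` V"
      then obtain u where u: "u \<in> V" "a = fib ?N u" by auto
      then have "- u \<in> V" by (auto simp: V_def evm Ualg_uminus)
      moreover have "inv\<^bsub>add_monoid (Ugl ?N)\<^esub> a = fib ?N (- u)" using u V add_inv_fib[of u ?N] by auto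
      ultimately show "inv\<^bsub>add_monoid (Ugl ?N)\<^esub> a \<in> fib ?N ` V" by simp
    qed
  next
    fix a b :: "'w matr falg set" assume "a \<in> carrier (Ugl ?N)" "b \<in> fib ?N ` V"
    then obtain u v where uv: "u \<in> Ualg ?N" "v \<in> V" "a = fib ?N u" "b = fib ?N v" by (auto elim: carrier_fibE)
    then have "u * v \<in> V" by (auto simp: V_def Ualg_mult simp flip: mult.assoc)
    moreover have "fib ?N u \<otimes>\<^bsub>Ugl ?N\<^esub> fib ?N v = fib ?N (u * v)" using uv V by (intro fib_ops) auto
    ultimately show "a \<otimes>\<^bsub>Ugl ?N\<^esub> b \<in> fib ?N ` V" by (simp add: uv)
  qed
  moreover have "cls ?N (gen (Emat i ?N x)) \<in> fib ?N ` V" if "i \<in> {1..?N}" for i x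
  proof -
    have "EE i ?N x \<in> V" using that by (auto simp: V_def evalF_Phi_Iplus intro!: EE_Ualg)
    moreover have "cls ?N (gen (Emat i ?N x)) = fib ?N (EE i ?N x)"
      using that by (subst cls_eq_fib) (auto intro!: Fc_gen gl_Emat simp: clsE_gen EE_def)
    ultimately show ?thesis by simp
  qed
  ultimately have "I_plus ?N \<subseteq> fib ?N ` V" unfolding I_plus_def by blast
  then obtain w' where "w' \<in> V" "fib ?N w = fib ?N w'" using assms(1) by blast
  then have "w \<in> V" using assms(2) by (simp add: fib_inj)
  then have "evalF (Phi gs) (1 * w) = 0" using assms(3) Ualg_1 unfolding V_def by blast
  then show ?thesis by simp
qed

lemma Iplus_Ualg_trivial: "u \<in> Iplus (Suc M) \<Longrightarrow> u \<in> Ualg M \<Longrightarrow> u = 0"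
  by (rule Ualg_eq_0_if_Phi) (auto intro: I_plus_Phi[of M] Iplus_I_plus Iplus_Ualg)

lemma adE_last_Ualg: "u \<in> Ualg M \<Longrightarrow> adE (Emat (Suc M) (Suc M) 1) u = 0"
proof (induction rule: Ualg_induct)
  case (word c ws)
  have "gl_ad (Emat (Suc M) (Suc M) 1) A = 0" if "A \<in> gl M" for A :: "'w matr"
    using that
  proof (induction rule: gl_eq_span_Emat_induct)
    case zero
    show ?case using gl_ad_add[of "Emat (Suc M) (Suc M) 1" 0 "0 :: 'w matr"] by simp
  qed (auto simp: gl_ad_Emat gl_ad_add)
  then have "adE (Emat (Suc M) (Suc M) 1) (gEs ws) = 0" if "set ws \<subseteq> gl M" for ws :: "'w matr list"
    using that by (induction ws) (auto simp: adE_gE_mult)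
  then show ?case using word by (simp add: adE_scal)
qed (simp add: adE_add)

text \<open>Uniqueness of the decomposition comes from the left ideal: two candidates differ by an
  element of \<open>Ualg M\<close> that is killed by every functional of an edge word in
  \<open>edges M\<close>, hence is 0.\<close>

lemma proj_fib:
  assumes "u \<in> Ualg (Suc M)" "v \<in> Ualg M" "adE (Emat (Suc M) (Suc M) 1) u = 0"
    and "u - v \<in> Iplus (Suc M)" "u - v \<in> Iminus (Suc M)"
  shows "proj (Suc M) (fib (Suc M) u) = fib M v"
proof -
  let ?N = "Suc M"
  have v: "v \<in> Ualg ?N" using assms(2) Ualg_mono[of M ?N] by auto
  have emb: "emb ?N (fib M v) = fib ?N v" if "v \<in> Ualg M" for v using emb_fib[of v ?N] that by simp
  show ?thesis
    unfolding proj_def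
  proof (rule the_equality)
    have "act ?N (Emat ?N ?N 1) (fib ?N (u - v)) = fib ?N 0"
      using assms v by (simp add: act_fib gl_Emat Ualg_diff adE_diff adE_last_Ualg)
    then have "fib ?N (u - v) \<in> L_ideal ?N"
      using assms v by (simp add: L_ideal_def U_ENN_def carrier_Ugl fib_0 Iplus_I_plus Iminus_I_minus Ualg_diff)
    moreover have "fib ?N u = emb ?N (fib M v) \<oplus>\<^bsub>Ugl ?N\<^esub> fib ?N (u - v)"
      using assms v by (simp add: emb fib_ops Ualg_diff)
    ultimately show "fib M v \<in> carrier (Ugl (?N - 1)) \<and> (\<exists>l\<in>L_ideal ?N. fib ?N u = emb ?N (fib M v) \<oplus>\<^bsub>Ugl ?N\<^esub> l)"
      using assms(2) by (auto simp: carrier_Ugl)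
  next
    fix b assume "b \<in> carrier (Ugl (?N - 1)) \<and> (\<exists>l\<in>L_ideal ?N. fib ?N u = emb ?N b \<oplus>\<^bsub>Ugl ?N\<^esub> l)"
    then obtain l where b: "b \<in> carrier (Ugl M)" and l: "l \<in> L_ideal ?N" and eq: "fib ?N u = emb ?N b \<oplus>\<^bsub>Ugl ?N\<^esub> l"
      by auto
    obtain z where z: "z \<in> Ualg M" "b = fib M z" using b by (rule carrier_fibE)
    have z': "z \<in> Ualg ?N" using z(1) Ualg_mono[of M ?N] by auto
    have "l \<in> carrier (Ugl ?N)" using l by (auto simp: L_ideal_def U_ENN_def)
    then obtain w where w: "w \<in> Ualg ?N" "l = fib ?N w" by (rule carrier_fibE)
    have uzw: "u = z + w" using eq assms(1) z z' w by (simp add: emb fib_ops fib_inj)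
    have "evalF (Phi gs) (z - v) = 0" if gs: "set gs \<subseteq> edges M" for gs
    proof -
      have "evalF (Phi gs) w = 0" using l w gs by (intro I_plus_Phi[of M]) (auto simp: L_ideal_def)
      moreover have "evalF (Phi gs) (u - v) = 0"
        using assms gs by (intro I_plus_Phi[of M]) (auto intro: Iplus_I_plus Iplus_Ualg)
      moreover have "z - v = (u - v) - w" by (simp add: uzw)
      ultimately show ?thesis by (simp only: evalF_diff diff_0_right)
    qed
    then have "z - v = 0" using z assms(2) by (intro Ualg_eq_0_if_Phi[of _ M]) (auto intro: Ualg_diff)
    then show "b = fib M v" by (simp add: z)
  qed
qed

section \<open>Stable sequences as elements of the limit algebra\<close>

definition fib_seq :: "nat \<Rightarrow> (nat \<Rightarrow> 'w env) \<Rightarrow> nat \<Rightarrow> 'w matr falg set" where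
  "fib_seq d u = (\<lambda>N\<in>{d..}. fib N (u N))"

lemma fib_seq_carrier:
  assumes u: "stable_seq d u"
  shows "fib_seq d u \<in> carrier (A_alg d)"
proof -
  have sub: "gl_sub d N \<subseteq> gl N" for N by (fastforce simp: gl_sub_def gl_def)
  have "fib N (u N) \<in> A_fin d N" if "N \<ge> d" for N
    using stable_seqD(1,2)[OF u that] sub[of N] by (auto simp: A_fin_def carrier_Ugl act_fib fib_0)
  moreover have "proj N (fib N (u N)) = fib (N - 1) (u (N - 1))" if N: "N > d" for N
  proof -
    obtain M where M: "N = Suc M" "M \<ge> d" using N by (cases N) auto
    \<comment> \<open>For \<open>N > d\<close> the matrix \<open>Emat N N 1\<close> belongs to
      \<open>gl_sub d N\<close>, so invariance puts every term into the domain of the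
      projection.\<close>
    have "(Emat N N 1 :: complex matr) \<in> gl_sub d N" using N by (auto simp: gl_sub_def Emat_def)
    then have "proj (Suc M) (fib (Suc M) (u (Suc M))) = fib M (u M)"
      using stable_seqD[OF u] M by (intro proj_fib) auto
    then show ?thesis by (simp add: M)
  qed
  moreover have "\<exists>k. \<forall>N\<ge>d. fib N (u N) \<in> U_filt N k"
  proof -
    obtain k where k: "\<forall>N\<ge>d. u N \<in> Ffil N k" using u by (auto simp: stable_seq_def)
    have "fib N w \<in> U_filt N k" if w: "w \<in> Ffil N k" for w N
    proof -
      obtain p :: "'w matr falg" where "p \<in> Fc N" "\<forall>w\<in>keys p. length (letters w) \<le> k" "w = clsE p"
        using w by (auto simp: Ffil_def)
      then show ?thesis using cls_eq_fib[of p N] unfolding U_filt_def by blast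
    qed
    with k show ?thesis by blast
  qed
  ultimately show ?thesis by (auto simp: A_alg_def fib_seq_def)
qed

lemma fib_seq_eq_iff:
  assumes "\<And>N. N \<ge> d \<Longrightarrow> u N \<in> Ualg N"
  shows "fib_seq d u = fib_seq d v \<longleftrightarrow> (\<forall>N\<ge>d. u N = v N)"
proof
  assume eq: "fib_seq d u = fib_seq d v"
  show "\<forall>N\<ge>d. u N = v N"
  proof (intro allI impI)
    fix N assume "N \<ge> d"
    then have "fib N (u N) = fib N (v N)" using fun_cong[OF eq, of N] by (simp add: fib_seq_def)
    then show "u N = v N" using assms[OF \<open>N \<ge> d\<close>] by (simp add: fib_inj)
  qed
qed (auto simp: fib_seq_def intro!: restrict_ext)

lemma fib_seq_ops:
  assumes "stable_seq d u" "stable_seq d v"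
  shows "fib_seq d u \<otimes>\<^bsub>A_alg d\<^esub> fib_seq d v = fib_seq d (\<lambda>N. u N * v N)"
    and "fib_seq d u \<oplus>\<^bsub>A_alg d\<^esub> fib_seq d v = fib_seq d (\<lambda>N. u N + v N)"
  using stable_seqD(1)[OF assms(1)] stable_seqD(1)[OF assms(2)]
  by (simp_all add: A_alg_def fib_seq_def fib_ops cong: restrict_cong)

lemma fib_seq_scale: "stable_seq d u \<Longrightarrow> c \<odot>\<^bsub>A_alg d\<^esub> fib_seq d u = fib_seq d (\<lambda>N. scal c * u N)"
  using stable_seqD(1)[of d u] by (simp add: A_alg_def fib_seq_def fib_scale cong: restrict_cong)

lemma fib_seq_one: "\<one>\<^bsub>A_alg d\<^esub> = fib_seq d (\<lambda>N. 1)" and fib_seq_zero: "\<zero>\<^bsub>A_alg d\<^esub> = fib_seq d (\<lambda>N. 0)"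
  by (simp_all add: A_alg_def fib_seq_def fib_0 fib_1)

lemma add_inv_fib_seq:
  assumes u: "stable_seq d u"
  shows "m_inv (add_monoid (A_alg d)) (fib_seq d u) = fib_seq d (\<lambda>N. scal (-1) * u N)"
  unfolding m_inv_def
proof (rule the_equality)
  have neg: "scal (-1) * u N = - u N" for N by (simp add: env.scale_minus_left[of 1, simplified])
  note su = stable_seq_scale[OF u, of "-1"]
  show "fib_seq d (\<lambda>N. scal (-1) * u N) \<in> carrier (add_monoid (A_alg d)) \<and>
     fib_seq d u \<otimes>\<^bsub>add_monoid (A_alg d)\<^esub> fib_seq d (\<lambda>N. scal (-1) * u N) = \<one>\<^bsub>add_monoid (A_alg d)\<^esub> \<and>
     fib_seq d (\<lambda>N. scal (-1) * u N) \<otimes>\<^bsub>add_monoid (A_alg d)\<^esub> fib_seq d u = \<one>\<^bsub>add_monoid (A_alg d)\<^esub>"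
    using fib_seq_carrier[OF su] fib_seq_ops(2)[OF u su] fib_seq_ops(2)[OF su u] by (simp add: fib_seq_zero neg)
  fix b assume b: "b \<in> carrier (add_monoid (A_alg d)) \<and>
     fib_seq d u \<otimes>\<^bsub>add_monoid (A_alg d)\<^esub> b = \<one>\<^bsub>add_monoid (A_alg d)\<^esub> \<and>
     b \<otimes>\<^bsub>add_monoid (A_alg d)\<^esub> fib_seq d u = \<one>\<^bsub>add_monoid (A_alg d)\<^esub>"
  then have b1: "b \<in> (\<Pi>\<^sub>E N\<in>{d..}. A_fin d N)" and b2: "fib_seq d u \<oplus>\<^bsub>A_alg d\<^esub> b = \<zero>\<^bsub>A_alg d\<^esub>"
    by (auto simp: A_alg_def)
  \<comment> \<open>The competing inverse \<open>b\<close> need not come from a stable sequence. It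
    is determined in \<open>Ugl N\<close> at each level from \<open>d\<close> on and by
    extensionality below.\<close>
  have "b N = fib_seq d (\<lambda>N. scal (-1) * u N) N" for N
  proof (cases "N \<ge> d")
    case True
    then have "b N \<in> carrier (Ugl N)" using b1 by (auto simp: A_fin_def PiE_def Pi_def)
    then obtain v where v: "v \<in> Ualg N" "b N = fib N v" by (rule carrier_fibE)
    have "fib N (u N) \<oplus>\<^bsub>Ugl N\<^esub> b N = \<zero>\<^bsub>Ugl N\<^esub>"
      using fun_cong[OF b2, of N] True by (simp add: A_alg_def fib_seq_def)
    then have "u N + v = 0" using v stable_seqD(1)[OF u True] by (simp add: fib_ops fib_0 fib_inj Ualg_add)
    then show ?thesis using True v by (simp add: fib_seq_def neg add_eq_0_iff)
  next
    case False
    then show ?thesis using b1 by (auto simp: fib_seq_def PiE_def extensional_def)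
  qed
  then show "b = fib_seq d (\<lambda>N. scal (-1) * u N)" by auto
qed

text \<open>Finite sums in \<open>A_alg\<close> are evaluated without knowing that it is an abelian group.\<close>

lemma finsum_fib_seq:
  assumes "finite I" and u: "\<And>i. i \<in> I \<Longrightarrow> stable_seq d (u i)"
  shows "(\<Oplus>\<^bsub>A_alg d\<^esub>i\<in>I. fib_seq d (u i)) = fib_seq d (\<lambda>N. \<Sum>i\<in>I. u i N)"
proof -
  define A where "A = (A_alg d :: (complex, nat \<Rightarrow> 'w matr falg set) module)"
  define D h e where "D = carrier (add_monoid A)"
    and "h = (\<otimes>\<^bsub>add_monoid A\<^esub>) \<circ> (\<lambda>i. fib_seq d (u i))" and "e = \<one>\<^bsub>add_monoid A\<^esub>"
  have e: "e = fib_seq d (\<lambda>N. 0)" by (simp add: e_def fib_seq_zero A_def)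
  have h: "h i (fib_seq d (\<lambda>N. \<Sum>i\<in>S. u i N)) = fib_seq d (\<lambda>N. u i N + (\<Sum>i\<in>S. u i N))" if "insert i S \<subseteq> I" for i S
    using that u by (simp add: h_def fib_seq_ops stable_seq_sum subset_iff A_def)
  have "(\<Oplus>\<^bsub>A_alg d\<^esub>i\<in>I. fib_seq d (u i)) = foldD D h e I"
    using assms(1) by (simp add: finsum_def finprod_def D_def h_def e_def A_def)
  also have "\<dots> = fib_seq d (\<lambda>N. \<Sum>i\<in>I. u i N)"
    unfolding foldD_def
  proof (rule the_equality)
    have "(S, fib_seq d (\<lambda>N. \<Sum>i\<in>S. u i N)) \<in> foldSetD D h e" if "finite S" "S \<subseteq> I" for S
      using that
    proof (induction S rule: finite_induct)
      case empty
      then show ?case using fib_seq_carrier[OF stable_seq_zero] by (auto simp: e D_def A_def intro: foldSetD.emptyI)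
    next
      case (insert i S)
      have "stable_seq d (\<lambda>N. \<Sum>i\<in>insert i S. u i N)" using insert u by (intro stable_seq_sum) auto
      then have "h i (fib_seq d (\<lambda>N. \<Sum>i\<in>S. u i N)) \<in> D"
        using fib_seq_carrier insert by (simp add: h D_def A_def)
      then have "(insert i S, h i (fib_seq d (\<lambda>N. \<Sum>i\<in>S. u i N))) \<in> foldSetD D h e"
        using insert by (intro foldSetD.insertI) auto
      then show ?case using insert by (simp add: h)
    qed
    then show "(I, fib_seq d (\<lambda>N. \<Sum>i\<in>I. u i N)) \<in> foldSetD D h e" using assms(1) by blast
  next
    fix x assume "(I, x) \<in> foldSetD D h e"
    moreover have "S \<subseteq> I \<Longrightarrow> x = fib_seq d (\<lambda>N. \<Sum>i\<in>S. u i N)" if "(S, x) \<in> foldSetD D h e" for S x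
      using that
    proof (induction rule: foldSetD.induct)
      case emptyI
      then show ?case by (simp add: e)
    next
      case (insertI i A y)
      then have "finite A" by (auto dest: foldSetD_imp_finite)
      then show ?case using insertI by (simp add: h)
    qed
    ultimately show "x = fib_seq d (\<lambda>N. \<Sum>i\<in>I. u i N)" by blast
  qed
  finally show ?thesis .
qed

lemma lin_comb_fib_seq:
  assumes "\<And>i. i \<in> keys c \<Longrightarrow> f i = fib_seq d (u i)" "\<And>i. i \<in> keys c \<Longrightarrow> stable_seq d (u i)"
  shows "lin_comb (A_alg d) f c = fib_seq d (\<lambda>N. \<Sum>i\<in>keys c. scal (lookup c i) * u i N)"
proof -
  let ?g = "\<lambda>i. lookup c i \<odot>\<^bsub>A_alg d\<^esub> f i"
  let ?u = "\<lambda>i N. scal (lookup c i) * u i N"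
  have g: "?g i = fib_seq d (?u i)" if "i \<in> keys c" for i
    using assms[OF that] by (simp add: fib_seq_scale)
  have fold_cong: "foldD D h e S = foldD D h' e S" if "\<And>i. i \<in> S \<Longrightarrow> h i = h' i" for D :: "'x set" and h h' e and S :: "'b set"
  proof -
    have "(A, x) \<in> foldSetD D h e \<Longrightarrow> A \<subseteq> S \<Longrightarrow> (A, x) \<in> foldSetD D h' e" if "\<And>i. i \<in> S \<Longrightarrow> h i = h' i" for A x h h'
    proof (induction rule: foldSetD.induct)
      case (insertI i A y)
      then have "h i = h' i" using that by auto
      then show ?case using insertI foldSetD.insertI[of i A h' y D e] by simp
    qed (auto intro: foldSetD.emptyI)
    from this[of h h'] this[of h' h] that have "(S, x) \<in> foldSetD D h e \<longleftrightarrow> (S, x) \<in> foldSetD D h' e" for x by auto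
    then show ?thesis by (simp add: foldD_def)
  qed
  have "lin_comb (A_alg d) f c = (\<Oplus>\<^bsub>A_alg d\<^esub>i\<in>keys c. fib_seq d (?u i))"
    unfolding lin_comb_def finsum_def finprod_def by (simp add: g cong: fold_cong)
  also have "\<dots> = fib_seq d (\<lambda>N. \<Sum>i\<in>keys c. ?u i N)"
    using assms(2) by (intro finsum_fib_seq) (auto intro: stable_seq_scale)
  finally show ?thesis .
qed

section \<open>Monomials in the generators\<close>

abbreviation Tm :: "complex \<Rightarrow> nat \<Rightarrow> (nat \<times> nat \<times> 'w list) list \<Rightarrow> 'w env" where
  "Tm s N ts \<equiv> prod_list (map (TTs s N) ts)"

lemma triples_mono: "triples d X \<subseteq> triples d UNIV"
  by (auto simp: triples_def words_def)

lemma t_elem_eq_fib_seq: "t \<in> triples d UNIV \<Longrightarrow> t_elem d s t = fib_seq d (\<lambda>N. TTs s N t)"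
  by (auto simp: t_elem_def fib_seq_def triples_def words_def t_fin_eq_fib intro!: restrict_ext)

lemma stable_seq_Tm: "set ts \<subseteq> triples d UNIV \<Longrightarrow> stable_seq d (\<lambda>N. Tm s N ts)"
  by (induction ts) (simp_all add: stable_seq_one stable_seq_mult stable_seq_TTs)

lemma t_monomial_eq_fib_seq: "set ts \<subseteq> triples d UNIV \<Longrightarrow> t_monomial d s ts = fib_seq d (\<lambda>N. Tm s N ts)"
  by (induction ts)
    (simp_all add: t_monomial_def fib_seq_one t_elem_eq_fib_seq fib_seq_ops stable_seq_TTs stable_seq_Tm)

text \<open>The increments of both sequences from \<open>M\<close> to \<open>Suc M\<close> lie in
  the left ideal, hence so does \<open>u M - v M\<close>. This is an element of the smaller algebra,
  which meets the ideal in 0.\<close>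

lemma stable_seq_eq_below:
  assumes "stable_seq d u" "stable_seq d v" "M \<ge> d" "u (Suc M) = v (Suc M)"
  shows "u M = v M"
proof -
  have "u M - v M = (v (Suc M) - v M) - (u (Suc M) - u M)" using assms(4) by simp
  also have "\<dots> \<in> Iplus (Suc M)" by (rule Iplus_diff[OF stable_seqD(3)[OF assms(2,3)] stable_seqD(3)[OF assms(1,3)]])
  finally have "u M - v M = 0"
    using stable_seqD(1) assms by (intro Iplus_Ualg_trivial) (auto intro: Ualg_diff)
  then show ?thesis by simp
qed

end

section \<open>Quadratic relations at a fixed level\<close>

abbreviation ee :: "nat \<Rightarrow> nat \<Rightarrow> nat \<Rightarrow> 'w::nonunital_complex_algebra list \<Rightarrow> 'w env" where
  "ee N i j xs \<equiv> TT 0 N i j xs"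

text \<open>The commutator of \<open>e\<^sub>i\<^sub>j(x)\<close> and \<open>e\<^sub>k\<^sub>l(y)\<close> is a combination of products of the shape
  \<open>e\<^sub>k\<^sub>j(u) e\<^sub>i\<^sub>l(v)\<close> etc. with coefficients not depending on the indices.  This uniformity is what the
  induction needs, since the indices are summed over; so the spans are taken in a space of families.\<close>

inductive comm_fam1 :: "nat \<Rightarrow> nat \<Rightarrow> (nat \<Rightarrow> nat \<Rightarrow> nat \<Rightarrow> nat \<Rightarrow> 'w::nonunital_complex_algebra env) \<Rightarrow> bool" for N K :: nat where
  basic1: "length u + length v \<le> K \<Longrightarrow> comm_fam1 N K (\<lambda>i j k l. scal c * (ee N k j u * ee N i l v))"
| add1: "comm_fam1 N K F \<Longrightarrow> comm_fam1 N K G \<Longrightarrow> comm_fam1 N K (\<lambda>i j k l. F i j k l + G i j k l)"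
| cong1: "comm_fam1 N K F \<Longrightarrow>
    (\<And>i j k l. i \<in> {1..N} \<Longrightarrow> j \<in> {1..N} \<Longrightarrow> k \<in> {1..N} \<Longrightarrow> l \<in> {1..N} \<Longrightarrow> F i j k l = G i j k l) \<Longrightarrow> comm_fam1 N K G"

inductive comm_fam :: "nat \<Rightarrow> nat \<Rightarrow> (nat \<Rightarrow> nat \<Rightarrow> nat \<Rightarrow> nat \<Rightarrow> 'w::nonunital_complex_algebra env) \<Rightarrow> bool" for N K :: nat where
  kj_il: "length u + length v \<le> K \<Longrightarrow> comm_fam N K (\<lambda>i j k l. scal c * (ee N k j u * ee N i l v))"
| il_kj: "length u + length v \<le> K \<Longrightarrow> comm_fam N K (\<lambda>i j k l. scal c * (ee N i l u * ee N k j v))"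
| ij_kl: "length u + length v \<le> K \<Longrightarrow> comm_fam N K (\<lambda>i j k l. scal c * (ee N i j u * ee N k l v))"
| kl_ij: "length u + length v \<le> K \<Longrightarrow> comm_fam N K (\<lambda>i j k l. scal c * (ee N k l u * ee N i j v))"
| add: "comm_fam N K F \<Longrightarrow> comm_fam N K G \<Longrightarrow> comm_fam N K (\<lambda>i j k l. F i j k l + G i j k l)"
| cong: "comm_fam N K F \<Longrightarrow>
    (\<And>i j k l. i \<in> {1..N} \<Longrightarrow> j \<in> {1..N} \<Longrightarrow> k \<in> {1..N} \<Longrightarrow> l \<in> {1..N} \<Longrightarrow> F i j k l = G i j k l) \<Longrightarrow> comm_fam N K G"

lemma comm_fam1_zero: "(\<And>i j k l. i \<in> {1..N} \<Longrightarrow> j \<in> {1..N} \<Longrightarrow> k \<in> {1..N} \<Longrightarrow> l \<in> {1..N} \<Longrightarrow> F i j k l = 0) \<Longrightarrow> comm_fam1 N K F"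
  by (rule cong1[OF basic1[where u="[]" and v="[]" and c=0]]) auto

lemma comm_fam_zero: "(\<And>i j k l. i \<in> {1..N} \<Longrightarrow> j \<in> {1..N} \<Longrightarrow> k \<in> {1..N} \<Longrightarrow> l \<in> {1..N} \<Longrightarrow> F i j k l = 0) \<Longrightarrow> comm_fam N K F"
  by (rule comm_fam.cong[OF kj_il[where u="[]" and v="[]" and c=0]]) auto

lemma scal_scal: "scal b * (scal c * u) = scal (b * c) * u"
  by (simp only: scal_mult mult.assoc)

lemma comm_fam_scale: "comm_fam N K F \<Longrightarrow> comm_fam N K (\<lambda>i j k l. scal b * F i j k l)"
proof (induction rule: comm_fam.induct)
  case (add F G)
  then show ?case using comm_fam.add[OF add.IH] by (simp add: distrib_left)
next
  case (cong F G)
  show ?case by (rule comm_fam.cong[OF cong.IH]) (simp add: cong)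
qed (simp_all only: scal_scal, (rule comm_fam.intros(1-4); assumption)+)

lemma comm_fam_mono:
  assumes "comm_fam N K F" "K \<le> K'"
  shows "comm_fam N K' F"
  using assms(1)
proof (induction rule: comm_fam.induct)
  case (add F G)
  then show ?case by (intro comm_fam.add)
next
  case (cong F G)
  show ?case by (rule comm_fam.cong[OF cong.IH]) (simp add: cong)
qed (rule comm_fam.intros(1-4); use assms(2) in simp)+

lemma comm_fam_swap_rows: "comm_fam N K F \<Longrightarrow> comm_fam N K (\<lambda>i j k l. F k j i l)"
proof (induction rule: comm_fam.induct)
  case (add F G)
  then show ?case by (intro comm_fam.add)
next
  case (cong F G)
  show ?case by (rule comm_fam.cong[OF cong.IH]) (simp add: cong)
qed (rule comm_fam.intros(1-4); assumption)+

lemma comm_fam_swap_columns: "comm_fam N K F \<Longrightarrow> comm_fam N K (\<lambda>i j k l. F i l k j)"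
proof (induction rule: comm_fam.induct)
  case (add F G)
  then show ?case by (intro comm_fam.add)
next
  case (cong F G)
  show ?case by (rule comm_fam.cong[OF cong.IH]) (simp add: cong)
qed (rule comm_fam.intros(1-4); assumption)+

lemma ee_append:
  assumes "i \<in> {1..N}" "l \<in> {1..N}"
  shows "(\<Sum>a=1..N. ee N i a x * ee N a l v) = ee N i l (x @ v)"
  using assms(1)
proof (induction x arbitrary: i)
  case Nil
  then show ?case by (simp add: if_distrib[of "\<lambda>z. z * _"] cong: if_cong)
next
  case (Cons z x)
  have "(\<Sum>a=1..N. ee N i a (z # x) * ee N a l v) = (\<Sum>a=1..N. \<Sum>b=1..N. EE i b z * (ee N b a x * ee N a l v))"
    by (intro sum.cong refl) (simp add: TT_0_Cons sum_distrib_right mult.assoc)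
  also have "\<dots> = (\<Sum>b=1..N. EE i b z * ee N b l (x @ v))"
    by (subst sum.swap) (intro sum.cong refl, simp only: sum_distrib_left[symmetric] Cons.IH)
  finally show ?case using assms(2) by (simp add: TT_0_Cons)
qed

text \<open>The base case, one word being the single letter \<open>z\<close>, which is bracketed
  with the letters of \<open>y\<close> in turn. Only products of the one shape in
  \<open>comm_fam1\<close> appear, and their total length is one less than that of the
  commutator.\<close>

lemma comm_fam1_generator:
  "comm_fam1 N (length y) (\<lambda>i j k l. EE i j z * ee N k l y - ee N k l y * EE i j z)"
proof (induction y)
  case Nil
  show ?case by (rule comm_fam1_zero) simp
next
  case (Cons y ys)
  \<comment> \<open>Prefixing \<open>EE k b y\<close> and summing over \<open>b\<close> preserves
    the shape, because the row index \<open>k\<close> sits in the left factor, whose word grows by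
    \<open>y\<close>.\<close>
  have lift: "comm_fam1 N (Suc K) (\<lambda>i j k l. \<Sum>b=1..N. EE k b y * F i j b l)" if "comm_fam1 N K F" for K and F :: "nat \<Rightarrow> nat \<Rightarrow> nat \<Rightarrow> nat \<Rightarrow> 'a env"
    using that
  proof (induction rule: comm_fam1.induct)
    case (basic1 u v c)
    show ?case
      by (rule cong1[OF comm_fam1.basic1[of "y # u" v _ _ c]])
        (use basic1 in \<open>simp_all add: TT_0_Cons scal_pull sum_distrib_left sum_distrib_right mult.assoc\<close>)
  next
    case (add1 F G)
    show ?case by (rule cong1[OF comm_fam1.add1[OF add1.IH]]) (simp add: distrib_left sum.distrib)
  next
    case (cong1 F G)
    show ?case by (rule comm_fam1.cong1[OF cong1.IH]) (simp add: cong1)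
  qed
  \<comment> \<open>The boundary term with the delta of \<open>k\<close> and \<open>j\<close> fits
    the shape as a product with the empty word.\<close>
  have 1: "comm_fam1 N (Suc (length ys)) (\<lambda>i j k l. scal 1 * (ee N k j [] * ee N i l ((z * y) # ys)))"
    "comm_fam1 N (Suc (length ys)) (\<lambda>i j k l. scal (-1) * (ee N k j [y * z] * ee N i l ys))"
    by (rule basic1; simp)+
  have neg: "scal (-1) * u = - u" for u :: "'a env" by (simp add: env.scale_minus_left[of 1, simplified])
  show ?case unfolding length_Cons
  proof (rule cong1[OF add1[OF add1[OF 1] lift[OF Cons.IH]]])
    fix i j k l assume ind: "i \<in> {1..N}" "j \<in> {1..N}" "k \<in> {1..N}" "l \<in> {1..N}"
    have c: "EE i j z * (EE k b y * ee N b l ys) - EE k b y * ee N b l ys * EE i j z =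
      (if k = j then EE i b (z * y) * ee N b l ys else 0) - (if i = b then EE k j (y * z) * ee N b l ys else 0) +
      EE k b y * (EE i j z * ee N b l ys - ee N b l ys * EE i j z)" for b
    proof -
      have "EE i j z * EE k b y = EE k b y * EE i j z + ((if k = j then EE i b (z * y) else 0) - (if i = b then EE k j (y * z) else 0))"
        using EE_bracket[of i j z k b y] by (simp add: algebra_simps)
      then have "EE i j z * EE k b y * ee N b l ys = EE k b y * EE i j z * ee N b l ys +
         ((if k = j then EE i b (z * y) else 0) * ee N b l ys - (if i = b then EE k j (y * z) else 0) * ee N b l ys)"
        by (simp only: distrib_right left_diff_distrib)
      then show ?thesis by (simp add: mult.assoc right_diff_distrib if_distrib[of "\<lambda>u. u * _"] cong: if_cong)
    qed
    have "EE i j z * ee N k l (y # ys) - ee N k l (y # ys) * EE i j z =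
       (\<Sum>b=1..N. EE i j z * (EE k b y * ee N b l ys) - EE k b y * ee N b l ys * EE i j z)"
      using ind by (simp add: TT_0_Cons sum_distrib_left sum_distrib_right sum_subtractf)
    also have "\<dots> = (if k = j then ee N i l ((z * y) # ys) else 0) - EE k j (y * z) * ee N i l ys +
       (\<Sum>b=1..N. EE k b y * (EE i j z * ee N b l ys - ee N b l ys * EE i j z))"
      unfolding c sum.distrib sum_subtractf using ind by (simp add: TT_0_Cons)
    finally show "scal 1 * (ee N k j [] * ee N i l ((z * y) # ys)) + scal (-1) * (ee N k j [y * z] * ee N i l ys) +
       (\<Sum>b=1..N. EE k b y * (EE i j z * ee N b l ys - ee N b l ys * EE i j z)) =
       EE i j z * ee N k l (y # ys) - ee N k l (y # ys) * EE i j z"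
      by (simp add: neg)
  qed
qed

text \<open>The two claims feed each other. Peeling a letter off a commutator creates products in
  which the two factors sharing the summation index \<open>a\<close> are separated by a third. The
  second claim exchanges the first two factors, after which the words can be joined; the commutator
  this costs falls under smaller values of \<open>K\<close>.\<close>

lemma comm_fam_main:
  fixes N :: nat
  shows "(\<forall>x y. length x + length y \<le> Suc K \<longrightarrow>
        comm_fam N K (\<lambda>i j k l. ee N i j x * ee N k l y - ee N k l y * ee N i j (x :: 'w::nonunital_complex_algebra list)))
    \<and> (\<forall>x u v. length x + length u + length v \<le> K \<longrightarrow>
        comm_fam N K (\<lambda>i j k l. \<Sum>a=1..N. ee N i a x * ee N k j u * ee N a l (v :: 'w list)))"
proof (induction K rule: less_induct)
  case (less K)
  let ?C = "\<lambda>x y i j k l. ee N i j x * ee N k l y - ee N k l y * ee N i j x"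
  let ?D = "\<lambda>x u v i j k l. \<Sum>a=1..N. ee N i a x * ee N k j u * ee N a l v"
  have IHC: "comm_fam N K' (?C x y)" if "K' < K" "length x + length y \<le> Suc K'" for K' and x y :: "'w list"
    using less that by blast
  have IHD: "comm_fam N K (?D x u v)" if "length x + length u + length v < K" for x u v :: "'w list"
    using less that by (blast intro: comm_fam_mono less_imp_le)
  have D: "comm_fam N K (?D x u v)" if len: "length x + length u + length v \<le> K" for x u v :: "'w list"
  proof -
    have 1: "comm_fam N K (\<lambda>i j k l. scal 1 * (ee N k j u * ee N i l (x @ v)))"
      using len by (intro kj_il) simp
    \<comment> \<open>Attaching \<open>ee N a l v\<close> joins two words if the factor ending in
      \<open>a\<close> is adjacent, and otherwise yields a separated product of smaller total
      length.\<close>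
    have map: "comm_fam N K (\<lambda>i j k l. \<Sum>a=1..N. F i a k j * ee N a l v)"
      if "comm_fam N K' F" "K' + length v < K" for K' and F :: "nat \<Rightarrow> nat \<Rightarrow> nat \<Rightarrow> nat \<Rightarrow> 'w env"
      using that
    proof (induction rule: comm_fam.induct)
      case (kj_il p q c)
      have "comm_fam N K (?D p q v)" using kj_il by (intro IHD) simp
      from comm_fam_scale[OF comm_fam_swap_rows[OF this], of c] show ?case
        by (rule comm_fam.cong) (simp add: sum_distrib_left mult.assoc)
    next
      case (il_kj p q c)
      then have "comm_fam N K (\<lambda>i j k l. scal c * (ee N i j p * ee N k l (q @ v)))" by (intro ij_kl) simp
      then show ?case by (rule comm_fam.cong) (simp add: sum_distrib_left mult.assoc flip: ee_append)
    next
      case (ij_kl p q c)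
      have "comm_fam N K (?D p q v)" using ij_kl by (intro IHD) simp
      from comm_fam_scale[OF this, of c] show ?case
        by (rule comm_fam.cong) (simp add: sum_distrib_left mult.assoc)
    next
      case (kl_ij p q c)
      then have "comm_fam N K (\<lambda>i j k l. scal c * (ee N k j p * ee N i l (q @ v)))" by (intro comm_fam.kj_il) simp
      then show ?case by (rule comm_fam.cong) (simp add: sum_distrib_left mult.assoc flip: ee_append)
    next
      case (add F G)
      show ?case by (rule comm_fam.cong[OF comm_fam.add[OF add.IH]]) (use add.prems in \<open>simp_all add: distrib_right sum.distrib\<close>)
    next
      case (cong F G)
      show ?case by (rule comm_fam.cong[OF cong.IH]) (use cong in simp_all)
    qed
    have 2: "comm_fam N K (\<lambda>i j k l. \<Sum>a=1..N. ?C x u i a k j * ee N a l v)"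
    proof (cases "length x + length u")
      case 0
      then show ?thesis by (intro comm_fam_zero) simp
    next
      case (Suc m)
      then show ?thesis using len by (intro map[of m] IHC) auto
    qed
    show ?thesis
    proof (rule comm_fam.cong[OF comm_fam.add[OF 1 2]])
      fix i j k l assume ind: "i \<in> {1..N}" "j \<in> {1..N}" "k \<in> {1..N}" "l \<in> {1..N}"
      have "scal 1 * (ee N k j u * ee N i l (x @ v)) = (\<Sum>a=1..N. ee N k j u * (ee N i a x * ee N a l v))"
        using ind by (simp add: sum_distrib_left flip: ee_append)
      then show "scal 1 * (ee N k j u * ee N i l (x @ v)) + (\<Sum>a=1..N. ?C x u i a k j * ee N a l v) = ?D x u v i j k l"
        by (simp add: mult.assoc left_diff_distrib flip: sum.distrib)
    qed
  qed
  have C: "comm_fam N K (?C x y)" if len: "length x + length y \<le> Suc K" for x y :: "'w list"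
  proof (cases "x = [] \<or> y = []")
    case True
    then show ?thesis by (intro comm_fam_zero) auto
  next
    case False
    then obtain z x' where x: "x = z # x'" by (cases x) auto
    obtain m where m: "K = Suc m" using False len x by (cases K) auto
    have map1: "comm_fam N K (\<lambda>i j k l. \<Sum>a=1..N. EE i a z * F a j k l)"
      if "comm_fam N m F" for F :: "nat \<Rightarrow> nat \<Rightarrow> nat \<Rightarrow> nat \<Rightarrow> 'w env"
      using that
    proof (induction rule: comm_fam.induct)
      case (kj_il p q c)
      have "comm_fam N K (?D [z] p q)" using kj_il m by (intro D) simp
      from comm_fam_scale[OF this, of c] show ?case
        by (rule comm_fam.cong) (simp add: sum_distrib_left mult.assoc scal_pull)
    next
      case (il_kj p q c)
      then have "comm_fam N K (\<lambda>i j k l. scal c * (ee N i l (z # p) * ee N k j q))" using m by (intro comm_fam.il_kj) simp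
      then show ?case by (rule comm_fam.cong) (simp add: TT_0_Cons sum_distrib_left sum_distrib_right mult.assoc scal_pull)
    next
      case (ij_kl p q c)
      then have "comm_fam N K (\<lambda>i j k l. scal c * (ee N i j (z # p) * ee N k l q))" using m by (intro comm_fam.ij_kl) simp
      then show ?case by (rule comm_fam.cong) (simp add: TT_0_Cons sum_distrib_left sum_distrib_right mult.assoc scal_pull)
    next
      case (kl_ij p q c)
      have "comm_fam N K (?D [z] p q)" using kl_ij m by (intro D) simp
      from comm_fam_scale[OF comm_fam_swap_columns[OF this], of c] show ?case
        by (rule comm_fam.cong) (simp add: sum_distrib_left mult.assoc scal_pull)
    next
      case (add F G)
      show ?case by (rule comm_fam.cong[OF comm_fam.add[OF add.IH]]) (simp_all add: distrib_left sum.distrib)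
    next
      case (cong F G)
      show ?case by (rule comm_fam.cong[OF cong.IH]) (use cong in simp_all)
    qed
    have map2: "comm_fam N K (\<lambda>i j k l. \<Sum>a=1..N. F i a k l * ee N a j x')"
      if "comm_fam1 N (length y) F" for F :: "nat \<Rightarrow> nat \<Rightarrow> nat \<Rightarrow> nat \<Rightarrow> 'w env"
      using that
    proof (induction rule: comm_fam1.induct)
      case (basic1 p q c)
      have "comm_fam N K (?D p q x')" using basic1 len x by (intro D) simp
      from comm_fam_scale[OF comm_fam_swap_columns[OF comm_fam_swap_rows[OF this]], of c] show ?case
        by (rule comm_fam.cong) (simp add: sum_distrib_left mult.assoc)
    next
      case (add1 F G)
      show ?case by (rule comm_fam.cong[OF comm_fam.add[OF add1.IH]]) (simp_all add: distrib_right sum.distrib)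
    next
      case (cong1 F G)
      show ?case by (rule comm_fam.cong[OF cong1.IH]) (use cong1 in simp_all)
    qed
    \<comment> \<open>Leibniz rule for \<open>x = z # x'\<close>: the commutator is taken with the
      rest \<open>x'\<close> here and with the letter \<open>z\<close> in the second family.\<close>
    have 1: "comm_fam N K (\<lambda>i j k l. \<Sum>a=1..N. EE i a z * ?C x' y a j k l)"
      using len x m by (intro map1 IHC) auto
    have 2: "comm_fam N K (\<lambda>i j k l. \<Sum>a=1..N. (EE i a z * ee N k l y - ee N k l y * EE i a z) * ee N a j x')"
      by (intro map2 comm_fam1_generator)
    show ?thesis
    proof (rule comm_fam.cong[OF comm_fam.add[OF 1 2]])
      fix i j k l assume ind: "i \<in> {1..N}" "j \<in> {1..N}" "k \<in> {1..N}" "l \<in> {1..N}"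
      have "(\<Sum>a=1..N. EE i a z * ?C x' y a j k l) + (\<Sum>a=1..N. (EE i a z * ee N k l y - ee N k l y * EE i a z) * ee N a j x')
        = (\<Sum>a=1..N. EE i a z * ee N a j x' * ee N k l y - ee N k l y * (EE i a z * ee N a j x'))"
        by (simp add: left_diff_distrib right_diff_distrib mult.assoc flip: sum.distrib)
      also have "\<dots> = ?C x y i j k l"
        using ind by (simp add: x TT_0_Cons sum_subtractf sum_distrib_left sum_distrib_right)
      finally show "(\<Sum>a=1..N. EE i a z * ?C x' y a j k l) +
          (\<Sum>a=1..N. (EE i a z * ee N k l y - ee N k l y * EE i a z) * ee N a j x') = ?C x y i j k l" .
    qed
  qed
  show ?case using C D by blast
qed

section \<open>Spanning at a fixed level\<close>

lemma TT_add_hd: "TT c N i j ((x + y) # vs) = TT c N i j (x # vs) + TT c N i j (y # vs)"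
  by (induction vs arbitrary: x y) (simp_all add: EE_add distrib_right distrib_left sum.distrib)

lemma TT_scale_hd: "TT c N i j (scaleC b x # vs) = scal b * TT c N i j (x # vs)"
proof (induction vs arbitrary: x)
  case (Cons v vs)
  have "scal c * (scal b * u) = scal b * (scal c * u)" for u :: "'a env"
    by (simp add: scal_scal mult.commute)
  then show ?case using Cons
    by (simp add: EE_scale scaleC_mult_left distrib_left sum_distrib_left mult.assoc)
qed (simp add: EE_scale)

lemma TT_add_letter: "TT c N i j (us @ (x + y) # vs) = TT c N i j (us @ x # vs) + TT c N i j (us @ y # vs)"
proof (cases "us = []")
  case False
  then show ?thesis
  proof (induction us arbitrary: i rule: cons_induct)
    case (single z)
    then show ?case by (simp add: TT_add_hd distrib_left sum.distrib)
  next
    case (cons z z' us)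
    then show ?case by (simp add: distrib_left sum.distrib)
  qed
qed (simp add: TT_add_hd)

lemma TT_scale_letter: "TT c N i j (us @ scaleC b x # vs) = scal b * TT c N i j (us @ x # vs)"
proof (cases "us = []")
  case False
  have [simp]: "scal c * (scal b * u) = scal b * (scal c * u)" for u :: "'a env"
    by (simp add: scal_scal mult.commute)
  show ?thesis using False
  proof (induction us arbitrary: i rule: cons_induct)
    case (single z)
    then show ?case by (simp add: TT_scale_hd distrib_left sum_distrib_left scal_pull scaleC_mult_right)
  next
    case (cons z z' us)
    then show ?case by (simp add: distrib_left sum_distrib_left scal_pull)
  qed
qed (simp add: TT_scale_hd)

text \<open>One list \<open>L\<close> has to serve all \<open>i\<close> and \<open>j\<close>, since
  the induction sums over the first index.\<close>

lemma TT_change_parameter: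
  assumes "xs \<noteq> []"
  shows "\<exists>L. (\<forall>(k, v)\<in>set L. v \<noteq> [] \<and> length v \<le> length xs) \<and>
    (\<forall>i j. TT c N i j xs = (\<Sum>(k, v)\<leftarrow>L. scal k * TT c' N i j (v :: 'w::nonunital_complex_algebra list)))"
  using assms
proof (induction xs rule: cons_induct)
  case (single x)
  show ?case by (rule exI[of _ "[(1, [x])]"]) simp
next
  case (cons x y w)
  obtain L1 where "(\<forall>(k, v)\<in>set L1. v \<noteq> [] \<and> length v \<le> length (y # w)) \<and>
      (\<forall>i j. TT c N i j (y # w) = (\<Sum>(k, v)\<leftarrow>L1. scal k * TT c' N i j v))"
    using cons.IH(1) by (rule exE)
  then have L1: "\<forall>(k, v)\<in>set L1. v \<noteq> [] \<and> length v \<le> length (y # w)"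
    "TT c N i j (y # w) = (\<Sum>(k, v)\<leftarrow>L1. scal k * TT c' N i j v)" for i j by - (erule conjunct1, drule conjunct2, drule spec, erule spec)
  obtain L2 where "(\<forall>(k, v)\<in>set L2. v \<noteq> [] \<and> length v \<le> length ((x * y) # w)) \<and>
      (\<forall>i j. TT c N i j ((x * y) # w) = (\<Sum>(k, v)\<leftarrow>L2. scal k * TT c' N i j v))"
    using cons.IH(2) by (rule exE)
  then have L2: "\<forall>(k, v)\<in>set L2. v \<noteq> [] \<and> length v \<le> length ((x * y) # w)"
    "TT c N i j ((x * y) # w) = (\<Sum>(k, v)\<leftarrow>L2. scal k * TT c' N i j v)" for i j by - (erule conjunct1, drule conjunct2, drule spec, erule spec)
  \<comment> \<open>By the recursion at \<open>c'\<close>, prefixing \<open>x\<close> to a term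
    turns it into the word \<open>x # v\<close> minus \<open>c'\<close> times its contraction; this
    gives \<open>A\<close> and \<open>B\<close>. The contraction term at \<open>c\<close> gives
    \<open>C\<close>.\<close>
  define A B C where "A = map (\<lambda>(k, v). (k, x # v)) L1"
    and "B = map (\<lambda>(k, v). (- c' * k, (x * hd v) # tl v)) L1" and "C = map (\<lambda>(k, v). (c * k, v)) L2"
  have C: "(\<Sum>(k, v)\<leftarrow>C. scal k * TT c' N i j v) = scal c * (\<Sum>(k, v)\<leftarrow>L2. scal k * TT c' N i j v)" for i j
    unfolding C_def by (induction L2) (auto simp: distrib_left scal_scal)
  have AB: "(\<Sum>(k, v)\<leftarrow>map (\<lambda>(k, v). (k, x # v)) L. scal k * TT c' N i j v) +
      (\<Sum>(k, v)\<leftarrow>map (\<lambda>(k, v). (- c' * k, (x * hd v) # tl v)) L. scal k * TT c' N i j v) =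
      (\<Sum>a=1..N. EE i a x * (\<Sum>(k, v)\<leftarrow>L. scal k * TT c' N a j v))"
    if "\<forall>(k, v)\<in>set L. v \<noteq> []" for L :: "(complex \<times> 'w list) list" and i j
    using that
  proof (induction L)
    case (Cons p L)
    obtain k h t where p: "p = (k, h # t)" using Cons.prems by (cases p; cases "snd p") auto
    have neg: "scal (- (c' * k)) * u = - (scal k * (scal c' * u))" for u :: "'w env"
      by (simp add: env.scale_minus_left scal_scal mult.commute)
    show ?case using Cons by (simp add: p neg distrib_left sum.distrib scal_pull sum_distrib_left[symmetric] scal_scal mult.commute[of k c'])
  qed simp
  show ?case
  proof (intro exI[of _ "A @ B @ C"] conjI allI)
    show "\<forall>(k, v)\<in>set (A @ B @ C). v \<noteq> [] \<and> length v \<le> length (x # y # w)"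
      using L1(1) L2(1) by (fastforce simp: A_def B_def C_def)
    fix i j
    have "\<forall>(k, v)\<in>set L1. v \<noteq> []" using L1(1) by auto
    from AB[OF this, of i j] show "TT c N i j (x # y # w) = (\<Sum>(k, v)\<leftarrow>A @ B @ C. scal k * TT c' N i j v)"
      using C[of i j] by (simp add: L1(2) L2(2) A_def B_def)
  qed
qed

section \<open>Filtered spans of products of generators\<close>

context algebra_basis
begin

abbreviation Tt :: "complex \<Rightarrow> nat \<Rightarrow> nat \<times> nat \<times> 'w list \<Rightarrow> 'w env" where
  "Tt c N \<equiv> \<lambda>(i, j, xs). TT c N i j xs"

abbreviation Tp :: "complex \<Rightarrow> nat \<Rightarrow> (nat \<times> nat \<times> 'w list) list \<Rightarrow> 'w env" where
  "Tp c N ts \<equiv> prod_list (map (Tt c N) ts)"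

abbreviation wt :: "nat \<times> nat \<times> 'w list \<Rightarrow> nat" where
  "wt t \<equiv> length (snd (snd t))"

abbreviation wts :: "(nat \<times> nat \<times> 'w list) list \<Rightarrow> nat" where
  "wts ts \<equiv> sum_list (map wt ts)"

definition Tspan :: "complex \<Rightarrow> nat \<Rightarrow> (nat \<times> nat \<times> 'w list) set \<Rightarrow> nat \<Rightarrow> 'w env set" where
  "Tspan c N T K = env.span {Tp c N ts | ts. set ts \<subseteq> T \<and> wts ts \<le> K}"

lemma Tspan_add: "u \<in> Tspan c N T K \<Longrightarrow> v \<in> Tspan c N T K \<Longrightarrow> u + v \<in> Tspan c N T K"
  and Tspan_scale: "u \<in> Tspan c N T K \<Longrightarrow> scal b * u \<in> Tspan c N T K"
  and Tspan_zero: "0 \<in> Tspan c N T K"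
  by (simp_all add: Tspan_def env.span_add env.span_scale env.span_zero)

lemma Tspan_base: "set ts \<subseteq> T \<Longrightarrow> wts ts \<le> K \<Longrightarrow> Tp c N ts \<in> Tspan c N T K"
  unfolding Tspan_def by (intro env.span_base) auto

lemma Tspan_mono: "T \<subseteq> T' \<Longrightarrow> K \<le> K' \<Longrightarrow> Tspan c N T K \<subseteq> Tspan c N T' K'"
  unfolding Tspan_def by (intro env.span_mono) fastforce

lemma Tspan_one: "1 \<in> Tspan c N T K"
  using Tspan_base[of "[]" T K c N] by simp

lemma Tspan_single: "t \<in> T \<Longrightarrow> wt t \<le> K \<Longrightarrow> Tt c N t \<in> Tspan c N T K"
  using Tspan_base[of "[t]" T K c N] by simp

lemma Tspan_mult:
  assumes "u \<in> Tspan c N T K" "v \<in> Tspan c N T L"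
  shows "u * v \<in> Tspan c N T (K + L)"
proof -
  have 1: "Tp c N ts * v \<in> Tspan c N T (K + L)"
    if ts: "set ts \<subseteq> T" "wts ts \<le> K" and v: "v \<in> Tspan c N T L" for ts v
    using v unfolding Tspan_def[of c N T L]
  proof (induction rule: env.span_induct_alt)
    case base
    then show ?case by (simp add: Tspan_zero)
  next
    case (step b x y)
    then obtain vs where vs: "set vs \<subseteq> T" "wts vs \<le> L" "x = Tp c N vs" by auto
    have "Tp c N ts * x \<in> Tspan c N T (K + L)"
      using Tspan_base[of "ts @ vs" T "K + L" c N] ts vs by simp
    then show ?case using step by (simp add: distrib_left scal_left_commute[of "prod_list _"] Tspan_add Tspan_scale)
  qed
  show ?thesis using assms(1) unfolding Tspan_def[of c N T K]
  proof (induction rule: env.span_induct_alt)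
    case base
    then show ?case by (simp add: Tspan_zero)
  next
    case (step b x y)
    then have "x * v \<in> Tspan c N T (K + L)" using 1 assms(2) by auto
    then show ?case using step by (simp add: distrib_right mult.assoc Tspan_add Tspan_scale)
  qed
qed

lemma Tspan_subset:
  assumes "\<And>t. t \<in> T \<Longrightarrow> Tt c N t \<in> Tspan c' N T' (wt t)"
  shows "Tspan c N T K \<subseteq> Tspan c' N T' K"
proof -
  have "Tp c N ts \<in> Tspan c' N T' (wts ts)" if "set ts \<subseteq> T" for ts
    using that
  proof (induction ts)
    case (Cons t ts)
    then show ?case using Tspan_mult[OF assms[of t], of "Tp c N ts" "wts ts"] by simp
  qed (simp add: Tspan_one)
  then have "Tp c N ts \<in> Tspan c' N T' K" if "set ts \<subseteq> T" "wts ts \<le> K" for ts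
    using that Tspan_mono[of T' T' "wts ts" K] by blast
  moreover have "env.subspace (Tspan c' N T' K)" by (simp add: Tspan_def env.subspace_span)
  ultimately show ?thesis unfolding Tspan_def[of c N T K] by (intro env.span_minimal) auto
qed

text \<open>The span is one of single generators, not of products: \<open>commutator_Tt\<close>
  expands both entries of a commutator bilinearly and then needs generators on both sides.\<close>

lemma Tt_change:
  assumes "t \<in> triples d UNIV"
  shows "Tt c N t \<in> env.span (Tt c' N ` {t' \<in> triples d UNIV. wt t' \<le> wt t})"
proof -
  obtain i j xs where t: "t = (i, j, xs)" by (cases t)
  have ij: "i \<in> {1..d}" "j \<in> {1..d}" "xs \<noteq> []" using assms by (auto simp: t triples_def words_def)
  obtain L where "(\<forall>(k, v)\<in>set L. v \<noteq> [] \<and> length v \<le> length xs) \<and>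
      (\<forall>i j. TT c N i j xs = (\<Sum>(k, v)\<leftarrow>L. scal k * TT c' N i j v))"
    using TT_change_parameter[OF ij(3), of c N c'] by (rule exE)
  then have L: "\<forall>(k, v)\<in>set L. v \<noteq> [] \<and> length v \<le> length xs"
    "TT c N i j xs = (\<Sum>(k, v)\<leftarrow>L. scal k * TT c' N i j v)" by - (erule conjunct1, drule conjunct2, drule spec, erule spec)
  have "(\<Sum>(k, v)\<leftarrow>L. scal k * TT c' N i j v) \<in> env.span (Tt c' N ` {t' \<in> triples d UNIV. wt t' \<le> wt t})"
    using L(1)
  proof (induction L)
    case (Cons p L)
    obtain k v where p: "p = (k, v)" by (cases p)
    have "TT c' N i j v \<in> env.span (Tt c' N ` {t' \<in> triples d UNIV. wt t' \<le> wt t})"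
      using Cons.prems ij by (intro env.span_base image_eqI[of _ _ "(i, j, v)"]) (auto simp: p t triples_def words_def)
    then show ?case using Cons by (auto simp: p intro: env.span_add env.span_scale)
  qed (simp add: env.span_zero)
  then show ?thesis by (simp add: t L(2))
qed

lemma Tt_basis_letters:
  assumes "t \<in> triples d UNIV"
  shows "Tt c N t \<in> Tspan c N (triples d X) (wt t)"
proof -
  obtain i j xs where t: "t = (i, j, xs)" by (cases t)
  have ij: "i \<in> {1..d}" "j \<in> {1..d}" "xs \<noteq> []" using assms by (auto simp: t triples_def words_def)
  \<comment> \<open>The letters of \<open>us\<close> are in \<open>X\<close> already; the first
    letter of \<open>vs\<close> is expanded next.\<close>
  have "TT c N i j (us @ vs) \<in> Tspan c N (triples d X) (length us + length vs)"
    if "set us \<subseteq> X" "us @ vs \<noteq> []" for us vs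
    using that
  proof (induction vs arbitrary: us)
    case Nil
    then show ?case using Tspan_single[of "(i, j, us)" "triples d X"] ij by (auto simp: triples_def words_def)
  next
    case (Cons x vs)
    have "x \<in> nuca.span X" by (simp add: span_X)
    then show ?case
    proof (induction rule: nuca.span_induct_alt)
      case base
      have "TT c N i j (us @ 0 # vs) = 0" using TT_scale_letter[of c N i j us 0 0 vs] by simp
      then show ?case by (simp add: Tspan_zero)
    next
      case (step b y z)
      have "TT c N i j ((us @ [y]) @ vs) \<in> Tspan c N (triples d X) (length (us @ [y]) + length vs)"
        using Cons.prems step by (intro Cons.IH) auto
      then show ?case using step by (simp add: TT_add_letter TT_scale_letter Tspan_add Tspan_scale)
    qed
  qed
  from this[of "[]" xs] show ?thesis using ij by (simp add: t)
qed

text \<open>Changing the parameter and passing to basis letters are done factor by factor, and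
  neither raises the weight.\<close>

lemma Tspan_UNIV_eq_X: "Tspan c N (triples d UNIV) K \<subseteq> Tspan c' N (triples d X) K"
proof -
  have "Tt c N t \<in> Tspan c' N (triples d UNIV) (wt t)" if "t \<in> triples d UNIV" for t
  proof -
    have "env.span (Tt c' N ` {t' \<in> triples d UNIV. wt t' \<le> wt t}) \<subseteq> Tspan c' N (triples d UNIV) (wt t)"
    proof (rule env.span_minimal)
      show "env.subspace (Tspan c' N (triples d UNIV) (wt t))" by (simp add: Tspan_def env.subspace_span)
    qed (auto intro!: Tspan_single[of "(_, _, _)", simplified])
    then show ?thesis using Tt_change[OF that, of c N c'] by blast
  qed
  then have "Tspan c N (triples d UNIV) K \<subseteq> Tspan c' N (triples d UNIV) K" by (rule Tspan_subset)
  also have "\<dots> \<subseteq> Tspan c' N (triples d X) K" by (rule Tspan_subset) (rule Tt_basis_letters)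
  finally show ?thesis .
qed

lemma ee_product_Tspan:
  assumes "i \<in> {1..d}" "j \<in> {1..d}" "k \<in> {1..d}" "l \<in> {1..d}" "length u + length v \<le> K"
  shows "ee N i j u * ee N k l v \<in> Tspan 0 N (triples d UNIV) K"
proof -
  have "ee N i j u \<in> Tspan 0 N (triples d UNIV) (length u)" if "i \<in> {1..d}" "j \<in> {1..d}" for i j and u :: "'w list"
  proof (cases "u = []")
    case False
    then show ?thesis using Tspan_single[of "(i, j, u)" "triples d UNIV"] that by (auto simp: triples_def words_def)
  qed (auto intro: Tspan_one Tspan_zero)
  then have "ee N i j u * ee N k l v \<in> Tspan 0 N (triples d UNIV) (length u + length v)"
    using assms by (intro Tspan_mult) auto
  then show ?thesis using Tspan_mono[OF order_refl assms(5)] by blast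
qed

text \<open>The products in \<open>comm_fam\<close> carry the same four outer indices in another
  arrangement, so they stay within \<open>{1..d}\<close>.\<close>

lemma commutator_ee:
  assumes "t \<in> triples d UNIV" "t' \<in> triples d UNIV" "wt t + wt t' \<le> Suc K" "d \<le> N"
  shows "Tt 0 N t * Tt 0 N t' - Tt 0 N t' * Tt 0 N t \<in> Tspan 0 N (triples d UNIV) K"
proof -
  obtain i j xs k l ys where t: "t = (i, j, xs)" "t' = (k, l, ys)" by (cases t; cases t')
  have ind: "i \<in> {1..d}" "j \<in> {1..d}" "k \<in> {1..d}" "l \<in> {1..d}" using assms by (auto simp: t triples_def)
  have "F i j k l \<in> Tspan 0 N (triples d UNIV) K" if "comm_fam N K F" for F
    using that
  proof (induction rule: comm_fam.induct)
    case (cong F G)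
    then show ?case using ind assms(4) by (metis atLeastAtMost_iff order_trans)
  qed (use ind in \<open>auto intro!: Tspan_add Tspan_scale ee_product_Tspan\<close>)
  from this[OF comm_fam_main[THEN conjunct1, rule_format, of xs ys K N]] assms(3)
  show ?thesis by (simp add: t)
qed

lemma commutator_Tt:
  assumes "t \<in> triples d UNIV" "t' \<in> triples d UNIV" "wt t + wt t' \<le> Suc K" "d \<le> N"
  shows "Tt c N t * Tt c N t' - Tt c N t' * Tt c N t \<in> Tspan c N (triples d X) K"
proof -
  let ?B = "\<lambda>t. Tt 0 N ` {t' \<in> triples d UNIV. wt t' \<le> wt t}"
  let ?P = "Tspan 0 N (triples d UNIV) K"
  have 1: "Tt 0 N p * v - v * Tt 0 N p \<in> ?P" if "p \<in> triples d UNIV" "wt p \<le> wt t" "v \<in> env.span (?B t')" for p v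
    using that(3)
  proof (induction rule: env.span_induct_alt)
    case base
    then show ?case by (simp add: Tspan_zero)
  next
    case (step b x y)
    then obtain q where q: "q \<in> triples d UNIV" "wt q \<le> wt t'" "x = Tt 0 N q" by auto
    have "Tt 0 N p * x - x * Tt 0 N p \<in> ?P"
      using that q assms unfolding q(3) by (intro commutator_ee) auto
    then have "scal b * (Tt 0 N p * x - x * Tt 0 N p) + (Tt 0 N p * y - y * Tt 0 N p) \<in> ?P"
      using step by (intro Tspan_add Tspan_scale)
    then show ?case
      by (simp add: scal_left_commute[of "Tt 0 N p"] algebra_simps)
  qed
  have 2: "u * v - v * u \<in> ?P" if "u \<in> env.span (?B t)" "v \<in> env.span (?B t')" for u v
    using that(1)
  proof (induction rule: env.span_induct_alt)
    case base
    then show ?case by (simp add: Tspan_zero)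
  next
    case (step b x y)
    then have "x * v - v * x \<in> ?P" using 1 that(2) by auto
    then have "scal b * (x * v - v * x) + (y * v - v * y) \<in> ?P"
      using step by (intro Tspan_add Tspan_scale)
    then show ?case
      by (simp add: scal_left_commute[of v] algebra_simps)
  qed
  have "Tt c N t * Tt c N t' - Tt c N t' * Tt c N t \<in> ?P"
    by (intro 2 Tt_change assms)
  then show ?thesis using Tspan_UNIV_eq_X by blast
qed

definition sorted_span :: "((nat \<times> nat \<times> 'w list) \<times> (nat \<times> nat \<times> 'w list)) set \<Rightarrow> nat \<Rightarrow> complex \<Rightarrow> nat \<Rightarrow> nat \<Rightarrow> 'w env set" where
  "sorted_span r d c N K =
     env.span {Tp c N ts | ts. ts \<in> weakly_increasing_lists r (triples d X) \<and> wts ts \<le> K}"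

lemma Tspan_sorted:
  assumes r: "linear_order_on (triples d X) r" and "d \<le> N"
  shows "Tspan c N (triples d X) K \<subseteq> sorted_span r d c N K"
proof -
  let ?pr = "Tp c N"
  have sub: "env.subspace (sorted_span r d c N K)" for K by (simp add: sorted_span_def env.subspace_span)
  have "?pr ts \<in> sorted_span r d c N K" if "set ts \<subseteq> triples d X" "wts ts \<le> K" for ts K
  proof (rule sorting_span[where S="sorted_span r d c N" and wt=wt and T="triples d X" and r=r and pr="?pr"])
    show "sorted_span r d c N K \<subseteq> sorted_span r d c N (Suc K)" for K
      unfolding sorted_span_def by (intro env.span_mono) auto
    show "?pr ws \<in> sorted_span r d c N K" if "ws \<in> weakly_increasing_lists r (triples d X)" "wts ws \<le> K" for ws K
      unfolding sorted_span_def using that by (intro env.span_base) auto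
    show "1 \<le> wt t" if "t \<in> triples d X" for t
      using that by (cases "snd (snd t)") (auto simp: triples_def words_def)
    fix us a b vs K
    assume ab: "set (us @ a # b # vs) \<subseteq> triples d X" "wts (us @ a # b # vs) \<le> Suc K"
      and IH: "\<And>ws. set ws \<subseteq> triples d X \<Longrightarrow> wts ws \<le> K \<Longrightarrow> ?pr ws \<in> sorted_span r d c N K"
    have ab_pos: "1 \<le> wt a" using ab(1) by (cases "snd (snd a)") (auto simp: triples_def words_def)
    \<comment> \<open>A commutator loses one unit of weight; as \<open>wt a\<close> is at least 1,
      the subtraction is exact.\<close>
    define m where "m = wt a + wt b - 1"
    have "Tt c N a * Tt c N b - Tt c N b * Tt c N a \<in> Tspan c N (triples d X) m"
      using ab triples_mono[of d] \<open>d \<le> N\<close> by (intro commutator_Tt) (auto simp: m_def)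
    then have "?pr us * (Tt c N a * Tt c N b - Tt c N b * Tt c N a) * ?pr vs \<in> sorted_span r d c N K"
      unfolding Tspan_def
    proof (induction rule: env.span_induct_alt)
      case base
      then show ?case using sub env.subspace_0 by force
    next
      case (step e x y)
      then obtain ws where ws: "set ws \<subseteq> triples d X" "wts ws \<le> m" "x = ?pr ws" by auto
      have "?pr (us @ ws @ vs) \<in> sorted_span r d c N K"
        using ws ab ab_pos by (intro IH) (auto simp: m_def)
      then have "scal e * (?pr us * x * ?pr vs) + ?pr us * y * ?pr vs \<in> sorted_span r d c N K"
        using step sub by (intro env.subspace_add[OF sub] env.subspace_scale[OF sub]) (auto simp: ws mult.assoc)
      then show ?case by (simp add: distrib_left distrib_right scal_left_commute[of "?pr us"] mult.assoc)
    qed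
    then show "?pr (us @ a # b # vs) - ?pr (us @ b # a # vs) \<in> sorted_span r d c N K"
      by (simp add: algebra_simps)
  qed (use that r sub in \<open>auto intro: env.subspace_0 env.subspace_add\<close>)
  then show ?thesis
    unfolding Tspan_def by (intro env.span_minimal sub) auto
qed

end

section \<open>Paths\<close>

text \<open>Expanding \<open>e\<^sub>i\<^sub>j(x)\<close> into words of matrix units gives one summand for each path from \<open>i\<close> to \<open>j\<close>
  labelled by \<open>x\<close>.\<close>

fun epaths :: "nat \<Rightarrow> nat \<Rightarrow> nat \<Rightarrow> 'w list \<Rightarrow> (nat \<times> nat \<times> 'w) list list" where
  "epaths N i j [] = []"
| "epaths N i j [x] = [[(i, j, x)]]"
| "epaths N i j (x # y # w) = concat (map (\<lambda>a. map ((#) (i, a, x)) (epaths N a j (y # w))) [1..<Suc N])"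

fun mpaths :: "nat \<Rightarrow> (nat \<times> nat \<times> 'w list) list \<Rightarrow> (nat \<times> nat \<times> 'w) list list list" where
  "mpaths N [] = [[]]"
| "mpaths N ((i, j, xs) # ts) = concat (map (\<lambda>p. map ((#) p) (mpaths N ts)) (epaths N i j xs))"

lemma sum_list_concat_map: "sum_list (map f (concat xss)) = (\<Sum>xs\<leftarrow>xss. sum_list (map f xs))"
  by (induction xss) auto

lemma ee_eq_sum_paths:
  "xs \<noteq> [] \<Longrightarrow> ee N i j xs = (\<Sum>p\<leftarrow>epaths N i j xs. gEs (map Em p))"
proof (induction N i j xs rule: epaths.induct)
  case (3 N i j x y w)
  have "(\<Sum>p\<leftarrow>epaths N i j (x # y # w). gEs (map Em p)) =
     (\<Sum>a\<leftarrow>[1..<Suc N]. EE i a x * (\<Sum>p\<leftarrow>epaths N a j (y # w). gEs (map Em p)))"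
    by (simp only: epaths.simps sum_list_concat_map map_map o_def list.map prod_list.Cons case_prod_conv sum_list_const_mult EE_def)
  also have "\<dots> = (\<Sum>a\<leftarrow>[1..<Suc N]. EE i a x * ee N a j (y # w))"
    using 3 by (intro arg_cong[of _ _ sum_list] map_cong) auto
  also have "\<dots> = (\<Sum>a=1..N. EE i a x * ee N a j (y # w))"
    unfolding interv_sum_list_conv_sum_set_nat by (simp add: atLeastLessThanSuc_atLeastAtMost del: upt_Suc)
  finally show ?case by simp
qed (simp_all add: EE_def)

lemma prod_ee_eq_sum_paths:
  assumes "set ts \<subseteq> triples d UNIV"
  shows "prod_list (map (\<lambda>(i, j, xs). ee N i j xs) ts) = (\<Sum>P\<leftarrow>mpaths N ts. gEs (map Em (concat P)))"
  using assms
proof (induction ts)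
  case (Cons t ts)
  obtain i j xs where t: "t = (i, j, xs)" by (cases t)
  have xs: "xs \<noteq> []" using Cons.prems by (auto simp: t triples_def words_def)
  have "(\<Sum>P\<leftarrow>mpaths N ((i, j, xs) # ts). gEs (map Em (concat P))) =
     (\<Sum>p\<leftarrow>epaths N i j xs. gEs (map Em p) * (\<Sum>P\<leftarrow>mpaths N ts. gEs (map Em (concat P))))"
    by (simp only: mpaths.simps sum_list_concat_map map_map o_def concat.simps map_append prod_list.append sum_list_const_mult)
  also have "\<dots> = ee N i j xs * (\<Sum>P\<leftarrow>mpaths N ts. gEs (map Em (concat P)))"
    by (simp add: ee_eq_sum_paths[OF xs] sum_list_mult_const)
  finally show ?case using Cons by (simp add: t)
qed simp

section \<open>Reconstructing paths from their edges\<close>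

definition path_label :: "(nat \<times> nat \<times> 'w) list \<Rightarrow> nat \<times> nat \<times> 'w list" where
  "path_label p = (fst (hd p), fst (snd (last p)), map (snd \<circ> snd) p)"

abbreviation chain :: "(nat \<times> nat \<times> 'w) list \<Rightarrow> bool" where
  "chain \<equiv> successively (\<lambda>e e'. fst (snd e) = fst e')"

lemma epaths_path:
  "p \<in> set (epaths N i j xs) \<Longrightarrow> p \<noteq> [] \<and> chain p \<and> path_label p = (i, j, xs)"
proof (induction N i j xs arbitrary: p rule: epaths.induct)
  case (3 N i j x y w)
  then obtain a q where q: "p = (i, a, x) # q" "q \<in> set (epaths N a j (y # w))" "1 \<le> a" "a \<le> N"
    by (auto simp del: epaths.simps(2))
  then have "a \<in> set [1..<Suc N]" by auto
  from 3(1)[OF this q(2)] show ?case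
    unfolding q(1) by (cases q) (auto simp: path_label_def)
qed (auto simp: path_label_def)

definition outer_path :: "nat \<Rightarrow> (nat \<times> nat \<times> 'w) list \<Rightarrow> bool" where
  "outer_path d p \<longleftrightarrow> p \<noteq> [] \<and> chain p \<and> fst (hd p) \<le> d \<and> fst (snd (last p)) \<le> d \<and> (\<forall>e\<in>set (tl p). d < fst e)"

text \<open>Above \<open>d\<close> the edges leave no choice: a path that has entered this region is
  forced until it returns to a vertex up to \<open>d\<close>.\<close>

definition functional_above :: "nat \<Rightarrow> (nat \<times> nat \<times> 'w) set \<Rightarrow> bool" where
  "functional_above d G \<longleftrightarrow> (\<forall>e\<in>G. \<forall>e'\<in>G. d < fst e \<longrightarrow> fst e = fst e' \<longrightarrow> e = e')"

lemma outer_path_unique: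
  assumes "functional_above d G" "set p \<subseteq> G" "set q \<subseteq> G" "hd p = hd q" "p \<noteq> []" "q \<noteq> []" "chain p" "chain q"
    "fst (snd (last p)) \<le> d" "fst (snd (last q)) \<le> d" "\<forall>e\<in>set (tl p). d < fst e" "\<forall>e\<in>set (tl q). d < fst e"
  shows "p = q"
  using assms(2-)
proof (induction p arbitrary: q)
  case (Cons e p)
  then obtain q' where q: "q = e # q'" by (cases q) auto
  show ?case
  proof (cases "p = []")
    case True
    then have "q' = []" using Cons.prems by (cases q') (auto simp: q)
    then show ?thesis using True q by simp
  next
    case False
    then obtain f p' where p: "p = f # p'" by (cases p) auto
    then have f: "fst (snd e) = fst f" "d < fst f" "f \<in> G" using Cons.prems by auto
    then obtain g q'' where q': "q' = g # q''" using Cons.prems by (cases q') (auto simp: q)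
    then have g: "fst (snd e) = fst g" "g \<in> G" using Cons.prems by (auto simp: q)
    have "f = g" using assms(1) f g unfolding functional_above_def by metis
    then have "p = q'" using Cons.prems by (intro Cons.IH) (auto simp: p q q')
    then show ?thesis by (simp add: q)
  qed
qed simp

text \<open>A first edge is recognized by its source, which is at most \<open>d\<close>, and
  \<open>functional_above\<close> forces the rest of its path. So the path of a given first edge can
  be removed from both sides.\<close>

lemma outer_paths_unique:
  assumes "\<forall>p\<in>set P. outer_path d p" "\<forall>q\<in>set Q. outer_path d q" "functional_above d (set (concat Q))"
    "mset (concat P) = mset (concat Q)"
  shows "mset P = mset Q"
  using assms
proof (induction P arbitrary: Q)
  case Nil
  then have "concat Q = []" by simp
  then have "Q = []" using Nil(2) by (cases Q) (auto simp: outer_path_def)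
  then show ?case by simp
next
  case (Cons p P)
  have p: "outer_path d p" using Cons.prems by simp
  have set_eq: "set (concat (p # P)) = set (concat Q)" using Cons.prems(4) by (metis set_mset_mset)
  have "hd p \<in> set p" using p by (simp add: outer_path_def)
  then have "hd p \<in> set (concat Q)" using set_eq by auto
  then obtain q where q: "q \<in> set Q" "hd p \<in> set q" by auto
  have oq: "outer_path d q" using Cons.prems(2) q by blast
  have hd: "hd p = hd q"
  proof (rule ccontr)
    assume "hd p \<noteq> hd q"
    then have "hd p \<in> set (tl q)" using q(2) by (cases q) auto
    then show False using p oq by (auto simp: outer_path_def)
  qed
  have "set p \<subseteq> set (concat Q)" using set_eq by auto
  moreover have "set q \<subseteq> set (concat Q)" using q by auto
  ultimately have "p = q"
    using p oq hd by (intro outer_path_unique[OF Cons.prems(3)]) (auto simp: outer_path_def)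
  then obtain Q1 Q2 where Q: "Q = Q1 @ p # Q2" using q by (auto simp: in_set_conv_decomp)
  have "mset P = mset (Q1 @ Q2)"
  proof (rule Cons.IH)
    show "functional_above d (set (concat (Q1 @ Q2)))"
      using Cons.prems(3) unfolding functional_above_def Q by auto
    show "mset (concat P) = mset (concat (Q1 @ Q2))" using Cons.prems(4) by (simp add: Q)
  qed (use Cons.prems Q in auto)
  then show ?case by (simp add: Q)
qed

definition lows :: "nat \<Rightarrow> (nat \<times> nat \<times> 'w) list \<Rightarrow> nat" where
  "lows d p = length (filter (\<lambda>e. fst e \<le> d) p)"

lemma mpaths_labels: "P \<in> set (mpaths N ts) \<Longrightarrow> map path_label P = ts \<and> (\<forall>p\<in>set P. p \<noteq> [] \<and> chain p)"
proof (induction ts arbitrary: P)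
  case (Cons t ts)
  obtain i j xs where t: "t = (i, j, xs)" by (cases t)
  obtain p P' where "P = p # P'" "p \<in> set (epaths N i j xs)" "P' \<in> set (mpaths N ts)"
    using Cons.prems by (auto simp: t)
  then show ?case using Cons.IH epaths_path[of p N i j xs] by (auto simp: t)
qed simp

text \<open>Every path contributes its first edge. If the count does not exceed the number of paths,
  no further edge can start at a vertex up to \<open>d\<close>.\<close>

lemma lows_concat:
  assumes "\<forall>p\<in>set P. p \<noteq> [] \<and> fst (hd p) \<le> d"
  shows "length P \<le> lows d (concat P)"
    and "lows d (concat P) \<le> length P \<Longrightarrow> p \<in> set P \<Longrightarrow> \<forall>e\<in>set (tl p). d < fst e"
proof -
  have hd: "lows d p = Suc (lows d (tl p))" if "p \<in> set P" for p
  proof -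
    have "p \<noteq> [] \<and> fst (hd p) \<le> d" using that assms by blast
    then show ?thesis by (cases p) (auto simp: lows_def)
  qed
  have app: "lows d (p @ q) = lows d p + lows d q" for p q :: "(nat \<times> nat \<times> 'a) list" by (simp add: lows_def)
  show le: "length P \<le> lows d (concat P)"
    using hd by (induction P) (auto simp: app)
  show "\<forall>e\<in>set (tl p). d < fst e" if "lows d (concat P) \<le> length P" "p \<in> set P"
  proof -
    have le': "length Q \<le> lows d (concat Q)" if "set Q \<subseteq> set P" for Q
      using hd that by (induction Q) (auto simp: app)
    obtain Q1 Q2 where Q: "P = Q1 @ p # Q2" using \<open>p \<in> set P\<close> by (auto simp: in_set_conv_decomp)
    have "length Q1 \<le> lows d (concat Q1)" "length Q2 \<le> lows d (concat Q2)"
      by (rule le', simp add: Q subset_iff)+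
    then have "lows d (tl p) = 0" using that(1) hd[OF that(2)] by (simp add: Q app)
    then show ?thesis by (auto simp: lows_def filter_empty_conv not_le)
  qed
qed

subsection \<open>Paths through fresh vertices\<close>

fun fresh :: "nat \<Rightarrow> nat \<Rightarrow> nat \<Rightarrow> 'w list \<Rightarrow> (nat \<times> nat \<times> 'w) list" where
  "fresh j i n [] = []"
| "fresh j i n [x] = [(i, j, x)]"
| "fresh j i n (x # y # w) = (i, n, x) # fresh j n (Suc n) (y # w)"

text \<open>A path with \<open>m\<close> edges has \<open>m - 1\<close> inner vertices. Reserving
  \<open>m\<close> numbers for each makes the total equal to the weight, hence the level bound
  \<open>d + wts ts0\<close> later.\<close>

fun fresh_paths :: "nat \<Rightarrow> (nat \<times> nat \<times> 'w list) list \<Rightarrow> (nat \<times> nat \<times> 'w) list list" where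
  "fresh_paths n [] = []"
| "fresh_paths n ((i, j, xs) # ts) = fresh j i n xs # fresh_paths (n + length xs) ts"

lemma fresh_tails: "e \<in> set (fresh j i n xs) \<Longrightarrow> fst e = i \<or> n \<le> fst e \<and> fst e < n + length xs"
proof (induction j i n xs rule: fresh.induct)
  case (3 j i n x y w)
  then consider "e = (i, n, x)" | "e \<in> set (fresh j n (Suc n) (y # w))" by auto
  then show ?case
    by cases (use 3(1) in auto)
qed auto

lemma fresh_inj: "i < n \<Longrightarrow> inj_on fst (set (fresh j i n xs))"
proof (induction j i n xs rule: fresh.induct)
  case (3 j i n x y w)
  have "fst e \<noteq> i" if "e \<in> set (fresh j n (Suc n) (y # w))" for e
    using fresh_tails[OF that] 3 by auto
  moreover have "inj_on fst (set (fresh j n (Suc n) (y # w)))" using 3 by simp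
  ultimately show ?case by (auto simp: inj_on_def)
qed auto

lemma fresh_epaths: "xs \<noteq> [] \<Longrightarrow> 1 \<le> n \<Longrightarrow> n + length xs \<le> Suc N \<Longrightarrow> fresh j i n xs \<in> set (epaths N i j xs)"
  by (induction j i n xs rule: fresh.induct) (auto simp del: upt_Suc)

lemma fresh_tl_tails: "e \<in> set (tl (fresh j i n xs)) \<Longrightarrow> n \<le> fst e"
proof (induction j i n xs rule: fresh.induct)
  case (3 j i n x y w)
  then show ?case using fresh_tails[of e j n "Suc n" "y # w"] by auto
qed auto

lemma fresh_paths_mpaths:
  assumes "\<forall>t\<in>set ts. snd (snd t) \<noteq> []" "1 \<le> n" "n + sum_list (map (\<lambda>t. length (snd (snd t))) ts) \<le> Suc N"
  shows "fresh_paths n ts \<in> set (mpaths N ts)"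
  using assms
  by (induction n ts rule: fresh_paths.induct) (auto intro!: bexI[OF _ fresh_epaths])

lemma fresh_paths_tails:
  "e \<in> set (concat (fresh_paths n ts)) \<Longrightarrow> \<forall>(i, j, xs)\<in>set ts. i \<le> d \<Longrightarrow> fst e \<le> d \<or> n \<le> fst e"
  by (induction n ts rule: fresh_paths.induct) (fastforce dest: fresh_tails)+

text \<open>Sources above \<open>d\<close> are inner vertices. They are distinct within one path,
  and different paths take theirs from disjoint intervals.\<close>

lemma fresh_paths_functional:
  "d < n \<Longrightarrow> \<forall>(i, j, xs)\<in>set ts. i \<le> d \<Longrightarrow> functional_above d (set (concat (fresh_paths n ts)))"
proof (induction n ts rule: fresh_paths.induct)
  case (2 n i j xs ts)
  let ?A = "set (fresh j i n xs)" and ?B = "set (concat (fresh_paths (n + length xs) ts))"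
  have i: "i \<le> d" using 2 by simp
  have A: "fst e < n + length xs" if "e \<in> ?A" for e using fresh_tails[OF that] i 2 by auto
  have B: "n + length xs \<le> fst e" if "e \<in> ?B" "d < fst e" for e
    using fresh_paths_tails[OF that(1), of d] that(2) 2 by auto
  have inj: "inj_on fst ?A" using i 2 by (intro fresh_inj) auto
  have IH: "functional_above d ?B" using 2 by auto
  have "e = e'" if ee: "e \<in> ?A \<union> ?B" "e' \<in> ?A \<union> ?B" "d < fst e" "fst e = fst e'" for e e'
  proof -
    consider "e \<in> ?A" "e' \<in> ?A" | "e \<in> ?B" "e' \<in> ?B" | "e \<in> ?A" "e' \<in> ?B" | "e \<in> ?B" "e' \<in> ?A" using ee by blast
    then show ?thesis
    proof cases
      case 1
      then show ?thesis using inj ee by (auto dest: inj_onD)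
    next
      case 2
      then show ?thesis using IH ee unfolding functional_above_def by blast
    next
      case 3
      then show ?thesis using A[of e] B[of e'] ee by auto
    next
      case 4
      then show ?thesis using A[of e'] B[of e] ee by auto
    qed
  qed
  then show ?case unfolding functional_above_def by (auto simp del: Un_iff simp: Un_iff[symmetric])
qed (simp add: functional_above_def)

lemma fresh_paths_outer:
  assumes "d < n" "\<forall>(i, j, xs)\<in>set ts. i \<le> d \<and> j \<le> d \<and> xs \<noteq> []" "p \<in> set (fresh_paths n ts)"
  shows "outer_path d p"
  using assms
proof (induction n ts rule: fresh_paths.induct)
  case (2 n i j xs ts)
  show ?case
  proof (cases "p = fresh j i n xs")
    case True
    \<comment> \<open>The level \<open>n + length xs\<close> merely has to have room for the path,
      so that \<open>epaths_path\<close> describes its ends.\<close>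
    have "p \<in> set (epaths (n + length xs) i j xs)" unfolding True using 2 by (intro fresh_epaths) auto
    from epaths_path[OF this] fresh_tl_tails[of _ j i n xs] show ?thesis
      using 2 True by (fastforce simp: outer_path_def path_label_def)
  qed (use 2 in auto)
qed simp

lemma lows_outer:
  "\<forall>p\<in>set P. outer_path d p \<Longrightarrow> lows d (concat P) = length P"
proof (induction P)
  case (Cons p P)
  obtain e q where p: "p = e # q" using Cons.prems by (cases p) (auto simp: outer_path_def)
  have "lows d p = 1" using Cons.prems by (auto simp: p lows_def outer_path_def filter_empty_conv)
  then show ?case using Cons by (simp add: lows_def)
qed (simp add: lows_def)

section \<open>Linear independence\<close>

context algebra_basis
begin

lemma prod_Tt_Ffil:
  assumes "set ts \<subseteq> triples d UNIV" "d \<le> N"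
  shows "Tp c N ts \<in> Ffil N (wts ts)"
    and "Tp c N ts - Tp 0 N ts \<in> Ffil N (wts ts - 1)"
proof -
  have T: "Tt c N t \<in> Ffil N (wt t)" "Tt c N t - Tt 0 N t \<in> Ffil N (wt t - 1)" "1 \<le> wt t"
    if t: "t \<in> triples d UNIV" for t c
  proof -
    obtain i j xs where "t = (i, j, xs)" by (cases t)
    then show "Tt c N t \<in> Ffil N (wt t)" "Tt c N t - Tt 0 N t \<in> Ffil N (wt t - 1)" "1 \<le> wt t"
      using t assms(2) Ffil_TT[of i N j c xs] TT_top_degree[of i N j xs c]
      by (auto simp: triples_def words_def Suc_le_eq)
  qed
  have 1: "Tp c N ts \<in> Ffil N (wts ts)" if "set ts \<subseteq> triples d UNIV" for ts
    using that
  proof (induction ts)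
    case (Cons t ts)
    then show ?case using Ffil_mult[OF T(1)[of t c], of "Tp c N ts" "wts ts"] by simp
  qed (simp add: Ffil_1)
  show "Tp c N ts \<in> Ffil N (wts ts)" by (rule 1[OF assms(1)])
  show "Tp c N ts - Tp 0 N ts \<in> Ffil N (wts ts - 1)"
    using assms(1)
  proof (induction ts)
    case (Cons t ts)
    let ?P = "\<lambda>c. Tp c N ts"
    have t: "t \<in> triples d UNIV" using Cons.prems by simp
    have "(Tt c N t - Tt 0 N t) * ?P c \<in> Ffil N (wt t - 1 + wts ts)"
      using Cons.prems by (intro Ffil_mult T 1) auto
    moreover have "Tt 0 N t * (?P c - ?P 0) \<in> Ffil N (wt t - 1 + wts ts)"
    \<comment> \<open>For empty \<open>ts\<close> the difference is 0; otherwise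
      \<open>wts ts\<close> is at least 1 and the subtraction of 1 may be moved to
      \<open>wt t\<close>.\<close>
    proof (cases "ts = []")
      case False
      then have "1 \<le> wts ts" using Cons.prems T(3) by (cases ts) (auto intro: trans_le_add1)
      moreover have "Tt 0 N t * (?P c - ?P 0) \<in> Ffil N (wt t + (wts ts - 1))"
        using Cons by (intro Ffil_mult T) auto
      ultimately show ?thesis using T(3)[OF t] by simp
    qed (simp add: Ffil_0)
    moreover have "prod_list (map (Tt c N) (t # ts)) - prod_list (map (Tt 0 N) (t # ts)) =
        (Tt c N t - Tt 0 N t) * ?P c + Tt 0 N t * (?P c - ?P 0)"
      by (simp add: algebra_simps)
    ultimately show ?case using Ffil_add T(3)[OF t] by simp
  qed (simp add: Ffil_0)
qed

lemma evalF_sum_list: "evalF F (\<Sum>x\<leftarrow>xs. f x) = (\<Sum>x\<leftarrow>xs. evalF F (f x))"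
  by (induction xs) (auto simp: evalF_add)

lemma sum_list_of_nat: "(\<Sum>x\<leftarrow>xs. of_nat (f x)) = (of_nat (\<Sum>x\<leftarrow>xs. f x) :: complex)"
  by (induction xs) auto

text \<open>The functional attached to fresh paths for \<open>ts0\<close> detects \<open>ts0\<close> among the monomials of the same
  weight with at least as many factors: a path with an inner vertex in \<open>{1..d}\<close> would have too many
  edges starting in \<open>{1..d}\<close>, and otherwise freshness allows to reconstruct the monomial.\<close>

lemma fresh_functional:
  assumes r: "linear_order_on (triples d X) r" and N: "d + wts ts0 \<le> N"
    and ts0: "ts0 \<in> weakly_increasing_lists r (triples d X)" and ts: "ts \<in> weakly_increasing_lists r (triples d X)"
    and w: "wts ts = wts ts0" and len: "length ts0 \<le> length ts"
  shows "evalF (Phi (concat (fresh_paths (Suc d) ts0))) (Tp c N ts) \<noteq> 0 \<longleftrightarrow> ts = ts0"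
proof -
  define gs where "gs = concat (fresh_paths (Suc d) ts0)"
  have s: "set ts \<subseteq> triples d X" "set ts0 \<subseteq> triples d X" using ts ts0 by (auto simp: weakly_increasing_lists_def)
  have s': "\<forall>(i, j, xs)\<in>set u. i \<le> d \<and> j \<le> d \<and> xs \<noteq> [] \<and> set xs \<subseteq> X" if "set u \<subseteq> triples d X" for u
    using that by (auto simp: triples_def words_def)
  have gs_mp: "fresh_paths (Suc d) ts0 \<in> set (mpaths N ts0)"
    using s'[OF s(2)] N by (intro fresh_paths_mpaths) auto
  \<comment> \<open>A path has as many edges as its label has letters, so all edge words of a
    monomial have its weight as their length.\<close>
  have concat_props: "length (concat P) = wts u \<and> snd ` snd ` set (concat P) \<subseteq> X"
    if "P \<in> set (mpaths N u)" "set u \<subseteq> triples d X" for P u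
  proof -
    have lab: "map path_label P = u" using mpaths_labels[OF that(1)] by simp
    have len: "wt (path_label p) = length p" for p :: "(nat \<times> nat \<times> 'w) list" by (simp add: path_label_def)
    have "length (concat P) = wts (map path_label P)"
      by (induction P) (simp_all add: len)
    moreover have "snd ` snd ` set p \<subseteq> X" if "p \<in> set P" for p
    proof -
      have "path_label p \<in> set u" using that lab by auto
      from bspec[OF s'[OF \<open>set u \<subseteq> _\<close>] this] have "set (map (snd \<circ> snd) p) \<subseteq> X"
        by (simp add: path_label_def)
      then show ?thesis by auto
    qed
    ultimately show ?thesis unfolding lab by auto
  qed
  have gs: "length gs = wts ts0" "snd ` snd ` set gs \<subseteq> X" using concat_props[OF gs_mp s(2)] by (auto simp: gs_def)
  have outer: "\<forall>p\<in>set (fresh_paths (Suc d) ts0). outer_path d p"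
    using s'[OF s(2)] by (intro ballI fresh_paths_outer[of d "Suc d" ts0]) auto
  have labels0: "map path_label (fresh_paths (Suc d) ts0) = ts0" using mpaths_labels[OF gs_mp] by simp
  have match: "mset gs = mset (concat P) \<Longrightarrow> ts = ts0" if P: "P \<in> set (mpaths N ts)" for P
  proof -
    assume eq: "mset gs = mset (concat P)"
    have lab: "map path_label P = ts" and ch: "\<forall>p\<in>set P. p \<noteq> [] \<and> chain p" using mpaths_labels[OF P] by auto
    have ends: "fst (hd p) \<le> d \<and> fst (snd (last p)) \<le> d" if "p \<in> set P" for p
    proof -
      have "path_label p \<in> set ts" using that lab by auto
      then show ?thesis using s'[OF s(1)] by (auto simp: path_label_def)
    qed
    \<comment> \<open>The number of edges starting at vertices up to \<open>d\<close> depends only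
      on the multiset of edges. It equals \<open>length ts0\<close>, which by \<open>len\<close> is
      at most the number of paths in \<open>P\<close>.\<close>
    have "lows d gs = lows d (concat P)"
      unfolding lows_def using eq by (metis mset_filter size_mset)
    moreover have "lows d gs = length ts0"
      using lows_outer[OF outer] arg_cong[OF labels0, of length] by (simp add: gs_def)
    moreover have "length P = length ts" using lab by auto
    ultimately have "lows d (concat P) \<le> length P" using len by simp
    then have "\<forall>p\<in>set P. outer_path d p"
      using ch ends lows_concat(2)[of P d] by (auto simp: outer_path_def)
    moreover have "functional_above d (set (concat (fresh_paths (Suc d) ts0)))"
      using s'[OF s(2)] by (intro fresh_paths_functional) auto
    ultimately have "mset P = mset (fresh_paths (Suc d) ts0)"
      using outer eq by (intro outer_paths_unique) (auto simp: gs_def)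
    then have "mset ts = mset ts0" using lab labels0 by (metis mset_map)
    then show "ts = ts0" by (rule sorted_perm_unique[OF r ts ts0])
  qed
  have "\<exists>n. Phi gs (map Em (concat P)) = of_nat n \<and> (n > 0 \<longleftrightarrow> mset gs = mset (concat P))" if "P \<in> set (mpaths N ts)" for P
    using concat_props[OF that s(1)] gs w by (intro Phi_edges) auto
  then obtain n where n: "\<And>P. P \<in> set (mpaths N ts) \<Longrightarrow> Phi gs (map Em (concat P)) = of_nat (n P) \<and> (n P > 0 \<longleftrightarrow> mset gs = mset (concat P))"
    by metis
  have e: "evalF (Phi gs) (Tp 0 N ts) = of_nat (\<Sum>P\<leftarrow>mpaths N ts. n P)"
  proof -
    have "evalF (Phi gs) (Tp 0 N ts) = (\<Sum>P\<leftarrow>mpaths N ts. Phi gs (map Em (concat P)))"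
      using s(1) triples_mono[of d] prod_ee_eq_sum_paths[of ts d N]
      by (simp add: evalF_sum_list evalF_gEs good_Phi del: map_map)
    also have "\<dots> = (\<Sum>P\<leftarrow>mpaths N ts. of_nat (n P))"
      using n by (intro arg_cong[of _ _ sum_list] map_cong) auto
    finally show ?thesis by (simp only: sum_list_of_nat)
  qed
  \<comment> \<open>The difference has degree below \<open>length gs\<close>, so the functional does
    not notice the parameter.\<close>
  have "evalF (Phi gs) (Tp c N ts - Tp 0 N ts) = 0"
  proof (cases "ts = []")
    case False
    then have "1 \<le> wts ts" using s'[OF s(1)] by (cases ts) (auto simp: Suc_le_eq)
    moreover have "Tp c N ts - Tp 0 N ts \<in> Ffil N (wts ts - 1)"
      using s(1) triples_mono[of d] N by (intro prod_Tt_Ffil(2)[of ts d N c]) auto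
    ultimately show ?thesis using gs(1) w by (intro evalF_Phi_Ffil) auto
  qed simp
  then have "evalF (Phi gs) (Tp c N ts) = of_nat (\<Sum>P\<leftarrow>mpaths N ts. n P)"
    by (simp add: evalF_diff e)
  moreover have "(\<Sum>P\<leftarrow>mpaths N ts. n P) \<noteq> 0 \<longleftrightarrow> ts = ts0"
  proof
    assume "(\<Sum>P\<leftarrow>mpaths N ts. n P) \<noteq> 0"
    then obtain P where "P \<in> set (mpaths N ts)" "n P \<noteq> 0" by (auto simp: sum_list_eq_0_iff)
    then show "ts = ts0" using n match by auto
  next
    assume eq: "ts = ts0"
    then have "fresh_paths (Suc d) ts0 \<in> set (mpaths N ts)" using gs_mp by simp
    moreover from this have "n (fresh_paths (Suc d) ts0) > 0" using n by (auto simp: gs_def)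
    ultimately show "(\<Sum>P\<leftarrow>mpaths N ts. n P) \<noteq> 0" by (auto simp: sum_list_eq_0_iff)
  qed
  ultimately show ?thesis unfolding gs_def by (simp only: of_nat_eq_0_iff)
qed

text \<open>Triangularity: among the monomials of maximal weight take one with the fewest factors.
  Its functional kills lighter monomials by degree; the others of the same weight have at least as
  many factors and are excluded by \<open>fresh_functional\<close>.\<close>

lemma sorted_monomials_independent:
  assumes r: "linear_order_on (triples d X) r" and N: "d + K \<le> N"
    and c: "keys c \<subseteq> weakly_increasing_lists r (triples d X)" "\<And>ts. ts \<in> keys c \<Longrightarrow> wts ts \<le> K"
    and zero: "(\<Sum>ts\<in>keys c. scal (lookup c ts) * Tp b N ts) = 0"
  shows "c = 0"
proof (rule ccontr)
  assume "c \<noteq> 0"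
  then have ne: "keys c \<noteq> {}" by simp
  define m where "m = Max (wts ` keys c)"
  have "m \<in> wts ` keys c" unfolding m_def using ne by (intro Max_in) auto
  then obtain ts1 where ts1: "ts1 \<in> keys c \<and> wts ts1 = m" by auto
  then obtain ts0 where ts0: "ts0 \<in> keys c" "wts ts0 = m"
    and least: "\<And>ts. ts \<in> keys c \<Longrightarrow> wts ts = m \<Longrightarrow> length ts0 \<le> length ts"
    using ex_has_least_nat[of "\<lambda>ts. ts \<in> keys c \<and> wts ts = m" ts1 length] by blast
  have le: "wts ts \<le> m" if "ts \<in> keys c" for ts
    using that by (auto simp: m_def)
  define gs where "gs = concat (fresh_paths (Suc d) ts0)"
  have N0: "d + wts ts0 \<le> N" using c(2)[OF ts0(1)] N by simp
  have s: "set ts \<subseteq> triples d X" if "ts \<in> keys c" for ts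
    using c(1) that by (auto simp: weakly_increasing_lists_def)
  have len_gs: "length gs = m"
  proof -
    have "fresh_paths (Suc d) ts0 \<in> set (mpaths N ts0)"
      using s[OF ts0(1)] N0 by (intro fresh_paths_mpaths) (auto simp: triples_def words_def)
    then have lab: "map path_label (fresh_paths (Suc d) ts0) = ts0" using mpaths_labels by blast
    have "length (concat P) = wts (map path_label P)" for P :: "(nat \<times> nat \<times> 'w) list list"
      by (induction P) (simp_all add: path_label_def)
    from this[of "fresh_paths (Suc d) ts0"] show ?thesis unfolding lab ts0(2) gs_def .
  qed
  have other: "evalF (Phi gs) (Tp b N ts) = 0" if "ts \<in> keys c" "ts \<noteq> ts0" for ts
  proof (cases "wts ts = m")
    case True
    then show ?thesis
      using fresh_functional[OF r N0, of ts b] c(1) ts0 that least[OF that(1)] by (auto simp: gs_def)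
  next
    case False
    then have "wts ts < length gs" using le[OF that(1)] len_gs by simp
    then show ?thesis
      using prod_Tt_Ffil(1)[of ts d N b] s[OF that(1)] triples_mono[of d] N by (intro evalF_Phi_Ffil) auto
  qed
  have "0 = evalF (Phi gs) (\<Sum>ts\<in>keys c. scal (lookup c ts) * Tp b N ts)"
    by (simp add: zero)
  also have "\<dots> = (\<Sum>ts\<in>keys c. lookup c ts * evalF (Phi gs) (Tp b N ts))"
    by (simp add: evalF_sum evalF_scal)
  also have "\<dots> = lookup c ts0 * evalF (Phi gs) (Tp b N ts0)"
    using other by (subst sum.remove[OF _ ts0(1)]) (auto intro!: sum.neutral)
  also have "\<dots> \<noteq> 0"
    using fresh_functional[OF r N0, of ts0 b] c(1) ts0 by (auto simp: gs_def in_keys_iff)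
  finally show False by simp
qed

section \<open>Stabilization of coefficients\<close>

definition comb :: "complex \<Rightarrow> ((nat \<times> nat \<times> 'w list) list \<Rightarrow>\<^sub>0 complex) \<Rightarrow> nat \<Rightarrow> 'w env" where
  "comb s c N = (\<Sum>ts\<in>keys c. scal (lookup c ts) * Tm s N ts)"

lemma comb_add: "comb s (c + c') N = comb s c N + comb s c' N"
  unfolding comb_def by (rule sum_keys_add) (simp_all add: scal_add distrib_right)

lemma comb_diff: "comb s (c - c') N = comb s c N - comb s c' N"
  using comb_add[of s "c - c'" c' N] by simp

lemma comb_single: "comb s (single ts b) N = scal b * Tm s N ts"
  by (simp add: comb_def)

lemma stable_seq_comb:
  assumes "\<And>ts. ts \<in> keys c \<Longrightarrow> set ts \<subseteq> triples d UNIV"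
  shows "stable_seq d (comb s c)"
  unfolding comb_def[abs_def] using assms by (intro stable_seq_sum stable_seq_scale stable_seq_Tm) auto

lemma sorted_span_comb:
  assumes "u \<in> sorted_span r d (- of_nat N - s) N K"
  shows "\<exists>c. keys c \<subseteq> {ts \<in> weakly_increasing_lists r (triples d X). wts ts \<le> K} \<and> u = comb s c N"
  using assms unfolding sorted_span_def
proof (induction rule: env.span_induct_alt)
  case base
  then show ?case by (intro exI[of _ 0]) (simp add: comb_def)
next
  case (step b x y)
  then obtain ts c where ts: "ts \<in> weakly_increasing_lists r (triples d X)" "wts ts \<le> K" "x = Tm s N ts"
    and c: "keys c \<subseteq> {ts \<in> weakly_increasing_lists r (triples d X). wts ts \<le> K}" "y = comb s c N"
    by auto
  have "keys (single ts b + c) \<subseteq> {ts \<in> weakly_increasing_lists r (triples d X). wts ts \<le> K}"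
    using Poly_Mapping.keys_add[of "single ts b" c] c(1) ts by (auto split: if_splits)
  then show ?case using ts c(2) by (intro exI[of _ "single ts b + c"]) (simp add: comb_add comb_single)
qed

text \<open>For \<open>N \<ge> d + K\<close> the coefficients are unique, and projecting to the previous level shows that they
  do not depend on \<open>N\<close>; so an expansion at each single level suffices.\<close>

lemma stable_seq_expansion:
  assumes r: "linear_order_on (triples d X) r" and u: "stable_seq d u"
    and span: "\<And>N. d \<le> N \<Longrightarrow> u N \<in> Tspan (- of_nat N - s) N (triples d X) K"
  shows "\<exists>c. keys c \<subseteq> weakly_increasing_lists r (triples d X) \<and> (\<forall>N\<ge>d. u N = comb s c N)"
proof -
  let ?I = "{ts \<in> weakly_increasing_lists r (triples d X). wts ts \<le> K}"
  have "\<exists>c. keys c \<subseteq> ?I \<and> u N = comb s c N" if "d \<le> N" for N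
    by (rule sorted_span_comb[OF subsetD[OF Tspan_sorted[OF r that] span[OF that]]])
  then have "\<forall>N. \<exists>c. d \<le> N \<longrightarrow> keys c \<subseteq> ?I \<and> u N = comb s c N" by simp
  from choice[OF this] obtain C where "\<forall>N. d \<le> N \<longrightarrow> keys (C N) \<subseteq> ?I \<and> u N = comb s (C N) N"
    by (rule exE)
  then have C: "keys (C N) \<subseteq> ?I" "u N = comb s (C N) N" if "d \<le> N" for N
    using that by simp_all
  have stable: "stable_seq d (comb s (C N))" if "d \<le> N" for N
    using C(1)[OF that] triples_mono[of d] by (intro stable_seq_comb) (auto simp: weakly_increasing_lists_def)
  \<comment> \<open>The coefficients found at level \<open>N\<close> remain valid at all lower
    levels, by descending one level at a time.\<close>
  have below: "u M = comb s (C N) M" if "d \<le> M" "M \<le> N" for M N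
  proof -
    have N: "d \<le> N" using that by simp
    have "u (N - k) = comb s (C N) (N - k)" if "k \<le> N - d" for k
      using that
    proof (induction k)
      case 0
      then show ?case using C(2)[OF N] by simp
    next
      case (Suc k)
      then have h: "Suc (N - Suc k) = N - k" "d \<le> N - Suc k" and "k \<le> N - d" by auto
      from Suc.IH[OF this(3)] have "u (Suc (N - Suc k)) = comb s (C N) (Suc (N - Suc k))"
        unfolding h(1) .
      then show ?case by (rule stable_seq_eq_below[OF u stable[OF N] h(2)])
    qed
    from this[of "N - M"] show ?thesis using that by simp
  qed
  \<comment> \<open>The coefficients of level \<open>N\<close> and those of level
    \<open>d + K\<close> both expand \<open>u (d + K)\<close>, and there the expansion is
    unique.\<close>
  have const: "C N = C (d + K)" if "d + K \<le> N" for N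
  proof -
    have "comb s (C N - C (d + K)) (d + K) = 0"
      using below[of "d + K" N] below[of "d + K" "d + K"] that by (simp add: comb_diff)
    moreover have "keys (C N - C (d + K)) \<subseteq> ?I"
      using keys_diff[of "C N" "C (d + K)"] C(1)[of N] C(1)[of "d + K"] that by auto
    ultimately have "C N - C (d + K) = 0"
      by (intro sorted_monomials_independent[OF r, of K "d + K"]) (auto simp: comb_def)
    then show ?thesis by simp
  qed
  have "u N = comb s (C (d + K)) N" if "N \<ge> d" for N
  proof (cases "d + K \<le> N")
    case True
    then show ?thesis using C(2)[of N] const[of N] by simp
  qed (use below that in simp)
  then show ?thesis using C(1)[of "d + K"] by (intro exI[of _ "C (d + K)"]) auto
qed

text \<open>The coefficients may vary with \<open>N\<close>; only the weight bound is uniform.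
  Closure under products is then immediate, and \<open>stable_seq_expansion\<close> supplies
  constant coefficients afterwards.\<close>

definition bounded_seq :: "nat \<Rightarrow> complex \<Rightarrow> (nat \<Rightarrow> 'w env) \<Rightarrow> bool" where
  "bounded_seq d s u \<longleftrightarrow> stable_seq d u \<and> (\<exists>K. \<forall>N\<ge>d. u N \<in> Tspan (- of_nat N - s) N (triples d X) K)"

lemma bounded_seq_one: "bounded_seq d s (\<lambda>N. 1)"
  by (auto simp: bounded_seq_def stable_seq_one Tspan_one)

lemma bounded_seq_zero: "bounded_seq d s (\<lambda>N. 0)"
  by (auto simp: bounded_seq_def stable_seq_zero Tspan_zero)

lemma bounded_seq_scale: "bounded_seq d s u \<Longrightarrow> bounded_seq d s (\<lambda>N. scal b * u N)"
  by (auto simp: bounded_seq_def intro!: stable_seq_scale Tspan_scale)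

lemma bounded_seq_mult: "bounded_seq d s u \<Longrightarrow> bounded_seq d s v \<Longrightarrow> bounded_seq d s (\<lambda>N. u N * v N)"
  unfolding bounded_seq_def by (blast intro: stable_seq_mult Tspan_mult)

lemma bounded_seq_add: "bounded_seq d s u \<Longrightarrow> bounded_seq d s v \<Longrightarrow> bounded_seq d s (\<lambda>N. u N + v N)"
proof -
  assume uv: "bounded_seq d s u" "bounded_seq d s v"
  then obtain K L where K: "\<And>N. d \<le> N \<Longrightarrow> u N \<in> Tspan (- of_nat N - s) N (triples d X) K"
    and L: "\<And>N. d \<le> N \<Longrightarrow> v N \<in> Tspan (- of_nat N - s) N (triples d X) L" by (auto simp: bounded_seq_def)
  have "u N + v N \<in> Tspan (- of_nat N - s) N (triples d X) (max K L)" if "d \<le> N" for N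
    by (rule Tspan_add[OF subsetD[OF Tspan_mono K[OF that]] subsetD[OF Tspan_mono L[OF that]]]) simp_all
  then show ?thesis using uv by (auto simp: bounded_seq_def stable_seq_add)
qed

text \<open>Generators for the parameter \<open>s'\<close> are compared with those for
  \<open>s\<close> separately at each level. This is the source of the independence of the
  subalgebra from the parameter.\<close>

lemma bounded_seq_TTs: "t \<in> triples d UNIV \<Longrightarrow> bounded_seq d s (\<lambda>N. TTs s' N t)"
proof -
  assume t: "t \<in> triples d UNIV"
  have "TTs s' N t \<in> Tspan (- of_nat N - s) N (triples d X) (wt t)" for N
    using Tspan_UNIV_eq_X[of "- of_nat N - s'" N d "wt t" "- of_nat N - s"] Tspan_single[OF t, of "wt t" "- of_nat N - s'" N]
    by auto
  then show ?thesis using stable_seq_TTs[OF t] by (auto simp: bounded_seq_def)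
qed

lemma bounded_seq_lin_comb:
  assumes r: "linear_order_on (triples d X) r" and "bounded_seq d s u"
  shows "\<exists>c. keys c \<subseteq> weakly_increasing_lists r (triples d X) \<and> fib_seq d u = lin_comb (A_alg d) (t_monomial d s) c"
proof -
  have u: "stable_seq d u" using assms(2) by (simp add: bounded_seq_def)
  obtain K where "\<And>N. d \<le> N \<Longrightarrow> u N \<in> Tspan (- of_nat N - s) N (triples d X) K"
    using assms(2) by (auto simp: bounded_seq_def)
  then obtain c where c: "keys c \<subseteq> weakly_increasing_lists r (triples d X)" "\<forall>N\<ge>d. u N = comb s c N"
    using stable_seq_expansion[OF r u, of s K] by auto
  have s: "set ts \<subseteq> triples d UNIV" if "ts \<in> keys c" for ts
    using c(1) that triples_mono[of d] by (auto simp: weakly_increasing_lists_def)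
  have "fib_seq d u = fib_seq d (comb s c)" using c(2) unfolding fib_seq_def by (intro restrict_ext) simp
  also have "\<dots> = lin_comb (A_alg d) (t_monomial d s) c"
    unfolding comb_def[abs_def] by (rule lin_comb_fib_seq[symmetric]) (auto simp: t_monomial_eq_fib_seq stable_seq_Tm s)
  finally show ?thesis using c(1) by blast
qed

section \<open>The subalgebra \<open>Y_alg\<close> and its basis\<close>

lemma subring_bounded: "subring (fib_seq d ` {u. bounded_seq d s u}) (A_alg d)"
proof (rule subring.intro)
  show "subgroup (fib_seq d ` {u. bounded_seq d s u}) (add_monoid (A_alg d))"
  proof (rule subgroup.intro)
    fix a assume "a \<in> fib_seq d ` {u. bounded_seq d s u}"
    then obtain u where u: "bounded_seq d s u" "a = fib_seq d u" by auto
    then have "inv\<^bsub>add_monoid (A_alg d)\<^esub> a = fib_seq d (\<lambda>N. scal (-1) * u N)"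
      by (simp add: add_inv_fib_seq bounded_seq_def)
    then show "inv\<^bsub>add_monoid (A_alg d)\<^esub> a \<in> fib_seq d ` {u. bounded_seq d s u}"
      using bounded_seq_scale[OF u(1), of "-1"] by auto
  next
    fix a b assume "a \<in> fib_seq d ` {u. bounded_seq d s u}" "b \<in> fib_seq d ` {u. bounded_seq d s u}"
    then obtain u v where uv: "bounded_seq d s u" "a = fib_seq d u" "bounded_seq d s v" "b = fib_seq d v" by auto
    then have "a \<otimes>\<^bsub>add_monoid (A_alg d)\<^esub> b = fib_seq d (\<lambda>N. u N + v N)"
      by (simp add: fib_seq_ops bounded_seq_def)
    then show "a \<otimes>\<^bsub>add_monoid (A_alg d)\<^esub> b \<in> fib_seq d ` {u. bounded_seq d s u}"
      using bounded_seq_add[OF uv(1,3)] by auto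
  next
    show "\<one>\<^bsub>add_monoid (A_alg d)\<^esub> \<in> fib_seq d ` {u. bounded_seq d s u}"
      using bounded_seq_zero by (auto simp: fib_seq_zero)
  next
    show "fib_seq d ` {u. bounded_seq d s u} \<subseteq> carrier (add_monoid (A_alg d))"
      by (auto simp: bounded_seq_def fib_seq_carrier)
  qed
  show "submonoid (fib_seq d ` {u. bounded_seq d s u}) (A_alg d)"
  proof (rule submonoid.intro)
    show "fib_seq d ` {u. bounded_seq d s u} \<subseteq> carrier (A_alg d)"
      by (auto simp: bounded_seq_def fib_seq_carrier)
    show "\<one>\<^bsub>A_alg d\<^esub> \<in> fib_seq d ` {u. bounded_seq d s u}"
      using bounded_seq_one by (auto simp: fib_seq_one)
    fix a b assume "a \<in> fib_seq d ` {u. bounded_seq d s u}" "b \<in> fib_seq d ` {u. bounded_seq d s u}"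
    then obtain u v where uv: "bounded_seq d s u" "a = fib_seq d u" "bounded_seq d s v" "b = fib_seq d v" by auto
    then have "a \<otimes>\<^bsub>A_alg d\<^esub> b = fib_seq d (\<lambda>N. u N * v N)"
      by (simp add: fib_seq_ops bounded_seq_def)
    then show "a \<otimes>\<^bsub>A_alg d\<^esub> b \<in> fib_seq d ` {u. bounded_seq d s u}"
      using bounded_seq_mult[OF uv(1,3)] by auto
  qed
qed

lemma Y_alg_subset: "Y_alg d s' \<subseteq> fib_seq d ` {u. bounded_seq d s u}"
proof -
  let ?B = "fib_seq d ` {u. bounded_seq d s u}"
  have "b \<odot>\<^bsub>A_alg d\<^esub> a \<in> ?B" if a: "a \<in> ?B" for a b
  proof -
    obtain u where u: "bounded_seq d s u" "a = fib_seq d u" using a by auto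
    then have "b \<odot>\<^bsub>A_alg d\<^esub> a = fib_seq d (\<lambda>N. scal b * u N)" by (simp add: fib_seq_scale bounded_seq_def)
    then show ?thesis using bounded_seq_scale[OF u(1), of b] by auto
  qed
  moreover have "t_elem d s' ` triples d UNIV \<subseteq> ?B"
    using bounded_seq_TTs by (auto simp: t_elem_eq_fib_seq)
  ultimately show ?thesis
    unfolding Y_alg_def generated_subalgebra_def using subring_bounded[of d s] by blast
qed

text \<open>A generator for \<open>s\<close> lies in every subalgebra containing those for
  \<open>s'\<close>: by \<open>stable_seq_expansion\<close>, applied with \<open>s'\<close>, it is a
  combination of sorted monomials in the latter with constant coefficients.\<close>

lemma t_monomial_Y_alg:
  fixes ts :: "(nat \<times> nat \<times> 'w list) list"
  assumes r: "linear_order_on (triples d X) r" and ts: "set ts \<subseteq> triples d UNIV"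
  shows "t_monomial d s ts \<in> Y_alg d s'"
  unfolding Y_alg_def generated_subalgebra_def
proof (intro InterI)
  fix H :: "(nat \<Rightarrow> 'w matr falg set) set"
  assume "H \<in> {B. subring B (A_alg d) \<and> (\<forall>c. \<forall>b\<in>B. c \<odot>\<^bsub>A_alg d\<^esub> b \<in> B) \<and> t_elem d s' ` triples d UNIV \<subseteq> B}"
  then have H: "subring H (A_alg d)" and scale: "\<And>c b. b \<in> H \<Longrightarrow> c \<odot>\<^bsub>A_alg d\<^esub> b \<in> H"
    and gens: "\<And>t. t \<in> triples d UNIV \<Longrightarrow> t_elem d s' t \<in> H"
    by auto
  interpret subring H "A_alg d" by (rule H)
  have add: "a \<oplus>\<^bsub>A_alg d\<^esub> b \<in> H" if "a \<in> H" "b \<in> H" for a b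
    using subgroup.m_closed[OF subgroup_axioms that] by simp
  have zero: "\<zero>\<^bsub>A_alg d\<^esub> \<in> H" using subgroup.one_closed[OF subgroup_axioms] by simp
  have one: "\<one>\<^bsub>A_alg d\<^esub> \<in> H" using submonoid.one_closed[OF submonoid_axioms] .
  have mult: "a \<otimes>\<^bsub>A_alg d\<^esub> b \<in> H" if "a \<in> H" "b \<in> H" for a b
    using submonoid.m_closed[OF submonoid_axioms that] .
  have mon: "t_monomial d b us \<in> H" if "\<And>t. t \<in> set us \<Longrightarrow> t_elem d b t \<in> H" for b us
    using that by (induction us) (auto simp: t_monomial_def one mult)
  have "t_elem d s t \<in> H" if t: "t \<in> triples d UNIV" for t
  proof -
    have b: "bounded_seq d s' (\<lambda>N. TTs s N t)" by (rule bounded_seq_TTs[OF t])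
    obtain K where "\<And>N. d \<le> N \<Longrightarrow> TTs s N t \<in> Tspan (- of_nat N - s') N (triples d X) K"
      using b by (auto simp: bounded_seq_def)
    then obtain c where c: "keys c \<subseteq> weakly_increasing_lists r (triples d X)" "\<forall>N\<ge>d. TTs s N t = comb s' c N"
      using stable_seq_expansion[OF r stable_seq_TTs[OF t, of s], of s' K] by blast
    have us: "set us \<subseteq> triples d UNIV" if "us \<in> keys c" for us
      using c(1) that triples_mono[of d] by (auto simp: weakly_increasing_lists_def)
    have "fib_seq d (\<lambda>N. \<Sum>us\<in>S. scal (lookup c us) * Tm s' N us) \<in> H"
      if "finite S" "S \<subseteq> keys c" for S
      using that
    proof (induction S rule: finite_induct)
      case empty
      then show ?case using zero by (simp add: fib_seq_zero)
    next
      case (insert v S)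
      have v: "set v \<subseteq> triples d UNIV" using insert us by auto
      have "t_monomial d s' v \<in> H" using v gens by (intro mon) auto
      then have "lookup c v \<odot>\<^bsub>A_alg d\<^esub> fib_seq d (\<lambda>N. Tm s' N v) \<in> H"
        using scale v by (simp add: t_monomial_eq_fib_seq)
      then have 1: "fib_seq d (\<lambda>N. scal (lookup c v) * Tm s' N v) \<in> H"
        using v by (simp add: fib_seq_scale stable_seq_Tm)
      have 2: "fib_seq d (\<lambda>N. \<Sum>us\<in>S. scal (lookup c us) * Tm s' N us) \<in> H"
        using insert by simp
      have "stable_seq d (\<lambda>N. scal (lookup c v) * Tm s' N v)"
        "stable_seq d (\<lambda>N. \<Sum>us\<in>S. scal (lookup c us) * Tm s' N us)"
        using v insert us by (auto intro!: stable_seq_sum stable_seq_scale stable_seq_Tm)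
      from add[OF 1 2, unfolded fib_seq_ops(2)[OF this]] show ?case
        using insert.hyps by simp
    qed
    from this[OF finite_keys order_refl] have "fib_seq d (comb s' c) \<in> H" by (simp add: comb_def[abs_def])
    moreover have "fib_seq d (\<lambda>N. TTs s N t) = fib_seq d (comb s' c)"
      using c(2) unfolding fib_seq_def by (intro restrict_ext) simp
    ultimately show ?thesis using t by (simp add: t_elem_eq_fib_seq)
  qed
  then show "t_monomial d s ts \<in> H" using ts by (intro mon) auto
qed

lemma sorted_t_monomials_basis:
  assumes r: "linear_order_on (triples d X) r"
  shows "is_basis_family (A_alg d) (Y_alg d s') (weakly_increasing_lists r (triples d X)) (t_monomial d s)"
  unfolding is_basis_family_def
proof (intro conjI ballI allI impI)
  show "t_monomial d s ` weakly_increasing_lists r (triples d X) \<subseteq> Y_alg d s'"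
    by (auto simp: weakly_increasing_lists_def intro!: t_monomial_Y_alg[OF r] dest: subset_trans[OF _ triples_mono])
next
  fix c assume "keys c \<subseteq> weakly_increasing_lists r (triples d X) \<and> lin_comb (A_alg d) (t_monomial d s) c = \<zero>\<^bsub>A_alg d\<^esub>"
  then have c: "keys c \<subseteq> weakly_increasing_lists r (triples d X)"
    and zero: "lin_comb (A_alg d) (t_monomial d s) c = \<zero>\<^bsub>A_alg d\<^esub>" by auto
  have s: "set ts \<subseteq> triples d UNIV" if "ts \<in> keys c" for ts
    using c that triples_mono[of d] by (auto simp: weakly_increasing_lists_def)
  have "lin_comb (A_alg d) (t_monomial d s) c = fib_seq d (comb s c)"
    unfolding comb_def[abs_def] by (rule lin_comb_fib_seq) (auto simp: t_monomial_eq_fib_seq stable_seq_Tm s)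
  then have "fib_seq d (comb s c) = fib_seq d (\<lambda>N. 0)" using zero by (simp add: fib_seq_zero)
  then have z: "comb s c N = 0" if "N \<ge> d" for N
    using that stable_seqD(1)[OF stable_seq_comb[OF s]] by (subst (asm) fib_seq_eq_iff) auto
  \<comment> \<open>The inserted 0 gives the maximum a value when \<open>c\<close> has no
    keys.\<close>
  define K where "K = Max (insert 0 (wts ` keys c))"
  have "wts ts \<le> K" if "ts \<in> keys c" for ts
    unfolding K_def using that by (intro Max_ge) auto
  then show "c = 0"
    using z[of "d + K"] by (intro sorted_monomials_independent[OF r, of K "d + K" c]) (auto simp: c comb_def subsetD[OF c])
next
  fix b :: "nat \<Rightarrow> 'w matr falg set" assume "b \<in> Y_alg d s'"
  then obtain u where "bounded_seq d s u" "b = fib_seq d u" using Y_alg_subset[of d s' s] by auto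
  then show "\<exists>c. keys c \<subseteq> weakly_increasing_lists r (triples d X) \<and> b = lin_comb (A_alg d) (t_monomial d s) c"
    using bounded_seq_lin_comb[OF r] by blast
qed

end

theorem theorem4p3:
  fixes X :: "'w::nonunital_complex_algebra set"
    and d :: nat
    and r :: "((nat \<times> nat \<times> 'w list) \<times> (nat \<times> nat \<times> 'w list)) set"
    and s s' :: complex
  assumes "\<exists>B :: 'w set. countable B \<and> is_linear_basis B"
    and "1 \<le> d"
    and "is_linear_basis X"
    and "linear_order_on (triples d X) r"
  shows "is_basis_family (A_alg d) (Y_alg d s')
           (weakly_increasing_lists r (triples d X)) (t_monomial d s)"
proof -
  interpret algebra_basis X by unfold_locales (rule assms(3))
  show ?thesis by (rule sorted_t_monomials_basis[OF assms(4)])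
qed

end
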